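(* Let $m\in\mathbb{Z}$ be a cube-free integer satisfying $m^2\not\equiv 1\pmod 9$, let $K=\mathbb{Q}(\sqrt[3]{m})$, and let $p\neq 2,3$ be a prime number. For each integer $n\ge 0$, let $A_{K,p,n}$ be the number of orders of $K$ of index $p^i$ for some $i\in\{0,1,2,\ldots,n\}$, and let $B_{K,p,n}$ be the number of monogenic orders of $K$ of index $p^i$ for some $i\in\{0,1,2,\ldots,n\}$. Then $$\left[\frac{n}{3}\right]\le \log_p A_{K,p,n}\le n\quad\text{ and }\quad B_{K,p,n}=O(n).$$ In particular, $$\lim_{n\to\infty}\frac{B_{K,p,n}}{A_{K,p,n}}=0.$$
   Context: $[x]$ denotes the floor of a real number $x$. Let $K$ be a number field of degree $d$ with ring of integers $\mathcal{O}_K$. An order of $K$ is a (unital) subring of $K$ that is a finitely generated $\mathbb{Z}$-submodule of rank $d$; every order is contained in $\mathcal{O}_K$. The index of an order $\mathcal{O}$ is $[\mathcal{O}_K:\mathcal{O}]$. An order $\mathcal{O}$ is monogenic if there is $\alpha\in\mathcal{O}$ with $\mathcal{O}=\mathbb{Z}[\alpha]$. Orders are counted as subsets of $K$ (not up to isomorphism). The notation $O(n)$ refers to $n\to\infty$ with $K$ and $p$ fixed (the implied constant may depend on $K$ and $p$). *)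

theory Defs
  imports
    Complex_Main
    "HOL-Algebra.Algebraic_Closure_Type"
    "HOL-Algebra.Generated_Fields"
    "HOL-Algebra.Generated_Rings"
    "HOL-Computational_Algebra.Computational_Algebra"
    "HOL-Number_Theory.Cong"
    "HOL-Library.Landau_Symbols"
begin

definition cube_free :: "int \<Rightarrow> bool" where
  "cube_free m \<longleftrightarrow> (\<forall>d. d ^ 3 dvd m \<longrightarrow> d dvd 1)"

text \<open>
  Number fields are subfields of an ambient type of class \<^class>\<open>field_char_0\<close>, and
  \<^term>\<open>ring_of_type_algebra\<close> is that type viewed as a ring of HOL-Algebra.
\<close>

definition rat_adjoin :: "'a::field_char_0 \<Rightarrow> 'a set" where
  "rat_adjoin x = generate_field ring_of_type_algebra {x}"

definition int_adjoin :: "'a::field_char_0 \<Rightarrow> 'a set" where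
  "int_adjoin x = generate_ring ring_of_type_algebra {x}"

definition nf_degree :: "'a::field_char_0 set \<Rightarrow> nat" where
  "nf_degree K = vector_space.dim (\<lambda>q x. of_rat q * x) K"

definition ring_of_integers :: "'a::field_char_0 set \<Rightarrow> 'a set" where
  "ring_of_integers K = {x \<in> K. algebraic_int x}"

definition int_span :: "'a::field_char_0 set \<Rightarrow> 'a set" where
  "int_span = module.span (\<lambda>(n::int) x. of_int n * x)"

definition int_independent :: "'a::field_char_0 set \<Rightarrow> bool" where
  "int_independent B \<longleftrightarrow> \<not> module.dependent (\<lambda>(n::int) x. of_int n * x) B"

definition has_int_rank :: "'a::field_char_0 set \<Rightarrow> nat \<Rightarrow> bool" where
  "has_int_rank M r \<longleftrightarrow>
     (\<exists>B\<subseteq>M. int_independent B \<and> finite B \<and> card B = r) \<and>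
     (\<forall>B\<subseteq>M. int_independent B \<longrightarrow> finite B \<and> card B \<le> r)"

definition is_order_of :: "'a::field_char_0 set \<Rightarrow> 'a set \<Rightarrow> bool" where
  "is_order_of K R \<longleftrightarrow>
     R \<subseteq> K \<and> subring R ring_of_type_algebra \<and>
     (\<exists>B. finite B \<and> R = int_span B) \<and> has_int_rank R (nf_degree K)"

text \<open>The index is that of additive groups; \<^const>\<open>card\<close> makes an infinite index \<open>0\<close>,
  which is not a power of a prime.\<close>

definition order_index :: "'a::field_char_0 set \<Rightarrow> 'a set \<Rightarrow> nat" where
  "order_index K R =
     card (a_rcosets\<^bsub>ring_of_type_algebra\<lparr>carrier := ring_of_integers K\<rparr>\<^esub> R)"

definition is_monogenic :: "'a::field_char_0 set \<Rightarrow> bool" where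
  "is_monogenic R \<longleftrightarrow> (\<exists>\<alpha>\<in>R. R = int_adjoin \<alpha>)"

definition num_orders :: "'a::field_char_0 set \<Rightarrow> nat \<Rightarrow> nat \<Rightarrow> nat" where
  "num_orders K p n =
     card {R. is_order_of K R \<and> (\<exists>i\<in>{0..n}. order_index K R = p ^ i)}"

definition num_monogenic_orders :: "'a::field_char_0 set \<Rightarrow> nat \<Rightarrow> nat \<Rightarrow> nat" where
  "num_monogenic_orders K p n =
     card {R. is_order_of K R \<and> is_monogenic R \<and> (\<exists>i\<in>{0..n}. order_index K R = p ^ i)}"

end

theory Submission
  imports Defs "HOL-Number_Theory.Residues"
begin

text \<open>
  Write \<open>m = a * b\<^sup>2\<close> and let \<open>\<theta>\<^sup>3 = m\<close>, \<open>\<eta> = \<theta>\<^sup>2 / b\<close>, so that \<open>1, \<theta>, \<eta>\<close> is an integral basis of \<open>K\<close>.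
  Orders correspond to lattices in \<open>\<int>\<^sup>2\<close> closed under \<open>(y, z) (y', z') = (a z z', b y y')\<close>, and the bounds
  for their number follow from Hermite normal forms. The order \<open>\<int>[y \<theta> + z \<eta>]\<close> has index
  \<open>\<bar>b y\<^sup>3 - a z\<^sup>3\<bar>\<close>. If this is a power of \<open>p\<close>, then \<open>(y, z)\<close> is a power of \<open>p\<close> times a primitive
  solution, so the linear bound amounts to the finiteness of the primitive solutions of the
  Thue-Mahler equation \<open>b y\<^sup>3 - a z\<^sup>3 = \<plusminus> p\<^sup>i\<close>. That finiteness is proved by the hypergeometric method: the
  explicit Pade approximants of the cube root, applied to one large solution, yield approximations of
  the cube root of \<open>m\<close>, real and \<open>p\<close>-adic, that are too good to coexist with a much larger solution.
\<close>

hide_const (open) Divisibility.prime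

section \<open>Pade approximants of the cube root\<close>

text \<open>For a solution of height \<open>H\<close> with right-hand side \<open>c * p ^ z\<close>,
  the real form \<open>X - \<theta> * Y\<close> is at most a constant times
  \<open>p ^ z / H ^ 2\<close>, while the cubic form has size \<open>p ^ (-z)\<close> at
  \<open>p\<close>; the product of both is of order \<open>H ^ (-2)\<close> whatever
  \<open>z\<close> is. Comparing solution 2 with the approximant of degree \<open>n\<close> built
  from solution 1 gives an integer whose real size, divided by its power of \<open>p\<close>, should
  be about \<open>B ^ n * (H2 * H1 ^ (-3 n - 2) + H1 ^ (3 n + 1) * H2 ^ (-2))\<close>. If
  \<open>H2\<close> is near \<open>H1 ^ (2 n + 1)\<close>, both terms are near
  \<open>H1 ^ (-n)\<close>, and a large \<open>H1\<close> beats \<open>B ^ n\<close>. This dictates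
  the shape of the proof. The coefficients must be integers that grow only exponentially in
  \<open>n\<close>. The factors \<open>p ^ z1\<close> and \<open>p ^ z2\<close> cancel only if
  \<open>z2\<close> is close to \<open>(2 n + 1) * z1\<close>, hence a pigeonhole on the ratio of
  \<open>z\<close> to \<open>ln H\<close>. The integer must be nonzero, which is known only for one
  of two consecutive \<open>n\<close>, so the choice of \<open>n\<close> has to leave room for both.
  As a large solution is needed to begin with, the outcome is finiteness without a bound.\<close>

lemma sum_div_node_diffs_shift:
  fixes S :: "'a::field set"
  assumes "finite S" "s \<in> S"
  shows "(\<Sum>e\<in>S. (e - s) * f e / (\<Prod>e'\<in>S-{e}. e - e')) =
         (\<Sum>e\<in>S-{s}. f e / (\<Prod>e'\<in>S-{s}-{e}. e - e'))"
proof -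
  have "(\<Sum>e\<in>S. (e - s) * f e / (\<Prod>e'\<in>S-{e}. e - e')) =
        (\<Sum>e\<in>S-{s}. (e - s) * f e / (\<Prod>e'\<in>S-{e}. e - e'))"
    using assms by (subst sum.remove[of S s]) auto
  also have "\<dots> = (\<Sum>e\<in>S-{s}. f e / (\<Prod>e'\<in>S-{s}-{e}. e - e'))"
  proof (rule sum.cong[OF refl])
    fix e assume e: "e \<in> S - {s}"
    have "(\<Prod>e'\<in>S-{e}. e - e') = (e - s) * (\<Prod>e'\<in>S-{e}-{s}. e - e')"
      using assms e by (subst prod.remove[of _ s]) auto
    moreover have "S - {e} - {s} = S - {s} - {e}" by auto
    ultimately show "(e - s) * f e / (\<Prod>e'\<in>S-{e}. e - e') = f e / (\<Prod>e'\<in>S-{s}-{e}. e - e')"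
      using e by simp
  qed
  finally show ?thesis .
qed

text \<open>The sum is the divided difference of the constant 1. Multiplying it by
  \<open>t - s = (e - s) - (e - t)\<close> leaves a difference of two such sums with one node
  fewer.\<close>

lemma sum_inverse_node_diffs_eq_0:
  fixes S :: "'a::field set"
  assumes "finite S" "card S \<ge> 2"
  shows "(\<Sum>e\<in>S. 1 / (\<Prod>e'\<in>S-{e}. e - e')) = 0"
  using assms
proof (induction "card S" arbitrary: S rule: less_induct)
  case less
  obtain s t where st: "s \<in> S" "t \<in> S" "s \<noteq> t"
    using less.prems by (metis card_le_Suc0_iff_eq not_less_eq_eq numeral_2_eq_2)
  let ?M = "\<lambda>S. \<Sum>e\<in>S. 1 / (\<Prod>e'\<in>S-{e}. e - e')"
  have "(t - s) * ?M S = (\<Sum>e\<in>S. (e - s) * 1 / (\<Prod>e'\<in>S-{e}. e - e')) -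
                         (\<Sum>e\<in>S. (e - t) * 1 / (\<Prod>e'\<in>S-{e}. e - e'))"
    unfolding sum_distrib_left sum_subtractf[symmetric]
    by (rule sum.cong[OF refl]) (simp add: diff_divide_distrib[symmetric])
  also have "\<dots> = ?M (S - {s}) - ?M (S - {t})"
    using less.prems(1) st by (simp only: sum_div_node_diffs_shift)
  also have "\<dots> = 0"
  proof (cases "card S = 2")
    case True
    then have "S = {s, t}"
      using st less.prems(1) by (metis card_2_iff doubleton_eq_iff insert_iff singletonD)
    then show ?thesis using st by (simp add: insert_Diff_if)
  next
    case False
    then have "card (S - {s}) \<ge> 2" "card (S - {t}) \<ge> 2" "card (S - {s}) < card S" "card (S - {t}) < card S"
      using st less.prems by auto
    then show ?thesis using less.hyps[of "S - {s}"] less.hyps[of "S - {t}"] less.prems(1) by simp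
  qed
  finally show ?case using st by simp
qed

text \<open>A divided difference on \<open>card S\<close> nodes annihilates polynomials of degree
  below \<open>card S - 1\<close>: synthetic division at a node lowers the degree and the number of
  nodes together.\<close>

lemma sum_poly_div_node_diffs_eq_0:
  fixes S :: "'a::field set"
  assumes "finite S" "degree f + 2 \<le> card S"
  shows "(\<Sum>e\<in>S. poly f e / (\<Prod>e'\<in>S-{e}. e - e')) = 0"
  using assms
proof (induction "degree f" arbitrary: S f rule: less_induct)
  case less
  obtain s where s: "s \<in> S" using less.prems by fastforce
  define g where "g = synthetic_div f s"
  have f: "poly f e = (e - s) * poly g e + poly f s" for e
    by (subst synthetic_div_correct'[of s f, symmetric]) (simp add: g_def algebra_simps)
  have "(\<Sum>e\<in>S. poly f e / (\<Prod>e'\<in>S-{e}. e - e')) =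
        (\<Sum>e\<in>S. (e - s) * poly g e / (\<Prod>e'\<in>S-{e}. e - e')) +
        poly f s * (\<Sum>e\<in>S. 1 / (\<Prod>e'\<in>S-{e}. e - e'))"
    unfolding sum_distrib_left sum.distrib[symmetric]
    by (rule sum.cong[OF refl]) (subst f, simp add: add_divide_distrib)
  also have "\<dots> = (\<Sum>e\<in>S-{s}. poly g e / (\<Prod>e'\<in>S-{s}-{e}. e - e'))"
    using less.prems s by (simp add: sum_div_node_diffs_shift sum_inverse_node_diffs_eq_0)
  also have "\<dots> = 0"
  proof (cases "degree f = 0")
    case True
    then have "g = 0" by (simp add: g_def synthetic_div_eq_0_iff)
    then show ?thesis by simp
  next
    case False
    have "degree g < degree f" "degree g + 2 \<le> card (S - {s})"
      using False less.prems s by (auto simp: g_def degree_synthetic_div)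
    then show ?thesis using less.hyps[of g "S - {s}"] less.prems(1) by simp
  qed
  finally show ?case .
qed

section \<open>Integrality of rising factorials with step 3\<close>

lemma fact_eq_power_3_times_coprime:
  "\<exists>v m. fact k = (3::int) ^ v * m \<and> coprime m 3 \<and> v \<le> k"
proof (induction k rule: less_induct)
  case (less k)
  \<comment> \<open>Among the factors of \<open>fact (3 * j)\<close>, the multiples of 3 contribute
    \<open>3 ^ j * fact j\<close>, and the remaining ones are coprime to 3.\<close>
  have *: "\<exists>m. fact (3 * j) = (3::int) ^ j * fact j * m \<and> coprime m 3" for j
  proof (induction j)
    case (Suc j)
    then obtain m where m: "fact (3 * j) = (3::int) ^ j * fact j * m" "coprime m 3" by blast
    have "(fact (3 * Suc j) :: int) = (3 * int j + 3) * (3 * int j + 2) * (3 * int j + 1) * fact (3 * j)"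
    proof -
      have "3 * Suc j = Suc (Suc (Suc (3 * j)))" by simp
      then have "(fact (3 * Suc j) :: int) = fact (Suc (Suc (Suc (3 * j))))" by (simp only:)
      also have "\<dots> = (3 * int j + 3) * ((3 * int j + 2) * ((3 * int j + 1) * fact (3 * j)))"
        by (simp add: add_ac)
      finally show ?thesis by (simp only: mult.assoc)
    qed
    also have "\<dots> = 3 ^ Suc j * fact (Suc j) * (m * ((3 * int j + 2) * (3 * int j + 1)))"
    proof -
      have "(fact (Suc j) :: int) = (int j + 1) * fact j" "3 * int j + 3 = 3 * (int j + 1)" by simp_all
      then show ?thesis unfolding m(1) by (simp only: power_Suc mult_ac)
    qed
    finally have "(fact (3 * Suc j) :: int) = 3 ^ Suc j * fact (Suc j) * (m * ((3 * int j + 2) * (3 * int j + 1)))" .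
    moreover have "coprime (3 * int j + 1) 3"
    proof (rule coprimeI)
      fix d :: int assume "d dvd 3 * int j + 1" "d dvd 3"
      then have "d dvd (3 * int j + 1) - 3 * int j" by (intro dvd_diff dvd_mult2)
      then show "d dvd 1" by simp
    qed
    moreover have "coprime (3 * int j + 2) 3"
    proof (rule coprimeI)
      fix d :: int assume "d dvd 3 * int j + 2" "d dvd 3"
      then have "d dvd 3 * (int j + 1) - (3 * int j + 2)" by (intro dvd_diff dvd_mult2)
      then show "d dvd 1" by simp
    qed
    ultimately show ?case using m(2) by (metis coprime_mult_left_iff)
  qed auto
  show ?case
  proof (cases "k = 0")
    case True then show ?thesis by (intro exI[of _ 0] exI[of _ 1]) simp
  next
    case False
    show ?thesis
    proof (cases "3 dvd k")
      case True
      then obtain j where j: "k = 3 * j" by blast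
      with False have "j < k" by simp
      from less.IH[OF this] obtain v m where v: "fact j = (3::int) ^ v * m" "coprime m 3" "v \<le> j" by blast
      obtain m' where m': "fact (3 * j) = (3::int) ^ j * fact j * m'" "coprime m' 3" using * by blast
      have "fact k = (3::int) ^ (j + v) * (m * m')" by (simp add: j m' v power_add)
      then show ?thesis using v m' j by (intro exI[of _ "j + v"] exI[of _ "m * m'"]) auto
    next
      case ndvd: False
      obtain j where j: "k = Suc j" using False by (cases k) auto
      from less.IH[of j] obtain v m where v: "fact j = (3::int) ^ v * m" "coprime m 3" "v \<le> j"
        using j by auto
      have "coprime (int k) 3"
      proof -
        have "prime (3::nat)" by simp
        from prime_imp_coprime[OF this ndvd] have "coprime (int 3) (int k)"
          by (simp only: coprime_int_iff)
        then show ?thesis by (simp add: coprime_commute)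
      qed
      then show ?thesis using v j
        by (intro exI[of _ v] exI[of _ "int k * m"]) (simp add: mult_ac del: of_nat_Suc)
    qed
  qed
qed

lemma prod_consecutive_eq_fact_binomial:
  "(\<Prod>i<k. int N + 1 + int i) = fact k * int ((N + k) choose k)"
proof -
  have "(\<Prod>i<k. int N + 1 + int i) * fact N = fact (N + k)"
  proof (induction k)
    case (Suc k)
    have "(\<Prod>i<Suc k. int N + 1 + int i) * fact N = (int N + 1 + int k) * ((\<Prod>i<k. int N + 1 + int i) * fact N)"
      by simp
    then show ?case unfolding Suc.IH by (simp add: add_ac)
  qed auto
  also have "\<dots> = int (fact k * fact (N + k - k) * ((N + k) choose k))"
    by (subst binomial_fact_lemma) auto
  finally show ?thesis by simp
qed

text \<open>Modulo the part \<open>m\<close> of \<open>fact k\<close> that is prime to 3, the number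
  3 is invertible, and the progression becomes 3 times a run of consecutive integers starting at a
  representative \<open>N + 1\<close> of \<open>r / 3\<close>; such a run has a product divisible by
  \<open>fact k\<close>. The factor \<open>3 ^ k\<close> pays for the 3-part, whose exponent is at
  most \<open>k\<close>.\<close>

lemma fact_dvd_power_3_times_prod:
  fixes r :: int
  shows "fact k dvd 3 ^ k * (\<Prod>i<k. r + 3 * int i)"
proof -
  obtain v m where v: "fact k = (3::int) ^ v * m" "coprime m 3" "v \<le> k"
    using fact_eq_power_3_times_coprime by blast
  have "m > 0" using v(1) by (metis fact_gt_zero zero_less_mult_pos zero_less_numeral zero_less_power)
  obtain s where s: "[3 * s = 1] (mod m)"
    using v(2) by (metis cong_solve_coprime_int coprime_commute)
  define N where "N = nat ((r * s - 1) mod m)"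
  have "int N = (r * s - 1) mod m" using \<open>m > 0\<close> by (simp add: N_def)
  then have N: "[int N + 1 = r * s] (mod m)"
    by (metis cong_add_rcancel cong_mod_left cong_refl diff_add_cancel)
  have "[(\<Prod>i<k. r + 3 * int i) = (\<Prod>i<k. 3 * (int N + 1 + int i))] (mod m)"
  proof (rule cong_prod)
    fix i
    have "[r * 1 + 3 * int i = r * (3 * s) + 3 * int i] (mod m)"
      using s by (intro cong_add cong_mult) (auto simp: cong_sym)
    also have "r * (3 * s) + 3 * int i = 3 * (r * s + int i)" by (simp add: algebra_simps)
    also have "[3 * (r * s + int i) = 3 * (int N + 1 + int i)] (mod m)"
      using N by (intro cong_add cong_mult) (auto simp: cong_sym)
    finally show "[r + 3 * int i = 3 * (int N + 1 + int i)] (mod m)" by simp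
  qed
  moreover have "m dvd (\<Prod>i<k. 3 * (int N + 1 + int i))"
  proof -
    have "m dvd fact k" using v by simp
    then show ?thesis by (simp only: prod.distrib prod_consecutive_eq_fact_binomial) simp
  qed
  ultimately have "m dvd (\<Prod>i<k. r + 3 * int i)" using cong_dvd_iff by blast
  moreover have "(3::int) ^ v dvd 3 ^ k" using v(3) by (simp add: le_imp_power_dvd)
  ultimately show ?thesis unfolding v(1) by (simp add: mult_dvd_mono)
qed

text \<open>The rising factorial of \<open>r / 3\<close> divided by \<open>fact k\<close>, times
  \<open>9 ^ k\<close>: one \<open>3 ^ k\<close> clears the denominators of \<open>r / 3\<close>,
  the other those that \<open>fact k\<close> introduces.\<close>

definition third_poch :: "int \<Rightarrow> nat \<Rightarrow> int" where
  "third_poch r k = 3 ^ k * (\<Prod>i<k. r + 3 * int i) div fact k"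

lemma fact_times_third_poch: "fact k * third_poch r k = 3 ^ k * (\<Prod>i<k. r + 3 * int i)"
  unfolding third_poch_def by (rule dvd_mult_div_cancel[OF fact_dvd_power_3_times_prod])

lemma third_poch_0 [simp]: "third_poch r 0 = 1"
  by (simp add: third_poch_def)

lemma third_poch_pos: "r > 0 \<Longrightarrow> third_poch r k > 0"
proof -
  assume "r > 0"
  then have "0 < fact k * third_poch r k"
    unfolding fact_times_third_poch by (intro mult_pos_pos prod_pos) auto
  then show ?thesis by (simp add: zero_less_mult_iff)
qed

text \<open>Each factor is at most \<open>3 * (N + 1 + i)\<close>, which replaces the product by an
  ordinary binomial coefficient. The growth stays exponential, as the final comparison with
  \<open>H1 ^ n\<close> demands.\<close>

lemma third_poch_le:
  assumes "r > 0" "r \<le> 3 * (int N + 1)"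
  shows "third_poch r k \<le> 9 ^ k * 2 ^ (N + k)"
proof -
  have "fact k * third_poch r k \<le> 3 ^ k * (\<Prod>i<k. 3 * (int N + 1 + int i))"
    unfolding fact_times_third_poch using assms by (intro mult_left_mono prod_mono) auto
  also have "\<dots> = fact k * (9 ^ k * int ((N + k) choose k))"
  proof -
    have "(9::int) ^ k = 3 ^ k * 3 ^ k" by (simp flip: power_mult_distrib)
    then show ?thesis
      by (simp only: prod.distrib prod_consecutive_eq_fact_binomial prod_constant card_lessThan)
         (simp only: mult_ac)
  qed
  finally have "third_poch r k \<le> 9 ^ k * int ((N + k) choose k)"
    using fact_gt_zero mult_le_cancel_left_pos by blast
  also have "int ((N + k) choose k) \<le> int (2 ^ (N + k))"
    by (intro of_nat_mono binomial_le_pow2)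
  finally show ?thesis by simp
qed

lemma third_poch_Suc: "(int k + 1) * third_poch r (Suc k) = 3 * (r + 3 * int k) * third_poch r k"
proof -
  have "fact k * ((int k + 1) * third_poch r (Suc k)) = fact (Suc k) * third_poch r (Suc k)"
    by (simp add: mult_ac)
  also have "\<dots> = 3 * (r + 3 * int k) * (fact k * third_poch r k)"
    unfolding fact_times_third_poch by (simp only: prod.lessThan_Suc power_Suc mult_ac)
  also have "\<dots> = fact k * (3 * (r + 3 * int k) * third_poch r k)"
    by (simp only: mult_ac)
  finally show ?thesis using fact_nonzero mult_left_cancel by blast
qed

text \<open>
  The partial fraction weights \<open>1 / (\<Prod>e' \<noteq> e. e - e')\<close> of the nodes \<open>0, 1, 3, 4, \<dots>, 3 n, 3 n + 1\<close>,
  multiplied by a common factor that makes them integral, are \<open>pade_coeff n k\<close> at \<open>e = 3 k + 1\<close> and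
  \<open>- pade_coeff n (n - k)\<close> at \<open>e = 3 k\<close>. Up to powers of 3 they are the coefficients
  \<open>binomial (n + 1/3) (n - k) * binomial (n - 1/3) k\<close> of the Pade approximants of the cube root.
\<close>

definition pade_coeff :: "nat \<Rightarrow> nat \<Rightarrow> int" where
  "pade_coeff n k = third_poch (3 * int k + 4) (n - k) * third_poch (3 * (int n - int k) + 2) k"

lemma pade_coeff_nonneg: "k \<le> n \<Longrightarrow> pade_coeff n k \<ge> 0"
  unfolding pade_coeff_def by (intro mult_nonneg_nonneg less_imp_le third_poch_pos) auto

lemma pade_coeff_le:
  assumes "k \<le> n"
  shows "pade_coeff n k \<le> 2 * 36 ^ n"
proof -
  have "third_poch (3 * int k + 4) (n - k) \<le> 9 ^ (n - k) * 2 ^ (k + 1 + (n - k))"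
    by (intro third_poch_le) auto
  moreover have "third_poch (3 * (int n - int k) + 2) k \<le> 9 ^ k * 2 ^ (n - k + k)"
    using assms by (intro third_poch_le) (auto simp: of_nat_diff)
  ultimately have "pade_coeff n k \<le> (9 ^ (n - k) * 2 ^ (k + 1 + (n - k))) * (9 ^ k * 2 ^ (n - k + k))"
    unfolding pade_coeff_def using assms
    by (intro mult_mono less_imp_le[OF third_poch_pos]) auto
  also have "\<dots> = (9 ^ (n - k) * 9 ^ k) * (2 ^ (n + 1) * 2 ^ n)"
    using assms by (simp add: mult_ac)
  also have "9 ^ (n - k) * 9 ^ k = (9::int) ^ n" using assms by (simp flip: power_add)
  also have "(9::int) ^ n * (2 ^ (n + 1) * 2 ^ n) = 2 * (9 * (2 * 2)) ^ n"
    by (simp only: power_mult_distrib power_add) (simp only: mult_ac power_one_right)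
  also have "(9 * (2 * 2) :: int) = 36" by simp
  finally show ?thesis .
qed

text \<open>
  The coefficient of \<open>(x - y) ^ j\<close> in \<open>x P(x\<^sup>3, y\<^sup>3) - y P(y\<^sup>3, x\<^sup>3)\<close>, \<open>P = pade n\<close> being the form with
  coefficients \<open>pade_coeff n k\<close>. It is the sum of the values of \<open>e choose j\<close> at the nodes \<open>e\<close> with the
  above weights, and hence vanishes while \<open>j\<close> is at most the number of nodes minus two.
\<close>

definition pade_defect :: "nat \<Rightarrow> nat \<Rightarrow> int" where
  "pade_defect n j = (\<Sum>k\<le>n. pade_coeff n k * int ((3 * k + 1) choose j))
                   - (\<Sum>k\<le>n. pade_coeff n (n - k) * int ((3 * k) choose j))"

section \<open>Order of contact of the approximants\<close>

lemma prod_differences_split: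
  fixes h :: "int \<Rightarrow> real"
  assumes "k \<le> n"
  shows "(\<Prod>j\<in>{..n}-{k}. h (int k - int j)) = (\<Prod>i<k. h (int i + 1)) * (\<Prod>i<n-k. h (- (int i + 1)))"
proof -
  have *: "{..n} - {k} = {..<k} \<union> {k<..n}" using assms by auto
  have "(\<Prod>j\<in>{..n}-{k}. h (int k - int j)) =
      (\<Prod>j<k. h (int k - int j)) * (\<Prod>j\<in>{k<..n}. h (int k - int j))"
    unfolding * by (rule prod.union_disjoint) auto
  also have "(\<Prod>j<k. h (int k - int j)) = (\<Prod>i<k. h (int i + 1))"
    by (rule prod.reindex_bij_witness[of _ "\<lambda>i. k - 1 - i" "\<lambda>i. k - 1 - i"]) (auto simp: of_nat_diff)
  also have "(\<Prod>j\<in>{k<..n}. h (int k - int j)) = (\<Prod>i<n-k. h (- (int i + 1)))"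
    using assms
    by (intro prod.reindex_bij_witness[of _ "\<lambda>i. k + 1 + i" "\<lambda>i. i - (k + 1)"])
       (auto simp: of_nat_diff)
  finally show ?thesis .
qed

lemma prod_arith_split:
  fixes r :: int
  assumes "k \<le> n"
  shows "(\<Prod>i<k. real_of_int (r + 3 * int i)) * (\<Prod>i<n-k. real_of_int (r + 3 * int k + 3 * int i)) =
         (\<Prod>i<n. real_of_int (r + 3 * int i))"
proof -
  have "(\<Prod>i<n. real_of_int (r + 3 * int i)) = (\<Prod>i\<in>{..<k}\<union>{k..<n}. real_of_int (r + 3 * int i))"
    using assms by (intro prod.cong) auto
  also have "\<dots> = (\<Prod>i<k. real_of_int (r + 3 * int i)) * (\<Prod>i\<in>{k..<n}. real_of_int (r + 3 * int i))"
    by (rule prod.union_disjoint) auto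
  also have "(\<Prod>i\<in>{k..<n}. real_of_int (r + 3 * int i)) = (\<Prod>i<n-k. real_of_int (r + 3 * int k + 3 * int i))"
    using assms
    by (intro prod.reindex_bij_witness[of _ "\<lambda>i. k + i" "\<lambda>i. i - k"]) (auto simp: of_nat_diff algebra_simps)
  finally show ?thesis by simp
qed

lemma real_third_poch: "real_of_int (third_poch r k) = 3 ^ k * (\<Prod>i<k. real_of_int (r + 3 * int i)) / fact k"
proof -
  have "real_of_int (fact k * third_poch r k) = real_of_int (3 ^ k * (\<Prod>i<k. r + 3 * int i))"
    by (simp only: fact_times_third_poch)
  then show ?thesis by (simp add: field_simps)
qed

lemma pade_defect_eq_0:
  assumes "j \<le> 2 * n"
  shows "pade_defect n j = 0"
proof -
  define F :: "int \<Rightarrow> nat \<Rightarrow> real" where "F r m = (\<Prod>i<m. real_of_int (r + 3 * int i))" for r m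
  \<comment> \<open>\<open>W k\<close> is the product of the differences between the node
    \<open>3 k + 1\<close> and all other nodes; \<open>N\<close> is the common factor that turns the
    weights \<open>1 / W k\<close> into the integers \<open>pade_coeff n k\<close>.\<close>
  define N where "N = 9 ^ n * F 4 n * F 2 n"
  define W where "W k = 3 ^ n * fact k * fact (n - k) * F 4 k * F 2 (n - k)" for k
  have Fpos: "F r m > 0" if "r > 0" for r m
    unfolding F_def using that by (intro prod_pos) auto
  have Npos: "N > 0" unfolding N_def using Fpos by simp
  have Wpos: "W k > 0" for k unfolding W_def using Fpos by simp
  have cW: "real_of_int (pade_coeff n k) * W k = N" if k: "k \<le> n" for k
  proof -
    have 1: "F 4 k * (\<Prod>i<n-k. real_of_int (3 * int k + 4 + 3 * int i)) = F 4 n"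
      using prod_arith_split[OF k, of 4] by (simp add: F_def add_ac)
    have 2: "F 2 (n-k) * (\<Prod>i<k. real_of_int (3 * (int n - int k) + 2 + 3 * int i)) = F 2 n"
      using prod_arith_split[of "n - k" n 2] k by (simp add: F_def add_ac of_nat_diff)
    have 3: "(3::real) ^ (n - k) * 3 ^ k = 3 ^ n" using k by (simp flip: power_add)
    have 4: "(3::real) ^ n * 3 ^ n = 9 ^ n" by (simp flip: power_mult_distrib)
    have "real_of_int (pade_coeff n k) * W k =
        ((3 ^ (n - k) * 3 ^ k) * 3 ^ n) *
        (F 4 k * (\<Prod>i<n-k. real_of_int (3 * int k + 4 + 3 * int i))) *
        (F 2 (n-k) * (\<Prod>i<k. real_of_int (3 * (int n - int k) + 2 + 3 * int i)))"
      by (simp only: pade_coeff_def W_def of_int_mult real_third_poch) (simp add: field_simps)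
    then show ?thesis by (simp only: 1 2 3 4 N_def)
  qed
  define g0 g1 where "g0 k = real (3 * k)" and "g1 k = real (3 * k + 1)" for k
  define S where "S = g0 ` {..n} \<union> g1 ` {..n}"
  have inj: "inj g0" "inj g1" by (auto simp: inj_def g0_def g1_def)
  have disj: "g0 k \<noteq> g1 l" for k l
    unfolding g0_def g1_def of_nat_eq_iff by presburger
  have dj: "g0 ` A \<inter> g1 ` B = {}" for A B using disj by auto
  have card: "card S = 2 * n + 2"
    unfolding S_def using dj by (subst card_Un_disjoint) (auto simp: card_image inj_on_subset[OF inj(1)] inj_on_subset[OF inj(2)])
  have prod_0: "(\<Prod>l\<in>{..n}-{k}. g0 k - g0 l) = 3 ^ n * fact k * fact (n - k) * (-1) ^ (n - k)" if k: "k \<le> n" for k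
  proof -
    have "(\<Prod>l\<in>{..n}-{k}. g0 k - g0 l) = (\<Prod>l\<in>{..n}-{k}. real_of_int (3 * (int k - int l)))"
      by (simp add: g0_def)
    also have "\<dots> = (\<Prod>i<k. 3 * real (Suc i)) * (\<Prod>i<n-k. (-1) * (3 * real (Suc i)))"
      using prod_differences_split[OF k, of "\<lambda>i. real_of_int (3 * i)"] by (simp add: algebra_simps)
    also have "\<dots> = (3 ^ k * 3 ^ (n - k)) * fact k * fact (n - k) * (-1) ^ (n - k)"
      by (simp only: prod.distrib prod_constant card_lessThan) (simp add: fact_prod_Suc atLeast0LessThan)
    also have "(3::real) ^ k * 3 ^ (n - k) = 3 ^ n" using k by (simp flip: power_add)
    finally show ?thesis .
  qed
  have prod_1: "(\<Prod>l\<le>n. g1 k - g0 l) = F 4 k * F 2 (n - k) * (-1) ^ (n - k)" if k: "k \<le> n" for k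
  proof -
    have "(\<Prod>l\<le>n. g1 k - g0 l) = (\<Prod>l\<in>{..n}-{k}. g1 k - g0 l)"
      using k by (subst prod.remove[of "{..n}" k]) (auto simp: g0_def g1_def)
    also have "\<dots> = (\<Prod>l\<in>{..n}-{k}. real_of_int (3 * (int k - int l) + 1))"
      by (simp add: g0_def g1_def algebra_simps)
    also have "\<dots> = (\<Prod>i<k. real_of_int (4 + 3 * int i)) * (\<Prod>i<n-k. (-1) * real_of_int (2 + 3 * int i))"
      using prod_differences_split[OF k, of "\<lambda>i. real_of_int (3 * i + 1)"] by (simp add: algebra_simps)
    also have "\<dots> = F 4 k * F 2 (n - k) * (-1) ^ (n - k)"
      by (simp only: prod.distrib prod_constant card_lessThan) (simp add: F_def)
    finally show ?thesis .
  qed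
  have prod_2: "(\<Prod>l\<le>n. g0 k - g1 l) = - F 2 k * F 4 (n - k) * (-1) ^ (n - k)" if k: "k \<le> n" for k
  proof -
    have "(\<Prod>l\<le>n. g0 k - g1 l) = - (\<Prod>l\<in>{..n}-{k}. g0 k - g1 l)"
      using k by (subst prod.remove[of "{..n}" k]) (auto simp: g0_def g1_def)
    also have "(\<Prod>l\<in>{..n}-{k}. g0 k - g1 l) = (\<Prod>l\<in>{..n}-{k}. real_of_int (3 * (int k - int l) - 1))"
      by (simp add: g0_def g1_def algebra_simps)
    also have "\<dots> = (\<Prod>i<k. real_of_int (2 + 3 * int i)) * (\<Prod>i<n-k. (-1) * real_of_int (4 + 3 * int i))"
      using prod_differences_split[OF k, of "\<lambda>i. real_of_int (3 * i - 1)"] by (simp add: algebra_simps)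
    also have "\<dots> = F 2 k * F 4 (n - k) * (-1) ^ (n - k)"
      by (simp only: prod.distrib prod_constant card_lessThan) (simp add: F_def)
    finally show ?thesis by simp
  qed
  have sgn: "(-1) ^ (n - k) * (-1) ^ (n - k) = (1::real)" for k
    by (simp flip: power_add)
  have node0: "(\<Prod>e'\<in>S-{g0 k}. g0 k - e') = - W (n - k)" if k: "k \<le> n" for k
  proof -
    have "S - {g0 k} = g0 ` ({..n} - {k}) \<union> g1 ` {..n}"
      unfolding S_def using disj inj(1) by (auto dest: injD)
    then have "(\<Prod>e'\<in>S-{g0 k}. g0 k - e') = (\<Prod>e'\<in>g0 ` ({..n} - {k}). g0 k - e') * (\<Prod>e'\<in>g1 ` {..n}. g0 k - e')"
      using dj by (simp add: prod.union_disjoint)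
    also have "\<dots> = (\<Prod>l\<in>{..n}-{k}. g0 k - g0 l) * (\<Prod>l\<le>n. g0 k - g1 l)"
      by (simp add: prod.reindex inj_on_subset[OF inj(1)] inj_on_subset[OF inj(2)])
    also have "\<dots> = - (3 ^ n * fact k * fact (n - k) * F 4 (n - k) * F 2 k) * ((-1) ^ (n - k) * (-1) ^ (n - k))"
      unfolding prod_0[OF k] prod_2[OF k] by (simp add: mult_ac)
    also have "\<dots> = - W (n - k)" unfolding sgn W_def using k by simp
    finally show ?thesis .
  qed
  have node1: "(\<Prod>e'\<in>S-{g1 k}. g1 k - e') = W k" if k: "k \<le> n" for k
  proof -
    have "S - {g1 k} = g0 ` {..n} \<union> g1 ` ({..n} - {k})"
      unfolding S_def using disj disj[THEN not_sym] inj(2) by (auto dest: injD)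
    then have "(\<Prod>e'\<in>S-{g1 k}. g1 k - e') = (\<Prod>e'\<in>g0 ` {..n}. g1 k - e') * (\<Prod>e'\<in>g1 ` ({..n} - {k}). g1 k - e')"
      using dj by (simp add: prod.union_disjoint)
    also have "\<dots> = (\<Prod>l\<le>n. g1 k - g0 l) * (\<Prod>l\<in>{..n}-{k}. g1 k - g1 l)"
      by (simp add: prod.reindex inj_on_subset[OF inj(1)] inj_on_subset[OF inj(2)])
    also have "(\<Prod>l\<in>{..n}-{k}. g1 k - g1 l) = (\<Prod>l\<in>{..n}-{k}. g0 k - g0 l)"
      by (simp add: g0_def g1_def)
    also have "(\<Prod>l\<le>n. g1 k - g0 l) * \<dots> = 3 ^ n * fact k * fact (n - k) * F 4 k * F 2 (n - k) * ((-1) ^ (n - k) * (-1) ^ (n - k))"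
      unfolding prod_0[OF k] prod_1[OF k] by (simp add: mult_ac)
    also have "\<dots> = W k" unfolding sgn W_def by simp
    finally show ?thesis .
  qed
  \<comment> \<open>This is \<open>e choose j\<close> as a polynomial in \<open>e\<close> of degree
    at most \<open>j\<close>; for \<open>j \<le> 2 n\<close> the \<open>2 n + 2\<close> nodes are
    enough to annihilate it.\<close>
  define f :: "real poly" where "f = smult (1 / fact j) (\<Prod>i<j. [:- real i, 1:])"
  have "degree (\<Prod>i<j. [:- real i, 1:]) \<le> j"
    using degree_prod_sum_le[of "{..<j}" "\<lambda>i. [:- real i, 1:]"] by simp
  then have deg: "degree f + 2 \<le> card S"
    unfolding f_def card using assms degree_smult_le[of "1 / fact j" "\<Prod>i<j. [:- real i, 1:]"] by linarith
  have f: "poly f (real e) = real (e choose j)" for e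
    by (simp add: f_def poly_prod binomial_gbinomial gbinomial_prod_rev atLeast0LessThan)
  have inv0: "1 / (- W (n - k)) = - real_of_int (pade_coeff n (n - k)) / N" if "k \<le> n" for k
    using cW[of "n - k"] Npos Wpos[of "n - k"] by (simp add: field_simps)
  have inv1: "1 / W k = real_of_int (pade_coeff n k) / N" if "k \<le> n" for k
    using cW[of k] that Npos Wpos[of k] by (simp add: field_simps)
  have "0 = (\<Sum>e\<in>S. poly f e / (\<Prod>e'\<in>S-{e}. e - e'))"
    using sum_poly_div_node_diffs_eq_0[OF _ deg] by (simp add: S_def)
  also have "\<dots> = (\<Sum>e\<in>g0 ` {..n}. poly f e / (\<Prod>e'\<in>S-{e}. e - e')) +
                 (\<Sum>e\<in>g1 ` {..n}. poly f e / (\<Prod>e'\<in>S-{e}. e - e'))"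
    unfolding S_def using dj by (intro sum.union_disjoint) auto
  also have "\<dots> = (\<Sum>k\<le>n. poly f (g0 k) * (1 / (- W (n - k)))) + (\<Sum>k\<le>n. poly f (g1 k) * (1 / W k))"
    by (simp add: sum.reindex inj_on_subset[OF inj(1)] inj_on_subset[OF inj(2)] node0 node1)
  also have "\<dots> = (\<Sum>k\<le>n. poly f (g0 k) * (- real_of_int (pade_coeff n (n - k)) / N)) +
                 (\<Sum>k\<le>n. poly f (g1 k) * (real_of_int (pade_coeff n k) / N))"
    by (intro arg_cong2[where f = "(+)"] sum.cong refl) (simp_all only: inv0 inv1 atMost_iff)
  also have "\<dots> = real_of_int (pade_defect n j) / N"
    unfolding g0_def g1_def f pade_defect_def
    by (simp add: sum_divide_distrib diff_divide_distrib sum_negf mult_ac del: of_nat_add of_nat_mult)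
  finally show ?thesis using Npos by simp
qed

definition pade :: "nat \<Rightarrow> 'a::comm_ring_1 \<Rightarrow> 'a \<Rightarrow> 'a" where
  "pade n u v = (\<Sum>k\<le>n. of_int (pade_coeff n k) * u ^ k * v ^ (n - k))"

definition pade_rem :: "nat \<Rightarrow> 'a::comm_ring_1 \<Rightarrow> 'a \<Rightarrow> 'a" where
  "pade_rem n x y = (\<Sum>j\<le>n. of_int (pade_defect n (2 * n + 1 + j)) * (x - y) ^ j * y ^ (n - j))"

lemma power_mult_power_expand:
  fixes x y :: "'a::comm_ring_1"
  assumes "e \<le> N"
  shows "x ^ e * y ^ (N - e) = (\<Sum>j\<le>N. of_int (int (e choose j)) * ((x - y) ^ j * y ^ (N - j)))"
proof -
  have "x ^ e * y ^ (N - e) = ((x - y) + y) ^ e * y ^ (N - e)" by simp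
  also have "\<dots> = (\<Sum>j\<le>e. of_int (int (e choose j)) * ((x - y) ^ j * y ^ (N - j)))"
    unfolding binomial_ring sum_distrib_right
  proof (rule sum.cong[OF refl])
    fix j assume "j \<in> {..e}"
    then have "y ^ (N - j) = y ^ (e - j) * y ^ (N - e)" using assms by (simp flip: power_add)
    then show "of_nat (e choose j) * (x - y) ^ j * y ^ (e - j) * y ^ (N - e) =
               of_int (int (e choose j)) * ((x - y) ^ j * y ^ (N - j))" by (simp add: mult.assoc)
  qed
  also have "\<dots> = (\<Sum>j\<le>N. of_int (int (e choose j)) * ((x - y) ^ j * y ^ (N - j)))"
    using assms by (intro sum.mono_neutral_left) (auto simp: binomial_eq_0)
  finally show ?thesis .
qed

text \<open>Both terms are homogeneous of degree \<open>3 n + 1\<close>, so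
  \<open>x = (x - y) + y\<close> expands them in \<open>(x - y) ^ j * y ^ (3 n + 1 - j)\<close>, and
  the coefficients with \<open>j \<le> 2 n\<close> vanish. The ring is general because the identity
  serves integers (size at \<open>p\<close>), reals (real size) and polynomials
  (independence).\<close>

theorem pade_identity:
  fixes x y :: "'a::comm_ring_1"
  shows "x * pade n (x ^ 3) (y ^ 3) - y * pade n (y ^ 3) (x ^ 3) = (x - y) ^ (2 * n + 1) * pade_rem n x y"
proof -
  define N where "N = 3 * n + 1"
  define T where "T j = (x - y) ^ j * y ^ (N - j)" for j
  have "x * pade n (x ^ 3) (y ^ 3) = (\<Sum>k\<le>n. of_int (pade_coeff n k) * (x ^ (3 * k + 1) * y ^ (N - (3 * k + 1))))"
    unfolding pade_def sum_distrib_left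
    by (rule sum.cong[OF refl])
       (auto simp: N_def power_mult[symmetric] diff_mult_distrib diff_mult_distrib2 mult_ac)
  also have "\<dots> = (\<Sum>k\<le>n. of_int (pade_coeff n k) * (\<Sum>j\<le>N. of_int (int ((3 * k + 1) choose j)) * T j))"
    unfolding T_def by (intro sum.cong refl arg_cong2[where f = "(*)"] power_mult_power_expand) (auto simp: N_def)
  also have "\<dots> = (\<Sum>j\<le>N. of_int (\<Sum>k\<le>n. pade_coeff n k * int ((3 * k + 1) choose j)) * T j)"
    unfolding sum_distrib_left by (subst sum.swap) (simp add: sum_distrib_right mult.assoc)
  finally have 1: "x * pade n (x ^ 3) (y ^ 3) = \<dots>" .
  have *: "n * 3 - (n - k) * 3 = k * 3" if "k \<le> n" for k using that by auto
  have "y * pade n (y ^ 3) (x ^ 3) = (\<Sum>k\<le>n. of_int (pade_coeff n k) * (y ^ (3 * k + 1) * x ^ (3 * (n - k))))"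
    unfolding pade_def sum_distrib_left
    by (rule sum.cong[OF refl]) (auto simp: power_mult[symmetric] mult_ac)
  also have "\<dots> = (\<Sum>k\<le>n. of_int (pade_coeff n (n - k)) * (x ^ (3 * k) * y ^ (N - 3 * k)))"
    using *
    by (intro sum.reindex_bij_witness[of _ "\<lambda>k. n - k" "\<lambda>k. n - k"])
       (auto simp: N_def Suc_diff_le mult_ac)
  also have "\<dots> = (\<Sum>k\<le>n. of_int (pade_coeff n (n - k)) * (\<Sum>j\<le>N. of_int (int ((3 * k) choose j)) * T j))"
    unfolding T_def by (intro sum.cong refl arg_cong2[where f = "(*)"] power_mult_power_expand) (auto simp: N_def)
  also have "\<dots> = (\<Sum>j\<le>N. of_int (\<Sum>k\<le>n. pade_coeff n (n - k) * int ((3 * k) choose j)) * T j)"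
    unfolding sum_distrib_left by (subst sum.swap) (simp add: sum_distrib_right mult.assoc)
  finally have 2: "y * pade n (y ^ 3) (x ^ 3) = \<dots>" .
  have "x * pade n (x ^ 3) (y ^ 3) - y * pade n (y ^ 3) (x ^ 3) = (\<Sum>j\<le>N. of_int (pade_defect n j) * T j)"
    unfolding 1 2 pade_defect_def by (simp only: of_int_diff left_diff_distrib sum_subtractf)
  also have "\<dots> = (\<Sum>j\<in>{2*n+1..N}. of_int (pade_defect n j) * T j)"
    by (rule sum.mono_neutral_right) (auto simp: pade_defect_eq_0 N_def)
  also have "\<dots> = (\<Sum>j\<le>n. of_int (pade_defect n (2*n+1+j)) * T (2*n+1+j))"
    by (rule sum.reindex_bij_witness[of _ "\<lambda>j. 2*n+1+j" "\<lambda>j. j - (2*n+1)"]) (auto simp: N_def)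
  also have "\<dots> = (x - y) ^ (2 * n + 1) * pade_rem n x y"
    unfolding pade_rem_def sum_distrib_left
    by (rule sum.cong[OF refl]) (auto simp: T_def N_def power_add mult_ac)
  finally show ?thesis .
qed

section \<open>Scaling, congruences and size of the approximants\<close>

lemma pade_scale: "pade n (t * u) (t * v) = t ^ n * pade n u v"
  unfolding pade_def sum_distrib_left
proof (rule sum.cong[OF refl])
  fix k assume "k \<in> {..n}"
  then have "t ^ n = t ^ k * t ^ (n - k)" by (simp flip: power_add)
  then show "of_int (pade_coeff n k) * (t * u) ^ k * (t * v) ^ (n - k) = t ^ n * (of_int (pade_coeff n k) * u ^ k * v ^ (n - k))"
    by (simp add: power_mult_distrib mult_ac)
qed

lemma of_int_pade: "of_int (pade n u v) = pade n (of_int u) (of_int v)"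
  by (simp add: pade_def)

lemma cong_pade: "[u = u'] (mod q) \<Longrightarrow> [v = v'] (mod q) \<Longrightarrow> [pade n u v = pade n u' v'] (mod (q::int))"
  unfolding pade_def by (intro cong_sum cong_mult cong_pow) auto

text \<open>Absorbs the number of summands into the exponential constant of each bound.\<close>

lemma Suc_le_power_2: "of_nat (n + 1) \<le> (2::'a::linordered_semidom) ^ n"
proof -
  have "n + 1 \<le> (2::nat) ^ n" by (induction n) auto
  then have "of_nat (n + 1) \<le> (of_nat (2 ^ n) :: 'a)" by (simp only: of_nat_le_iff)
  then show ?thesis by (simp only: of_nat_power of_nat_numeral)
qed

lemma abs_pade_le:
  fixes u v :: real
  assumes "\<bar>u\<bar> \<le> M" "\<bar>v\<bar> \<le> M"
  shows "\<bar>pade n u v\<bar> \<le> 2 * 72 ^ n * M ^ n"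
proof -
  have "M \<ge> 0" using assms by linarith
  have "\<bar>pade n u v\<bar> \<le> (\<Sum>k\<le>n. \<bar>real_of_int (pade_coeff n k) * u ^ k * v ^ (n - k)\<bar>)"
    unfolding pade_def by (rule sum_abs)
  also have "\<dots> \<le> (\<Sum>k\<le>n. 2 * 36 ^ n * M ^ n)"
  proof (rule sum_mono)
    fix k assume k: "k \<in> {..n}"
    have "\<bar>real_of_int (pade_coeff n k) * u ^ k * v ^ (n - k)\<bar> =
          real_of_int (pade_coeff n k) * (\<bar>u\<bar> ^ k * \<bar>v\<bar> ^ (n - k))"
      using k pade_coeff_nonneg[of k n] by (simp add: abs_mult power_abs)
    also have "\<dots> \<le> real_of_int (2 * 36 ^ n) * (M ^ k * M ^ (n - k))"
      using k pade_coeff_le[of k n] pade_coeff_nonneg[of k n] assms \<open>M \<ge> 0\<close>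
      by (intro mult_mono power_mono) (auto simp del: of_int_mult)
    also have "M ^ k * M ^ (n - k) = M ^ n" using k by (simp flip: power_add)
    finally show "\<bar>real_of_int (pade_coeff n k) * u ^ k * v ^ (n - k)\<bar> \<le> 2 * 36 ^ n * M ^ n" by simp
  qed
  also have "\<dots> = real (n + 1) * (2 * 36 ^ n * M ^ n)" by simp
  also have "\<dots> \<le> 2 ^ n * (2 * 36 ^ n * M ^ n)"
    using \<open>M \<ge> 0\<close> by (intro mult_right_mono Suc_le_power_2) simp
  also have "\<dots> = 2 * (2 * 36) ^ n * M ^ n" by (simp only: power_mult_distrib mult_ac)
  finally show ?thesis by simp
qed

text \<open>The base is \<open>2 * 36 * 8\<close>: 36 from the coefficients, 8 from binomial
  coefficients bounded by \<open>2 ^ (3 n + 1)\<close>, and 2 for the number of summands.\<close>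

lemma abs_pade_defect_le: "\<bar>pade_defect n j\<bar> \<le> 8 * 576 ^ n"
proof -
  have bin: "int (e choose j) \<le> 2 * 8 ^ n" if "e \<le> 3 * n + 1" for e
  proof -
    have "e choose j \<le> 2 ^ e" by (rule binomial_le_pow2)
    also have "(2::nat) ^ e \<le> 2 ^ (3 * n + 1)" using that by (intro power_increasing) auto
    also have "\<dots> = 2 * 8 ^ n" by (simp add: power_mult)
    finally show ?thesis by (metis of_nat_le_iff of_nat_mult of_nat_numeral of_nat_power)
  qed
  have le: "0 \<le> pade_coeff n k * int (e choose j) \<and> pade_coeff n k * int (e choose j) \<le> (2 * 36 ^ n) * (2 * 8 ^ n)"
    if "k \<le> n" "e \<le> 3 * n + 1" for k e
    using pade_coeff_nonneg[OF that(1)] pade_coeff_le[OF that(1)] bin[OF that(2)]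
    by (intro conjI mult_mono mult_nonneg_nonneg) auto
  let ?A = "\<Sum>k\<le>n. pade_coeff n k * int ((3 * k + 1) choose j)"
  let ?B = "\<Sum>k\<le>n. pade_coeff n (n - k) * int ((3 * k) choose j)"
  let ?C = "(2 * 36 ^ n) * (2 * 8 ^ n) :: int"
  have "?A \<ge> 0" "?B \<ge> 0" by (auto intro!: sum_nonneg simp: le)
  moreover have "?A \<le> (\<Sum>k\<le>n. ?C)" by (rule sum_mono) (use le in auto)
  moreover have "?B \<le> (\<Sum>k\<le>n. ?C)" by (rule sum_mono) (use le in auto)
  moreover have "(\<Sum>k\<le>n. ?C) \<le> 4 * 576 ^ n"
  proof -
    have "(\<Sum>k\<le>n. ?C) = int (n + 1) * ?C" by simp
    also have "\<dots> \<le> 2 ^ n * ?C" by (intro mult_right_mono Suc_le_power_2) simp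
    also have "\<dots> = 2 * (2 * (2 * (36 * 8)) ^ n)" by (simp only: power_mult_distrib mult_ac)
    finally show ?thesis by simp
  qed
  ultimately show ?thesis unfolding pade_defect_def abs_le_iff by linarith
qed

lemma abs_pade_rem_le:
  fixes x y :: real
  assumes "\<bar>x - y\<bar> \<le> M" "\<bar>y\<bar> \<le> M"
  shows "\<bar>pade_rem n x y\<bar> \<le> 8 * 1152 ^ n * M ^ n"
proof -
  have "M \<ge> 0" using assms by linarith
  have "\<bar>pade_rem n x y\<bar> \<le> (\<Sum>j\<le>n. \<bar>real_of_int (pade_defect n (2 * n + 1 + j)) * (x - y) ^ j * y ^ (n - j)\<bar>)"
    unfolding pade_rem_def by (rule sum_abs)
  also have "\<dots> \<le> (\<Sum>j\<le>n. 8 * 576 ^ n * M ^ n)"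
  proof (rule sum_mono)
    fix j assume j: "j \<in> {..n}"
    let ?d = "pade_defect n (2 * n + 1 + j)"
    have "\<bar>real_of_int ?d * (x - y) ^ j * y ^ (n - j)\<bar> =
          real_of_int \<bar>?d\<bar> * (\<bar>x - y\<bar> ^ j * \<bar>y\<bar> ^ (n - j))"
      by (simp add: abs_mult power_abs)
    also have "\<dots> \<le> real_of_int (8 * 576 ^ n) * (M ^ j * M ^ (n - j))"
      using abs_pade_defect_le[of n "2 * n + 1 + j"] assms \<open>M \<ge> 0\<close>
      by (intro mult_mono power_mono) (auto simp del: of_int_mult)
    also have "M ^ j * M ^ (n - j) = M ^ n" using j by (simp flip: power_add)
    finally show "\<bar>real_of_int ?d * (x - y) ^ j * y ^ (n - j)\<bar> \<le> 8 * 576 ^ n * M ^ n" by simp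
  qed
  also have "\<dots> = real (n + 1) * (8 * 576 ^ n * M ^ n)" by simp
  also have "\<dots> \<le> 2 ^ n * (8 * 576 ^ n * M ^ n)"
    using \<open>M \<ge> 0\<close> by (intro mult_right_mono Suc_le_power_2) simp
  also have "\<dots> = 8 * (2 * 576) ^ n * M ^ n" by (simp only: power_mult_distrib mult_ac)
  finally show ?thesis by simp
qed

section \<open>Independence of consecutive approximants\<close>

lemma linear_power_dvd_mult_cancel:
  fixes q g :: "'a::idom poly"
  assumes "[:- c, 1:] ^ j dvd q * g" "poly q c \<noteq> 0"
  shows "[:- c, 1:] ^ j dvd g"
proof (cases "g = 0")
  case False
  with assms have "q * g \<noteq> 0" by auto
  moreover have "order c q = 0" using assms(2) by (rule order_0I)
  ultimately show ?thesis using assms(1) False order_mult[of q g c] by (simp add: order_divides)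
qed simp

text \<open>As \<open>x ^ 3 - 1 = (x - 1) * (x ^ 2 + x + 1)\<close> and the second factor is 3 at 1,
  substituting \<open>x ^ 3\<close> for \<open>x\<close> does not raise the order of vanishing at
  1.\<close>

lemma power_dvd_of_dvd_pcompose_cube:
  fixes f :: "real poly"
  assumes "[:-1, 1:] ^ j dvd pcompose f ([:0, 1:] ^ 3)"
  shows "[:-1, 1:] ^ j dvd f"
  using assms
proof (induction j arbitrary: f)
  case (Suc j)
  let ?x = "[:0, 1:] :: real poly" and ?l = "[:-1, 1:] :: real poly" and ?q = "[:1, 1, 1:] :: real poly"
  have "?l dvd pcompose f (?x ^ 3)" using Suc.prems by (metis dvd_mult_left power_Suc)
  then have "poly (pcompose f (?x ^ 3)) 1 = 0" by (simp add: poly_eq_0_iff_dvd)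
  then have "poly f 1 = 0" by (simp add: poly_pcompose)
  then obtain g where g: "f = ?l * g" by (auto simp: poly_eq_0_iff_dvd elim: dvdE)
  have "pcompose ?l (?x ^ 3) = ?l * ?q"
    by (simp add: pcompose_pCons power3_eq_cube)
  then have "pcompose f (?x ^ 3) = ?l * (?q * pcompose g (?x ^ 3))"
    by (simp only: g pcompose_mult mult.assoc)
  then have "?l * ?l ^ j dvd ?l * (?q * pcompose g (?x ^ 3))"
    using Suc.prems by (simp only: power_Suc)
  then have "?l ^ j dvd ?q * pcompose g (?x ^ 3)" by (simp only: dvd_mult_cancel_left) simp
  then have "?l ^ j dvd pcompose g (?x ^ 3)" by (rule linear_power_dvd_mult_cancel) simp
  from Suc.IH[OF this] show ?case unfolding g power_Suc by (intro mult_dvd_mono dvd_refl)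
qed auto

definition pade_poly :: "nat \<Rightarrow> real poly" where
  "pade_poly n = (\<Sum>k\<le>n. monom (of_int (pade_coeff n k)) k)"

definition pade_poly_rev :: "nat \<Rightarrow> real poly" where
  "pade_poly_rev n = (\<Sum>k\<le>n. monom (of_int (pade_coeff n (n - k))) k)"

lemma pcompose_monom: "pcompose (monom c k) p = smult c (p ^ k)"
  by (induction k) (auto simp: monom_0 monom_Suc pcompose_pCons mult_ac)

lemma pcompose_pade_poly: "pcompose (pade_poly n) p = pade n p 1"
  by (simp add: pade_poly_def pade_def pcompose_sum pcompose_monom of_int_poly)

lemma pcompose_pade_poly_rev: "pcompose (pade_poly_rev n) p = pade n 1 p"
  unfolding pade_poly_rev_def pade_def pcompose_sum pcompose_monom
  by (rule sum.reindex_bij_witness[of _ "\<lambda>k. n - k" "\<lambda>k. n - k"]) (auto simp: of_int_poly)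

lemma homogenize_sum:
  fixes u v :: real
  assumes "v \<noteq> 0"
  shows "(\<Sum>k\<le>n. c k * u ^ k * v ^ (n - k)) = v ^ n * (\<Sum>k\<le>n. c k * (u / v) ^ k)"
  unfolding sum_distrib_left
proof (rule sum.cong[OF refl])
  fix k assume "k \<in> {..n}"
  then have "v ^ n = v ^ k * v ^ (n - k)" by (simp flip: power_add)
  then show "c k * u ^ k * v ^ (n - k) = v ^ n * (c k * (u / v) ^ k)"
    using assms by (simp add: power_divide)
qed

lemma pade_eq_poly:
  fixes u v :: real
  assumes "v \<noteq> 0"
  shows "pade n u v = v ^ n * poly (pade_poly n) (u / v)"
  unfolding pade_def by (subst homogenize_sum[OF assms]) (simp add: pade_poly_def poly_sum poly_monom)

lemma pade_eq_poly_rev: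
  fixes u v :: real
  assumes "v \<noteq> 0"
  shows "pade n v u = v ^ n * poly (pade_poly_rev n) (u / v)"
proof -
  have "pade n v u = (\<Sum>k\<le>n. of_int (pade_coeff n (n - k)) * u ^ k * v ^ (n - k))"
    unfolding pade_def
    by (rule sum.reindex_bij_witness[of _ "\<lambda>k. n - k" "\<lambda>k. n - k"]) (auto simp: mult_ac)
  then show ?thesis by (simp only: homogenize_sum[OF assms]) (simp add: pade_poly_rev_def poly_sum poly_monom)
qed

lemma pade_poly_rational_approx:
  "[:-1, 1:] ^ (2 * n + 1) dvd [:0, 1:] * pcompose (pade_poly n) ([:0, 1:] ^ 3) - pcompose (pade_poly_rev n) ([:0, 1:] ^ 3)"
proof -
  have "[:0, 1:] - 1 = ([:-1, 1:] :: real poly)" by (simp add: one_pCons)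
  then show ?thesis
    using pade_identity[of "[:0, 1:] :: real poly" n 1]
    by (simp only: pcompose_pade_poly pcompose_pade_poly_rev power_one mult_1_left dvd_triv_left)
qed

definition pade_det :: "nat \<Rightarrow> real poly" where
  "pade_det n = pade_poly n * pade_poly_rev (Suc n) - pade_poly (Suc n) * pade_poly_rev n"

text \<open>After substituting \<open>x ^ 3\<close>, the determinant times \<open>x\<close> is a
  combination of the two remainders \<open>x * P - Q\<close>, each divisible by
  \<open>(x - 1) ^ (2 n + 1)\<close>; the factor \<open>x\<close> does not vanish at 1.\<close>

lemma power_dvd_pade_det: "[:-1, 1:] ^ (2 * n + 1) dvd pade_det n"
proof (rule power_dvd_of_dvd_pcompose_cube)
  let ?x = "[:0, 1:] :: real poly" and ?l = "[:-1, 1:] :: real poly"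
  define P Q where "P k = pcompose (pade_poly k) (?x ^ 3)" and "Q k = pcompose (pade_poly_rev k) (?x ^ 3)" for k
  have dvd: "?l ^ (2 * n + 1) dvd ?x * P k - Q k" if "n \<le> k" for k
    using pade_poly_rational_approx[of k] that unfolding P_def Q_def
    by (meson add_le_mono1 dvd_trans le_imp_power_dvd mult_le_mono2)
  have "?x * (P n * Q (Suc n) - P (Suc n) * Q n) = (?x * P n - Q n) * Q (Suc n) - (?x * P (Suc n) - Q (Suc n)) * Q n"
    by (simp add: algebra_simps)
  then have "?l ^ (2 * n + 1) dvd ?x * (P n * Q (Suc n) - P (Suc n) * Q n)"
    using dvd[of n] dvd[of "Suc n"] by (metis dvd_diff dvd_mult2 le_refl le_SucI)
  then have "?l ^ (2 * n + 1) dvd P n * Q (Suc n) - P (Suc n) * Q n"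
    by (rule linear_power_dvd_mult_cancel) simp
  then show "?l ^ (2 * n + 1) dvd pcompose (pade_det n) (?x ^ 3)"
    by (simp add: pade_det_def P_def Q_def pcompose_diff pcompose_mult)
qed

lemma degree_pade_poly_le: "degree (pade_poly n) \<le> n" "degree (pade_poly_rev n) \<le> n"
  unfolding pade_poly_def pade_poly_rev_def
  by (auto intro!: degree_sum_le order.trans[OF degree_monom_le])

text \<open>At 0 only the constant terms \<open>third_poch 4\<close> and \<open>third_poch 2\<close>
  remain. Their recurrences in \<open>n\<close> have different ratios, and the determinant comes out
  as \<open>- 6 * a * b / (n + 1)\<close>.\<close>

lemma pade_det_at_0: "poly (pade_det n) 0 \<noteq> 0"
proof -
  have sum0: "(\<Sum>k\<le>m. c k * (0::real) ^ k) = c 0" for m and c :: "nat \<Rightarrow> real"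
    by (subst sum.remove[of _ 0]) auto
  have P: "poly (pade_poly m) 0 = of_int (third_poch 4 m)" "poly (pade_poly_rev m) 0 = of_int (third_poch 2 m)" for m
    by (simp_all add: pade_poly_def pade_poly_rev_def poly_sum poly_monom sum0 pade_coeff_def)
  define a b :: real where "a = of_int (third_poch 4 n)" and "b = of_int (third_poch 2 n)"
  have pos: "a > 0" "b > 0" by (simp_all add: a_def b_def third_poch_pos)
  have Suc: "(real n + 1) * of_int (third_poch r (Suc n)) = 3 * (of_int r + 3 * real n) * of_int (third_poch r n)" for r
  proof -
    have "real_of_int ((int n + 1) * third_poch r (Suc n)) = real_of_int (3 * (r + 3 * int n) * third_poch r n)"
      by (simp only: third_poch_Suc)
    then show ?thesis by simp
  qed
  have "(real n + 1) * poly (pade_det n) 0 = a * (3 * (2 + 3 * real n) * b) - b * (3 * (4 + 3 * real n) * a)"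
  proof -
    have "(real n + 1) * poly (pade_det n) 0 =
        a * ((real n + 1) * of_int (third_poch 2 (Suc n))) - b * ((real n + 1) * of_int (third_poch 4 (Suc n)))"
      by (simp add: pade_det_def P a_def b_def algebra_simps)
    then show ?thesis unfolding Suc by (simp add: a_def b_def)
  qed
  also have "\<dots> = - 6 * (a * b)" by (simp add: algebra_simps)
  finally show ?thesis using pos by (metis less_numeral_extra(3) mult_eq_0_iff mult_pos_pos neg_equal_0_iff_equal zero_neq_numeral)
qed

text \<open>The zero at 1 exhausts the degree, which is at most \<open>2 n + 1\<close>, so the
  determinant is a constant times \<open>(s - 1) ^ (2 n + 1)\<close>; the value at 0 shows that this
  constant is not 0.\<close>

lemma poly_pade_det_nonzero:
  assumes "s \<noteq> 1"
  shows "poly (pade_det n) s \<noteq> 0"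
proof -
  obtain h where h: "pade_det n = [:-1, 1:] ^ (2 * n + 1) * h" using power_dvd_pade_det by (blast elim: dvdE)
  have "pade_det n \<noteq> 0" using pade_det_at_0[of n] by auto
  then have "h \<noteq> 0" using h by auto
  have "degree (pade_det n) \<le> 2 * n + 1"
    unfolding pade_det_def
    by (intro degree_diff_le order.trans[OF degree_mult_le])
       (use degree_pade_poly_le[of n] degree_pade_poly_le[of "Suc n"] in linarith)+
  moreover have "degree (pade_det n) = 2 * n + 1 + degree h"
  proof -
    have "[:-1, 1:] ^ (2 * n + 1) \<noteq> (0 :: real poly)" by (rule power_not_zero) simp
    from degree_mult_eq[OF this \<open>h \<noteq> 0\<close>] show ?thesis
      by (simp only: h degree_linear_power)
  qed
  ultimately have "degree h = 0" by simp
  then obtain c where "h = [:c:]" by (rule degree_eq_zeroE)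
  then show ?thesis using \<open>h \<noteq> 0\<close> assms unfolding h by (simp add: poly_power)
qed

lemma pade_linear_independent:
  fixes u v g h :: real
  assumes "u \<noteq> v" "v \<noteq> 0"
    and "g * pade n u v = h * pade n v u" "g * pade (Suc n) u v = h * pade (Suc n) v u"
  shows "g = 0 \<and> h = 0"
proof -
  define s where "s = u / v"
  have "s \<noteq> 1" using assms by (simp add: s_def)
  define p q where "p k = poly (pade_poly k) s" and "q k = poly (pade_poly_rev k) s" for k
  have 1: "g * p n = h * q n" "g * p (Suc n) = h * q (Suc n)"
    using assms by (auto simp: pade_eq_poly[OF assms(2)] pade_eq_poly_rev[OF assms(2)] p_def q_def s_def)
  have "g * (p n * q (Suc n) - p (Suc n) * q n) = (g * p n) * q (Suc n) - (g * p (Suc n)) * q n"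
    by (simp add: algebra_simps)
  also have "\<dots> = 0" unfolding 1 by simp
  finally have g: "g * (p n * q (Suc n) - p (Suc n) * q n) = 0" .
  have "h * (p n * q (Suc n) - p (Suc n) * q n) = p n * (h * q (Suc n)) - p (Suc n) * (h * q n)"
    by (simp add: algebra_simps)
  also have "\<dots> = 0" unfolding 1[symmetric] by simp
  finally have h: "h * (p n * q (Suc n) - p (Suc n) * q n) = 0" .
  have "p n * q (Suc n) - p (Suc n) * q n \<noteq> 0"
    using poly_pade_det_nonzero[OF \<open>s \<noteq> 1\<close>, of n] by (simp add: pade_det_def p_def q_def)
  then show ?thesis using g h by simp
qed

section \<open>A cubic Thue-Mahler equation\<close>

text \<open>
  For two points with \<open>Xi\<^sup>3 - m * Yi\<^sup>3\<close> close to 0 at the real place and at \<open>p\<close>, this integer compares the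
  approximation \<open>X2 / Y2\<close> of the cube root of \<open>m\<close> with the one that the Pade approximant yields from
  \<open>X1 / Y1\<close>. It is divisible by a high power of \<open>p\<close>, yet small.
\<close>

definition pade_form :: "nat \<Rightarrow> int \<Rightarrow> int \<Rightarrow> int \<Rightarrow> int \<Rightarrow> int \<Rightarrow> int" where
  "pade_form n m X1 Y1 X2 Y2 =
     X1 * Y2 * pade n (X1 ^ 3) (m * Y1 ^ 3) - Y1 * X2 * pade n (m * Y1 ^ 3) (X1 ^ 3)"

text \<open>The cofactor \<open>A ^ 2 + A * B + B ^ 2\<close> is \<open>3 * A ^ 2\<close> modulo
  \<open>p\<close>, hence prime to \<open>p\<close>, and the whole power of \<open>p\<close> falls
  on \<open>A - B\<close>. This uniqueness of \<open>p\<close>-adic cube roots is why solutions get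
  sorted by residues modulo \<open>p\<close>; it returns when orders are counted.\<close>

lemma power_dvd_diff_of_cubes:
  fixes p A B :: int
  assumes "prime p" "p \<noteq> 3" "\<not> p dvd A" "[A = B] (mod p)" "p ^ k dvd A ^ 3 - B ^ 3"
  shows "p ^ k dvd A - B"
proof -
  have "\<not> p dvd A\<^sup>2 + A * B + B\<^sup>2"
  proof
    assume "p dvd A\<^sup>2 + A * B + B\<^sup>2"
    moreover have "[A\<^sup>2 + A * B + B\<^sup>2 = A\<^sup>2 + A * A + A\<^sup>2] (mod p)"
      using assms(4) by (intro cong_add cong_mult cong_pow) (auto simp: cong_sym)
    ultimately have "p dvd A\<^sup>2 + A * A + A\<^sup>2" using cong_dvd_iff by blast
    also have "A\<^sup>2 + A * A + A\<^sup>2 = 3 * (A * A)" by (simp add: power2_eq_square)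
    finally have "p dvd 3" using assms by (auto simp: prime_dvd_mult_iff)
    moreover have "prime (3::int)" by simp
    ultimately show False using assms(1,2) primes_dvd_imp_eq by blast
  qed
  then have "coprime (p ^ k) (A\<^sup>2 + A * B + B\<^sup>2)"
    using assms(1) by (simp add: prime_imp_coprime)
  moreover have "A ^ 3 - B ^ 3 = (A - B) * (A\<^sup>2 + A * B + B\<^sup>2)"
    by (simp add: algebra_simps power2_eq_square power3_eq_cube)
  ultimately show ?thesis using assms(5) by (simp add: coprime_dvd_mult_left_iff)
qed

text \<open>The \<open>p\<close>-adic estimate. The two equations make the cubes of
  \<open>A = X1 * Y2\<close> and \<open>B = X2 * Y1\<close> agree modulo
  \<open>p ^ min z1 z2\<close>, hence also \<open>A\<close> and \<open>B\<close>, and the Pade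
  identity raises this to the power \<open>2 n + 1\<close>. Replacing \<open>B ^ 3\<close> by
  \<open>Y2 ^ 3 * (m * Y1 ^ 3)\<close> costs only a multiple of \<open>p ^ z2\<close>; then
  \<open>Y2 ^ (3 n)\<close>, which is prime to \<open>p\<close>, splits off.\<close>

lemma pade_form_divisible:
  fixes p m c X1 Y1 X2 Y2 :: int
  assumes p: "prime p" "p \<noteq> 3" "\<not> p dvd m"
    and eq1: "X1 ^ 3 - m * Y1 ^ 3 = c * p ^ z1" and eq2: "X2 ^ 3 - m * Y2 ^ 3 = c * p ^ z2"
    and prim1: "\<not> (p dvd X1 \<and> p dvd Y1)" and prim2: "\<not> (p dvd X2 \<and> p dvd Y2)"
    and cong: "[X1 = X2] (mod p)" "[Y1 = Y2] (mod p)"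
  shows "p ^ min ((2 * n + 1) * z1) z2 dvd pade_form n m X1 Y1 X2 Y2"
proof (cases "z1 = 0 \<or> z2 = 0")
  case True
  then show ?thesis by auto
next
  case False
  have nd: "\<not> p dvd U \<and> \<not> p dvd V"
    if "U ^ 3 - m * V ^ 3 = c * p ^ z" "\<not> (p dvd U \<and> p dvd V)" "z \<noteq> 0" for U V z
  proof -
    have "p dvd U ^ 3 - m * V ^ 3" unfolding that(1) using that(3) by simp
    then have "p dvd U ^ 3 \<longleftrightarrow> p dvd m * V ^ 3" by (intro cong_dvd_iff) (simp add: cong_iff_dvd_diff)
    then have "p dvd U \<longleftrightarrow> p dvd V"
      using p by (auto simp: prime_dvd_mult_iff prime_dvd_power_iff)
    then show ?thesis using that(2) by blast
  qed
  have pw: "p ^ k dvd c * p ^ z * w" if "k \<le> z" for k z w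
    by (rule dvd_mult2[OF dvd_mult[OF le_imp_power_dvd[OF that]]])
  have nd1: "\<not> p dvd X1" "\<not> p dvd Y1" and nd2: "\<not> p dvd X2" "\<not> p dvd Y2"
    using nd[OF eq1 prim1] nd[OF eq2 prim2] False by auto
  define A B where "A = X1 * Y2" and "B = X2 * Y1"
  have cA: "A ^ 3 = Y2 ^ 3 * X1 ^ 3" by (simp add: A_def power_mult_distrib mult_ac)
  have "A ^ 3 - B ^ 3 = c * p ^ z1 * Y2 ^ 3 - c * p ^ z2 * Y1 ^ 3"
    unfolding eq1[symmetric] eq2[symmetric] A_def B_def by (simp add: power_mult_distrib algebra_simps)
  also have "p ^ min z1 z2 dvd \<dots>"
    by (intro dvd_diff pw) auto
  finally have cubes: "p ^ min z1 z2 dvd A ^ 3 - B ^ 3" .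
  have "\<not> p dvd A" using p(1) nd1 nd2 by (simp add: A_def prime_dvd_mult_iff)
  moreover have "[A = B] (mod p)"
    unfolding A_def B_def by (rule cong_mult[OF cong(1) cong_sym[OF cong(2)]])
  ultimately have "p ^ min z1 z2 dvd A - B"
    using power_dvd_diff_of_cubes[OF p(1,2) _ _ cubes] by blast
  then have "(p ^ min z1 z2) ^ (2 * n + 1) dvd (A - B) ^ (2 * n + 1) * pade_rem n A B"
    by (intro dvd_mult2 dvd_power_same)
  moreover have "p ^ min ((2 * n + 1) * z1) z2 dvd (p ^ min z1 z2) ^ (2 * n + 1)"
  proof -
    have "z2 * 1 \<le> z2 * (2 * n + 1)" by (rule mult_le_mono2) simp
    then have "min ((2 * n + 1) * z1) z2 \<le> min z1 z2 * (2 * n + 1)"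
      by (cases "z1 \<le> z2") (simp_all add: mult.commute min.coboundedI2 min.coboundedI1 min_absorb1 min_absorb2)
    then show ?thesis unfolding power_mult[symmetric] by (rule le_imp_power_dvd)
  qed
  ultimately have "p ^ min ((2 * n + 1) * z1) z2 dvd A * pade n (A ^ 3) (B ^ 3) - B * pade n (B ^ 3) (A ^ 3)"
    unfolding pade_identity by (rule dvd_trans[rotated])
  moreover have "[A * pade n (A ^ 3) (B ^ 3) - B * pade n (B ^ 3) (A ^ 3) =
      A * pade n (Y2 ^ 3 * X1 ^ 3) (Y2 ^ 3 * (m * Y1 ^ 3)) - B * pade n (Y2 ^ 3 * (m * Y1 ^ 3)) (Y2 ^ 3 * X1 ^ 3)]
      (mod p ^ min ((2 * n + 1) * z1) z2)"
  proof -
    have "B ^ 3 - Y2 ^ 3 * (m * Y1 ^ 3) = c * p ^ z2 * Y1 ^ 3"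
      unfolding eq2[symmetric] B_def by (simp add: power_mult_distrib algebra_simps)
    moreover have "p ^ min ((2 * n + 1) * z1) z2 dvd c * p ^ z2 * Y1 ^ 3"
      by (intro pw) auto
    ultimately have "[B ^ 3 = Y2 ^ 3 * (m * Y1 ^ 3)] (mod p ^ min ((2 * n + 1) * z1) z2)"
      by (simp add: cong_iff_dvd_diff)
    then show ?thesis unfolding cA by (intro cong_diff cong_mult cong_pade) auto
  qed
  moreover have "A * pade n (Y2 ^ 3 * X1 ^ 3) (Y2 ^ 3 * (m * Y1 ^ 3)) - B * pade n (Y2 ^ 3 * (m * Y1 ^ 3)) (Y2 ^ 3 * X1 ^ 3)
      = (Y2 ^ 3) ^ n * pade_form n m X1 Y1 X2 Y2"
    unfolding pade_scale pade_form_def A_def B_def by (simp only: right_diff_distrib mult_ac)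
  ultimately have "p ^ min ((2 * n + 1) * z1) z2 dvd (Y2 ^ 3) ^ n * pade_form n m X1 Y1 X2 Y2"
    by (simp only: cong_dvd_iff)
  moreover have "coprime (p ^ min ((2 * n + 1) * z1) z2) ((Y2 ^ 3) ^ n)"
    using p nd2 by (simp add: prime_imp_coprime)
  ultimately show ?thesis by (simp add: coprime_dvd_mult_right_iff)
qed

text \<open>If both forms vanished, \<open>(X1 * Y2, Y1 * X2)\<close> would give a nontrivial
  relation between two consecutive approximants.\<close>

lemma pade_form_nonzero:
  assumes "X1 \<noteq> 0" "Y1 \<noteq> 0" "m \<noteq> 0" "X1 ^ 3 - m * Y1 ^ 3 \<noteq> 0" "X2 \<noteq> 0 \<or> Y2 \<noteq> 0"
  shows "pade_form n m X1 Y1 X2 Y2 \<noteq> 0 \<or> pade_form (Suc n) m X1 Y1 X2 Y2 \<noteq> 0"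
proof (rule ccontr)
  define u v where "u = real_of_int (X1 ^ 3)" and "v = real_of_int (m * Y1 ^ 3)"
  assume "\<not> ?thesis"
  then have "real_of_int (pade_form n m X1 Y1 X2 Y2) = 0" "real_of_int (pade_form (Suc n) m X1 Y1 X2 Y2) = 0"
    by simp_all
  then have "real_of_int (X1 * Y2) * pade n u v = real_of_int (Y1 * X2) * pade n v u"
    "real_of_int (X1 * Y2) * pade (Suc n) u v = real_of_int (Y1 * X2) * pade (Suc n) v u"
    unfolding pade_form_def of_int_diff of_int_mult[of "X1 * Y2"] of_int_mult[of "Y1 * X2"] of_int_pade u_def v_def
    by simp_all
  moreover have "v \<noteq> 0" "u \<noteq> v" unfolding u_def v_def of_int_eq_iff using assms by auto
  ultimately have "real_of_int (X1 * Y2) = 0 \<and> real_of_int (Y1 * X2) = 0"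
    by (intro pade_linear_independent[of u v])
  then show False using assms by auto
qed

text \<open>The quadratic cofactor of \<open>U - \<theta> * V\<close> is positive definite:
  completing the square in two ways bounds it below by three quarters of \<open>U ^ 2\<close> and,
  since the absolute value of \<open>\<theta>\<close> is at least 1, of
  \<open>V ^ 2\<close>.\<close>

lemma linear_form_le:
  fixes U V m :: int and \<theta> :: real
  assumes "\<theta> ^ 3 = of_int m" "m \<noteq> 0" "H = max \<bar>real_of_int U\<bar> \<bar>real_of_int V\<bar>" "H > 0"
  shows "\<bar>U - \<theta> * V\<bar> * H\<^sup>2 \<le> 2 * \<bar>real_of_int (U ^ 3 - m * V ^ 3)\<bar>"
proof -
  define q where "q = (real_of_int U)\<^sup>2 + U * (\<theta> * V) + (\<theta> * V)\<^sup>2"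
  have a1: "\<bar>\<theta>\<bar> \<ge> 1"
  proof (rule ccontr)
    assume "\<not> \<bar>\<theta>\<bar> \<ge> 1"
    then have "\<bar>\<theta>\<bar> ^ 3 < 1" by (intro power_less_one_iff[THEN iffD2]) auto
    then have "\<bar>real_of_int m\<bar> < 1" using assms(1) by (simp flip: power_abs)
    then show False using assms(2) by linarith
  qed
  have "q = (U + (\<theta> * V) / 2)\<^sup>2 + 3 / 4 * (\<theta> * V)\<^sup>2"
    by (simp add: q_def power2_eq_square algebra_simps)
  then have "3 / 4 * (\<theta> * V)\<^sup>2 \<le> q" by simp
  moreover have "(real_of_int V)\<^sup>2 \<le> (\<theta> * V)\<^sup>2"
  proof -
    have "1 * \<bar>real_of_int V\<bar> \<le> \<bar>\<theta>\<bar> * \<bar>real_of_int V\<bar>" using a1 by (intro mult_right_mono) auto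
    then show ?thesis by (simp add: abs_le_square_iff[symmetric] abs_mult)
  qed
  ultimately have q1: "3 / 4 * (real_of_int V)\<^sup>2 \<le> q" by linarith
  have "q = ((\<theta> * V) + U / 2)\<^sup>2 + 3 / 4 * (real_of_int U)\<^sup>2"
    by (simp add: q_def power2_eq_square algebra_simps)
  then have q2: "3 / 4 * (real_of_int U)\<^sup>2 \<le> q" by simp
  have "H\<^sup>2 = (real_of_int U)\<^sup>2 \<or> H\<^sup>2 = (real_of_int V)\<^sup>2"
    unfolding assms(3) by (auto simp: max_def)
  then have "H\<^sup>2 \<le> 2 * q"
    using q1 q2 zero_le_power2[of "real_of_int U"] zero_le_power2[of "real_of_int V"] by (elim disjE) linarith+
  then have "\<bar>U - \<theta> * V\<bar> * H\<^sup>2 \<le> \<bar>U - \<theta> * V\<bar> * (2 * q)" by (intro mult_left_mono) auto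
  also have "\<dots> = 2 * (\<bar>U - \<theta> * V\<bar> * \<bar>q\<bar>)"
  proof -
    have "q \<ge> 0" using q2 zero_le_power2[of "real_of_int U"] by linarith
    then show ?thesis by simp
  qed
  also have "\<bar>U - \<theta> * V\<bar> * \<bar>q\<bar> = \<bar>(U - \<theta> * V) * q\<bar>" by (simp add: abs_mult)
  also have "(U - \<theta> * V) * q = U ^ 3 - \<theta> ^ 3 * V ^ 3"
    by (simp add: q_def power2_eq_square power3_eq_cube algebra_simps)
  finally show ?thesis using assms(1) by simp
qed

text \<open>The real estimate. Writing \<open>X2 = \<theta> * Y2 + (X2 - \<theta> * Y2)\<close>
  separates the Pade remainder at solution 1 from a term that is linear in the error of solution
  2.\<close>

lemma pade_form_le:
  fixes m X1 Y1 X2 Y2 :: int and \<theta> :: real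
  assumes \<theta>: "\<theta> ^ 3 = of_int m"
    and H1: "H1 = max \<bar>real_of_int X1\<bar> \<bar>real_of_int Y1\<bar>" and H2: "H2 = max \<bar>real_of_int X2\<bar> \<bar>real_of_int Y2\<bar>"
  shows "\<bar>real_of_int (pade_form n m X1 Y1 X2 Y2)\<bar> \<le>
    8 * 1152 ^ n * (1 + \<bar>\<theta>\<bar>) ^ (3 * n) *
      (H2 * H1 ^ n * \<bar>X1 - \<theta> * Y1\<bar> ^ (2 * n + 1) + H1 ^ (3 * n + 1) * \<bar>X2 - \<theta> * Y2\<bar>)"
proof -
  define u v x y where "u = real_of_int (X1 ^ 3)" and "v = real_of_int (m * Y1 ^ 3)"
    and "x = real_of_int X1" and "y = \<theta> * Y1"
  define M where "M = 1 + \<bar>\<theta>\<bar>"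
  have M1: "M \<ge> 1" by (simp add: M_def)
  have Xle: "\<bar>real_of_int X1\<bar> \<le> H1" "\<bar>real_of_int Y1\<bar> \<le> H1" "\<bar>real_of_int Y2\<bar> \<le> H2"
    unfolding H1 H2 by simp_all
  have H0: "H1 \<ge> 0" "H2 \<ge> 0" using Xle by linarith+
  have x3: "x ^ 3 = u" "y ^ 3 = v" by (simp_all add: x_def y_def u_def v_def power_mult_distrib \<theta>)
  have yle: "\<bar>y\<bar> \<le> \<bar>\<theta>\<bar> * H1" unfolding y_def abs_mult using Xle by (intro mult_left_mono) auto
  have yM: "\<bar>y\<bar> \<le> M * H1" using yle H0 by (simp add: M_def distrib_right)
  have xyM: "\<bar>x - y\<bar> \<le> M * H1" using yle Xle(1) by (simp add: M_def distrib_right x_def)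
  have "1 * H1 \<le> M * H1" using M1 H0 by (intro mult_right_mono) auto
  then have xM: "\<bar>x\<bar> \<le> M * H1" using Xle(1) by (simp add: x_def)
  have "real_of_int (pade_form n m X1 Y1 X2 Y2) = Y2 * (x * pade n u v - y * pade n v u) - Y1 * pade n v u * (X2 - \<theta> * Y2)"
    unfolding pade_form_def of_int_diff of_int_mult[of "X1 * Y2"] of_int_mult[of "Y1 * X2"] of_int_pade u_def[symmetric] v_def[symmetric]
    by (simp add: x_def y_def algebra_simps)
  also have "x * pade n u v - y * pade n v u = (x - y) ^ (2 * n + 1) * pade_rem n x y"
    using pade_identity[of x n y] by (simp only: x3)
  finally have "\<bar>real_of_int (pade_form n m X1 Y1 X2 Y2)\<bar> \<le>
     \<bar>Y2 * ((x - y) ^ (2 * n + 1) * pade_rem n x y)\<bar> + \<bar>Y1 * pade n v u * (X2 - \<theta> * Y2)\<bar>"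
    using abs_triangle_ineq4 by simp
  also have "\<bar>Y2 * ((x - y) ^ (2 * n + 1) * pade_rem n x y)\<bar> = \<bar>real_of_int Y2\<bar> * (\<bar>x - y\<bar> ^ (2 * n + 1) * \<bar>pade_rem n x y\<bar>)"
    by (simp only: abs_mult power_abs)
  also have "\<dots> \<le> H2 * (\<bar>x - y\<bar> ^ (2 * n + 1) * (8 * 1152 ^ n * (M * H1) ^ n))"
    using xyM yM H0 Xle by (intro mult_mono mult_nonneg_nonneg abs_pade_rem_le) auto
  also have "\<dots> = 8 * 1152 ^ n * M ^ n * (H2 * H1 ^ n * \<bar>x - y\<bar> ^ (2 * n + 1))"
    by (simp only: power_mult_distrib mult_ac)
  also have "\<dots> \<le> 8 * 1152 ^ n * M ^ (3 * n) * (H2 * H1 ^ n * \<bar>x - y\<bar> ^ (2 * n + 1))"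
    using M1 H0 by (intro mult_right_mono mult_left_mono power_increasing) auto
  also have "\<bar>Y1 * pade n v u * (X2 - \<theta> * Y2)\<bar> = \<bar>real_of_int Y1\<bar> * \<bar>pade n v u\<bar> * \<bar>X2 - \<theta> * Y2\<bar>"
    by (simp only: abs_mult)
  also have "\<dots> \<le> H1 * (8 * 1152 ^ n * ((M * H1) ^ 3) ^ n) * \<bar>X2 - \<theta> * Y2\<bar>"
  proof -
    have "\<bar>pade n v u\<bar> \<le> 2 * 72 ^ n * ((M * H1) ^ 3) ^ n"
      using xM yM unfolding x3[symmetric] by (intro abs_pade_le) (auto simp: power_abs intro!: power_mono)
    also have "\<dots> \<le> 8 * 1152 ^ n * ((M * H1) ^ 3) ^ n"
      using H0 M1 by (intro mult_right_mono mult_mono power_mono) auto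
    finally show ?thesis using Xle H0 by (intro mult_right_mono mult_mono) auto
  qed
  also have "H1 * (8 * 1152 ^ n * ((M * H1) ^ 3) ^ n) * \<bar>X2 - \<theta> * Y2\<bar> =
     8 * 1152 ^ n * M ^ (3 * n) * (H1 ^ (3 * n + 1) * \<bar>X2 - \<theta> * Y2\<bar>)"
    by (simp only: power_mult_distrib power_mult[symmetric] power_add power_one_right mult_ac)
  finally show ?thesis by (simp add: M_def x_def y_def distrib_left)
qed

text \<open>The final comparison on a logarithmic scale: \<open>L = ln H1\<close>,
  \<open>h * L = ln H2\<close>, \<open>\<zeta>1\<close> and \<open>\<zeta>2\<close> belong to the
  powers of \<open>p\<close>, and \<open>b\<close> to the exponential constant. With
  \<open>h\<close> near \<open>2 n + 1\<close> the gain is about \<open>n * L\<close>. Against it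
  stand \<open>n * L / 4\<close> from \<open>b\<close>, about \<open>n * L / 4\<close> from the
  mismatch of \<open>\<zeta>2\<close> and \<open>(2 n + 1) * \<zeta>1\<close>, and a bounded
  multiple of \<open>L\<close> that \<open>n \<ge> 50\<close> covers.\<close>

lemma gap_arith:
  fixes L h \<zeta>1 \<zeta>2 b :: real and n :: nat
  assumes "L > 0" "n \<ge> 50" "\<bar>h - (2 * real n + 1)\<bar> \<le> 2" "0 \<le> \<zeta>1" "\<zeta>1 \<le> 4 * L"
    and "\<bar>\<zeta>2 - h * \<zeta>1\<bar> \<le> h * L / 8" "4 * b \<le> L"
  shows "n * b + (h - 3 * n - 2) * L + (2 * n + 1) * \<zeta>1 < min ((2 * n + 1) * \<zeta>1) \<zeta>2"
    and "n * b + (3 * n + 1 - 2 * h) * L + \<zeta>2 < min ((2 * n + 1) * \<zeta>1) \<zeta>2"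
proof -
  define T where "T = (2 * real n + 1) * \<zeta>1"
  have "\<bar>(h - (2 * real n + 1)) * \<zeta>1\<bar> \<le> 2 * (4 * L)"
    unfolding abs_mult using assms by (intro mult_mono) auto
  moreover have "\<zeta>2 - T = (\<zeta>2 - h * \<zeta>1) + (h - (2 * real n + 1)) * \<zeta>1"
    by (simp add: T_def algebra_simps)
  ultimately have diff: "\<bar>\<zeta>2 - T\<bar> \<le> h * L / 8 + 8 * L" using assms(6) by linarith
  have hL: "h * L \<le> (2 * real n + 3) * L" "(2 * real n - 1) * L \<le> h * L"
    using assms by (intro mult_right_mono; linarith)+
  have nb: "real n * b \<le> real n * (L / 4)" using assms by (intro mult_left_mono) auto
  have nL: "50 * L \<le> real n * L" using assms by (intro mult_right_mono) auto
  define A N where "A = h * L" and "N = real n * L"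
  have facts: "A \<le> 2 * N + 3 * L" "2 * N - L \<le> A" "real n * b \<le> N / 4" "50 * L \<le> N" "\<bar>\<zeta>2 - T\<bar> \<le> A / 8 + 8 * L"
    using hL nb nL diff by (simp_all add: A_def N_def algebra_simps del: mult_le_cancel_left mult_le_cancel_right mult_le_cancel_left_pos mult_le_cancel_right_pos)
  have e: "(h - 3 * n - 2) * L = A - 3 * N - 2 * L" "(3 * n + 1 - 2 * h) * L = 3 * N + L - 2 * A"
    by (simp_all add: A_def N_def algebra_simps)
  have "real n * b + (h - 3 * n - 2) * L + T < min T \<zeta>2"
    unfolding e min_less_iff_conj using facts assms(1) by (intro conjI; linarith)
  then show "n * b + (h - 3 * n - 2) * L + (2 * n + 1) * \<zeta>1 < min ((2 * n + 1) * \<zeta>1) \<zeta>2"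
    by (simp add: T_def add_ac)
  have "real n * b + (3 * n + 1 - 2 * h) * L + \<zeta>2 < min T \<zeta>2"
    unfolding e min_less_iff_conj using facts assms(1) by (intro conjI; linarith)
  then show "n * b + (3 * n + 1 - 2 * h) * L + \<zeta>2 < min ((2 * n + 1) * \<zeta>1) \<zeta>2"
    by (simp add: T_def add_ac)
qed

text \<open>A nonzero integer divisible by \<open>p ^ k\<close> is at least \<open>p ^ k\<close> in
  absolute value, which the real estimate contradicts. All constants are collected in
  \<open>B ^ n\<close>, and \<open>4 * ln B \<le> ln H1\<close> keeps it below
  \<open>H1 ^ (n / 4)\<close>.\<close>

lemma pade_form_eq_0:
  fixes m c p X1 Y1 X2 Y2 :: int and \<theta> :: real
  assumes \<theta>: "\<theta> ^ 3 = of_int m" and m: "m \<noteq> 0" and c: "c \<noteq> 0"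
    and p: "prime p" "p \<noteq> 3" "\<not> p dvd m"
    and eq1: "X1 ^ 3 - m * Y1 ^ 3 = c * p ^ z1" and eq2: "X2 ^ 3 - m * Y2 ^ 3 = c * p ^ z2"
    and prim1: "\<not> (p dvd X1 \<and> p dvd Y1)" and prim2: "\<not> (p dvd X2 \<and> p dvd Y2)"
    and cong: "[X1 = X2] (mod p)" "[Y1 = Y2] (mod p)"
    and H1: "H1 = max \<bar>real_of_int X1\<bar> \<bar>real_of_int Y1\<bar>" and H2: "H2 = max \<bar>real_of_int X2\<bar> \<bar>real_of_int Y2\<bar>"
    and H1_gt: "H1 > 1" and H2_gt: "H2 > 1"
    and n: "n \<ge> 50" "\<bar>ln H2 / ln H1 - (2 * real n + 1)\<bar> \<le> 2"
    and z1: "z1 * ln p \<le> 4 * ln H1" and z12: "\<bar>z2 * ln p / ln H2 - z1 * ln p / ln H1\<bar> \<le> 1 / 8"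
    and B: "B = 2 * (8 * 1152 * (1 + \<bar>\<theta>\<bar>) ^ 3 * (2 * \<bar>real_of_int c\<bar>) ^ 3)" "4 * ln B \<le> ln H1"
  shows "pade_form n m X1 Y1 X2 Y2 = 0"
proof (rule ccontr)
  let ?D = "pade_form n m X1 Y1 X2 Y2"
  assume D: "?D \<noteq> 0"
  define P where "P = real_of_int p"
  define C where "C = 2 * \<bar>real_of_int c\<bar>"
  define M where "M = 1 + \<bar>\<theta>\<bar>"
  define L h where "L = ln H1" and "h = ln H2 / L"
  have P1: "P > 1" unfolding P_def using prime_gt_1_int[OF p(1)] by simp
  have C1: "C \<ge> 1" unfolding C_def using c by linarith
  have M1: "M \<ge> 1" by (simp add: M_def)
  have L0: "L > 0" using H1_gt by (simp add: L_def)
  have lnH2: "ln H2 = h * L" using L0 by (simp add: h_def)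
  have h0: "h > 0" using L0 H2_gt by (simp add: h_def)
  have lin1: "\<bar>X1 - \<theta> * Y1\<bar> \<le> C * P ^ z1 / H1\<^sup>2"
    using linear_form_le[OF \<theta> m H1] H1_gt P1 unfolding eq1
    by (simp add: field_simps C_def P_def abs_mult)
  have lin2: "\<bar>X2 - \<theta> * Y2\<bar> \<le> C * P ^ z2 / H2\<^sup>2"
    using linear_form_le[OF \<theta> m H2] H2_gt P1 unfolding eq2
    by (simp add: field_simps C_def P_def abs_mult)
  let ?t1 = "H2 * H1 ^ n * (P ^ z1 / H1\<^sup>2) ^ (2 * n + 1)"
  let ?t2 = "H1 ^ (3 * n + 1) * (P ^ z2 / H2\<^sup>2)"
  define k where "k = min ((2 * n + 1) * z1) z2"
  have "p ^ k dvd ?D" unfolding k_def by (rule pade_form_divisible[OF p eq1 eq2 prim1 prim2 cong])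
  then have "p ^ k \<le> \<bar>?D\<bar>" using D by (intro zdvd_imp_le) auto
  then have "P ^ k \<le> \<bar>real_of_int ?D\<bar>"
    unfolding P_def by (metis of_int_abs of_int_le_iff of_int_power)
  also have "\<dots> \<le> 8 * 1152 ^ n * M ^ (3 * n) *
      (H2 * H1 ^ n * \<bar>X1 - \<theta> * Y1\<bar> ^ (2 * n + 1) + H1 ^ (3 * n + 1) * \<bar>X2 - \<theta> * Y2\<bar>)"
    unfolding M_def by (rule pade_form_le[OF \<theta> H1 H2])
  also have "\<dots> \<le> 8 * 1152 ^ n * M ^ (3 * n) * (C ^ (3 * n) * ?t1 + C ^ (3 * n) * ?t2)"
  proof (intro mult_left_mono add_mono)
    have "\<bar>X1 - \<theta> * Y1\<bar> ^ (2 * n + 1) \<le> (C * (P ^ z1 / H1\<^sup>2)) ^ (2 * n + 1)"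
      using lin1 by (intro power_mono) auto
    also have "\<dots> = C ^ (2 * n + 1) * (P ^ z1 / H1\<^sup>2) ^ (2 * n + 1)"
      by (rule power_mult_distrib)
    also have "\<dots> \<le> C ^ (3 * n) * (P ^ z1 / H1\<^sup>2) ^ (2 * n + 1)"
      using C1 n(1) P1 by (intro mult_right_mono power_increasing) auto
    finally have "H2 * H1 ^ n * \<bar>X1 - \<theta> * Y1\<bar> ^ (2 * n + 1) \<le> H2 * H1 ^ n * (C ^ (3 * n) * (P ^ z1 / H1\<^sup>2) ^ (2 * n + 1))"
      using H1_gt H2_gt by (intro mult_left_mono) auto
    then show "H2 * H1 ^ n * \<bar>X1 - \<theta> * Y1\<bar> ^ (2 * n + 1) \<le> C ^ (3 * n) * ?t1"
      by (simp only: mult_ac)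
    have "\<bar>X2 - \<theta> * Y2\<bar> \<le> C ^ 1 * (P ^ z2 / H2\<^sup>2)" using lin2 by simp
    also have "\<dots> \<le> C ^ (3 * n) * (P ^ z2 / H2\<^sup>2)"
      using C1 n(1) P1 by (intro mult_right_mono power_increasing) auto
    finally have "H1 ^ (3 * n + 1) * \<bar>X2 - \<theta> * Y2\<bar> \<le> H1 ^ (3 * n + 1) * (C ^ (3 * n) * (P ^ z2 / H2\<^sup>2))"
      using H1_gt by (intro mult_left_mono) auto
    then show "H1 ^ (3 * n + 1) * \<bar>X2 - \<theta> * Y2\<bar> \<le> C ^ (3 * n) * ?t2" by (simp only: mult_ac)
  qed (use M1 in auto)
  also have "\<dots> = 8 * (1152 ^ n * (M ^ 3) ^ n * (C ^ 3) ^ n) * (?t1 + ?t2)"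
    unfolding power_mult[of M 3 n] power_mult[of C 3 n] by (simp only: distrib_left mult_ac)
  also have "\<dots> \<le> 8 ^ n * (1152 ^ n * (M ^ 3) ^ n * (C ^ 3) ^ n) * (?t1 + ?t2)"
  proof (intro mult_right_mono)
    have "(8::real) ^ 1 \<le> 8 ^ n" using n(1) by (intro power_increasing) auto
    then show "(8::real) \<le> 8 ^ n" by simp
  qed (use H1_gt H2_gt P1 M1 C1 in auto)
  also have "\<dots> = (B / 2) ^ n * (?t1 + ?t2)"
  proof -
    have "B / 2 = 8 * (1152 * M ^ 3 * C ^ 3)" by (simp add: B(1) M_def C_def)
    then show ?thesis by (simp only: power_mult_distrib)
  qed
  also have "\<dots> \<le> (B / 2) ^ n * (2 * max ?t1 ?t2)"
    using B(1) by (intro mult_left_mono) (auto simp: max_def)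
  also have "\<dots> = (2 * (B / 2) ^ n) * max ?t1 ?t2" by simp
  also have "\<dots> \<le> B ^ n * max ?t1 ?t2"
  proof (intro mult_right_mono)
    have "(2::real) ^ 1 \<le> 2 ^ n" using n(1) by (intro power_increasing) auto
    then have "2 * (B / 2) ^ n \<le> 2 ^ n * (B / 2) ^ n" unfolding B(1) by (intro mult_right_mono) auto
    also have "\<dots> = B ^ n" by (simp flip: power_mult_distrib)
    finally show "2 * (B / 2) ^ n \<le> B ^ n" .
  qed (use H1_gt H2_gt P1 in \<open>auto simp: le_max_iff_disj\<close>)
  finally have le: "P ^ k \<le> B ^ n * max ?t1 ?t2" .
  have B0: "B > 0" unfolding B(1) using c by (simp add: add_pos_nonneg)
  have t0: "?t1 > 0" "?t2 > 0" using H1_gt H2_gt P1 by auto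
  define \<zeta>1 \<zeta>2 where "\<zeta>1 = z1 * ln P" and "\<zeta>2 = z2 * ln P"
  have lnP: "ln P > 0" using P1 by simp
  have lnk: "ln (P ^ k) = min ((2 * n + 1) * \<zeta>1) \<zeta>2"
  proof -
    have "ln (P ^ k) = real k * ln P" using P1 by (simp add: ln_realpow)
    also have "real k = min (real ((2 * n + 1) * z1)) (real z2)" by (simp only: k_def of_nat_min)
    also have "\<dots> * ln P = min (real ((2 * n + 1) * z1) * ln P) (real z2 * ln P)"
    proof -
      have "min a b * l = min (a * l) (b * l)" if "l > 0" for a b l :: real
        using that by (auto simp: min_def)
      then show ?thesis using lnP .
    qed
    finally show ?thesis by (simp only: \<zeta>1_def \<zeta>2_def of_nat_mult mult.assoc)
  qed
  have "ln (P ^ k) \<le> ln (B ^ n * max ?t1 ?t2)"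
    using le P1 B0 t0 by (intro ln_mono) (auto simp: less_max_iff_disj)
  also have "\<dots> = n * ln B + ln (max ?t1 ?t2)"
    using B0 t0 by (simp add: ln_mult ln_realpow less_max_iff_disj del: max_less_iff_conj)
  finally have le': "min ((2 * n + 1) * \<zeta>1) \<zeta>2 \<le> n * ln B + ln (max ?t1 ?t2)" by (simp only: lnk)
  have lnt1: "ln ?t1 = (h - 3 * n - 2) * L + (2 * n + 1) * \<zeta>1"
  proof -
    have "ln ?t1 = ln H2 + n * ln H1 + real (2 * n + 1) * (z1 * ln P - 2 * ln H1)"
      using H1_gt H2_gt P1 by (simp add: ln_mult ln_div ln_realpow del: power_Suc)
    then show ?thesis by (simp add: lnH2 L_def[symmetric] \<zeta>1_def algebra_simps)
  qed
  have lnt2: "ln ?t2 = (3 * n + 1 - 2 * h) * L + \<zeta>2"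
  proof -
    have "ln ?t2 = real (3 * n + 1) * ln H1 + (z2 * ln P - 2 * ln H2)"
      using H1_gt H2_gt P1 by (simp add: ln_mult ln_div ln_realpow del: power_Suc)
    then show ?thesis by (simp add: lnH2 L_def[symmetric] \<zeta>2_def algebra_simps)
  qed
  have "\<bar>\<zeta>2 - h * \<zeta>1\<bar> = (h * L) * \<bar>\<zeta>2 / (h * L) - \<zeta>1 / L\<bar>"
  proof -
    have "\<zeta>2 - h * \<zeta>1 = (h * L) * (\<zeta>2 / (h * L) - \<zeta>1 / L)"
      using L0 h0 by (simp add: right_diff_distrib)
    then have "\<bar>\<zeta>2 - h * \<zeta>1\<bar> = \<bar>h * L\<bar> * \<bar>\<zeta>2 / (h * L) - \<zeta>1 / L\<bar>"
      by (simp only: abs_mult)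
    then show ?thesis using L0 h0 by simp
  qed
  also have "\<dots> \<le> (h * L) * (1 / 8)"
    using z12 L0 h0 by (intro mult_left_mono) (auto simp: \<zeta>1_def \<zeta>2_def P_def L_def[symmetric] lnH2)
  finally have "\<bar>\<zeta>2 - h * \<zeta>1\<bar> \<le> h * L / 8" by simp
  note arith = gap_arith[OF L0 n(1) _ _ _ this B(2)[folded L_def]]
  have a: "\<bar>h - (2 * real n + 1)\<bar> \<le> 2" "0 \<le> \<zeta>1" "\<zeta>1 \<le> 4 * L"
    using n(2) z1 lnP by (auto simp: h_def L_def \<zeta>1_def P_def)
  show False
  proof (cases "?t1 \<le> ?t2")
    case True
    then have "ln (max ?t1 ?t2) = ln ?t2" by (simp only: max_absorb2)
    then show False using arith(2)[OF a] le' unfolding lnt2 by linarith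
  next
    case False
    then have "ln (max ?t1 ?t2) = ln ?t1" by (simp only: max_absorb1 not_le less_imp_le)
    then show False using arith(1)[OF a] le' unfolding lnt1 by linarith
  qed
qed

section \<open>Finiteness of the solutions by pigeonhole\<close>

lemma finite_bounded_int_pairs:
  "finite {s :: int \<times> int. max \<bar>real_of_int (fst s)\<bar> \<bar>real_of_int (snd s)\<bar> \<le> b}"
proof (rule finite_subset)
  show "{s. max \<bar>real_of_int (fst s)\<bar> \<bar>real_of_int (snd s)\<bar> \<le> b} \<subseteq> {-\<lfloor>b\<rfloor>..\<lfloor>b\<rfloor>} \<times> {-\<lfloor>b\<rfloor>..\<lfloor>b\<rfloor>}"
  proof
    fix s :: "int \<times> int" assume "s \<in> {s. max \<bar>real_of_int (fst s)\<bar> \<bar>real_of_int (snd s)\<bar> \<le> b}"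
    then have "\<bar>fst s\<bar> \<le> \<lfloor>b\<rfloor>" "\<bar>snd s\<bar> \<le> \<lfloor>b\<rfloor>" by (simp_all add: le_floor_iff)
    then show "s \<in> {-\<lfloor>b\<rfloor>..\<lfloor>b\<rfloor>} \<times> {-\<lfloor>b\<rfloor>..\<lfloor>b\<rfloor>}" by (cases s) auto
  qed
qed auto

text \<open>
  Of infinitely many solutions, infinitely many agree modulo \<open>p\<close> and nearly agree in the ratio
  \<open>ln (p ^ z) / ln H\<close>; two of these of very different heights \<open>H\<close> contradict \<open>pade_form_eq_0\<close>, as
  \<open>pade_form n\<close> and \<open>pade_form (Suc n)\<close> cannot vanish both.
\<close>

theorem finite_cubic_thue_mahler:
  fixes m c p :: int
  assumes p: "prime p" "p \<noteq> 3" "\<not> p dvd m" and c: "c \<noteq> 0"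
  shows "finite {(U, V). \<not> (p dvd U \<and> p dvd V) \<and> (\<exists>z. U ^ 3 - m * V ^ 3 = c * p ^ z)}"
    (is "finite ?S")
proof (rule ccontr)
  assume inf: "infinite ?S"
  have m: "m \<noteq> 0" using p(3) by auto
  define \<theta> where "\<theta> = root 3 (real_of_int m)"
  have \<theta>: "\<theta> ^ 3 = of_int m" by (simp add: \<theta>_def odd_real_root_pow)
  define B where "B = 2 * (8 * 1152 * (1 + \<bar>\<theta>\<bar>) ^ 3 * (2 * \<bar>real_of_int c\<bar>) ^ 3)"
  have B0: "B > 0" unfolding B_def using c by (simp add: add_pos_nonneg)
  define H where "H s = max \<bar>real_of_int (fst s)\<bar> \<bar>real_of_int (snd s)\<bar>" for s :: "int \<times> int"
  \<comment> \<open>The summand with \<open>c\<close> excludes solutions with a zero coordinate, the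
    one with \<open>m\<close> yields \<open>p ^ z \<le> H ^ 4\<close>, and \<open>B ^ 4\<close>
    meets the size condition of \<open>pade_form_eq_0\<close>.\<close>
  define H0 where "H0 = 1 + \<bar>real_of_int c\<bar> + \<bar>real_of_int m\<bar> + B ^ 4"
  define zf where "zf s = (SOME z. (fst s) ^ 3 - m * (snd s) ^ 3 = c * p ^ z)" for s
  define lam where "lam s = zf s * ln p / ln (H s)" for s
  have lnp: "ln (real_of_int p) > 0" using prime_gt_1_int[OF p(1)] by simp
  have zf: "(fst s) ^ 3 - m * (snd s) ^ 3 = c * p ^ zf s" and prim: "\<not> (p dvd fst s \<and> p dvd snd s)" if "s \<in> ?S" for s
    using that unfolding zf_def by (auto intro: someI)
  have big: "infinite {s \<in> A. H s > b}" if "infinite A" for A b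
  proof -
    have "A = {s \<in> A. H s > b} \<union> {s \<in> A. H s \<le> b}" by auto
    moreover have "finite {s \<in> A. H s \<le> b}"
      using finite_bounded_int_pairs[of b] by (rule rev_finite_subset) (auto simp: H_def)
    ultimately show ?thesis using that by (metis finite_UnI)
  qed
  define S where "S = {s \<in> ?S. H s > H0}"
  have infS: "infinite S" unfolding S_def using inf by (rule big)
  have S: "s \<in> ?S" "H s > 1" "H s > \<bar>real_of_int c\<bar>" "H s > 1 + \<bar>real_of_int m\<bar>" "H s > B ^ 4" if "s \<in> S" for s
  proof -
    have "H s > H0" using that by (simp add: S_def)
    moreover have "B ^ 4 > 0" using B0 by simp
    ultimately show "H s > 1" "H s > \<bar>real_of_int c\<bar>" "H s > 1 + \<bar>real_of_int m\<bar>" "H s > B ^ 4"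
      unfolding H0_def by linarith+
  qed (use that in \<open>simp add: S_def\<close>)
  have z_le: "zf s * ln p \<le> 4 * ln (H s)" if s: "s \<in> S" for s
  proof -
    have xy: "\<bar>real_of_int (fst s)\<bar> ^ 3 \<le> H s ^ 3" "\<bar>real_of_int (snd s)\<bar> ^ 3 \<le> H s ^ 3"
      by (auto intro!: power_mono simp: H_def)
    have "real_of_int p ^ zf s = 1 * \<bar>real_of_int p ^ zf s\<bar>"
      using prime_gt_1_int[OF p(1)] by simp
    also have "\<dots> \<le> \<bar>real_of_int c\<bar> * \<bar>real_of_int p ^ zf s\<bar>"
      using c by (intro mult_right_mono) auto
    also have "\<dots> = \<bar>real_of_int (fst s ^ 3 - m * snd s ^ 3)\<bar>"
      unfolding zf[OF S(1)[OF s]] by (simp add: abs_mult)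
    also have "\<dots> \<le> \<bar>real_of_int (fst s)\<bar> ^ 3 + \<bar>real_of_int m\<bar> * \<bar>real_of_int (snd s)\<bar> ^ 3"
      using abs_triangle_ineq4[of "real_of_int (fst s) ^ 3" "real_of_int m * real_of_int (snd s) ^ 3"]
      by (simp add: abs_mult power_abs)
    also have "\<dots> \<le> H s ^ 3 + \<bar>real_of_int m\<bar> * H s ^ 3"
      using xy by (intro add_mono mult_left_mono) auto
    also have "\<dots> = (1 + \<bar>real_of_int m\<bar>) * H s ^ 3" by (simp add: algebra_simps)
    also have "\<dots> \<le> H s * H s ^ 3" using S(2,4)[OF s] by (intro mult_right_mono) auto
    finally have "real_of_int p ^ zf s \<le> H s ^ 4" by (simp add: numeral_eq_Suc)
    then have "ln (real_of_int p ^ zf s) \<le> ln (H s ^ 4)"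
      using prime_gt_1_int[OF p(1)] S(2)[OF s] by (intro ln_mono) auto
    then show ?thesis using prime_gt_1_int[OF p(1)] S(2)[OF s] by (simp add: ln_realpow)
  qed
  \<comment> \<open>Buckets of width 1/8 for \<open>lam\<close> match the tolerance in
    \<open>pade_form_eq_0\<close>; they are finite in number because \<open>lam\<close> lies between
    0 and 4.\<close>
  define f where "f s = (fst s mod p, snd s mod p, \<lfloor>8 * lam s\<rfloor>)" for s
  have "f ` S \<subseteq> {0..<p} \<times> {0..<p} \<times> {0..32}"
  proof
    fix y assume "y \<in> f ` S"
    then obtain s where s: "s \<in> S" "y = f s" by blast
    have "ln (H s) > 0" using S(2)[OF s(1)] by simp
    then have "0 \<le> lam s" "lam s \<le> 4" using z_le[OF s(1)] lnp by (simp_all add: lam_def field_simps)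
    then have "0 \<le> \<lfloor>8 * lam s\<rfloor>" "\<lfloor>8 * lam s\<rfloor> \<le> 32" by (simp_all add: floor_le_iff le_floor_iff)
    then show "y \<in> {0..<p} \<times> {0..<p} \<times> {0..32}"
      using prime_gt_1_int[OF p(1)] by (simp add: s(2) f_def)
  qed
  then have "finite (f ` S)" by (rule finite_subset) auto
  from pigeonhole_infinite[OF infS this] obtain s1 where s1: "s1 \<in> S" and inf1: "infinite {s \<in> S. f s = f s1}"
    by auto
  \<comment> \<open>The factor 101 makes the degree \<open>n\<close> chosen below at least
    50.\<close>
  have "infinite {s \<in> {s \<in> S. f s = f s1}. H s > exp (101 * ln (H s1))}" by (rule big[OF inf1])
  from infinite_imp_nonempty[OF this] obtain s2 where s2: "s2 \<in> S" "f s2 = f s1" "H s2 > exp (101 * ln (H s1))"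
    by blast
  define L h where "L = ln (H s1)" and "h = ln (H s2) / L"
  have L0: "L > 0" using S(2)[OF s1] by (simp add: L_def)
  have "ln (exp (101 * ln (H s1))) < ln (H s2)" using s2 S(2)[OF s2(1)] by (subst ln_less_cancel_iff) auto
  then have h: "h > 101" using L0 by (simp add: h_def L_def[symmetric] field_simps)
  \<comment> \<open>This choice gives \<open>2 n + 1 \<le> h < 2 n + 3\<close>, so that
    \<open>n\<close> and \<open>Suc n\<close> both lie within the tolerance 2.\<close>
  define n where "n = nat \<lfloor>(h - 1) / 2\<rfloor>"
  have "real n = \<lfloor>(h - 1) / 2\<rfloor>" using h by (simp add: n_def)
  then have "real n \<le> (h - 1) / 2" "(h - 1) / 2 < real n + 1"
    using floor_correct[of "(h - 1) / 2"] by (simp_all only: of_int_add of_int_1)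
  then have n: "2 * real n + 1 \<le> h" "h < 2 * real n + 3" by (simp_all add: field_simps)
  have n50: "n \<ge> 50" using n(2) h by linarith
  have cong: "[fst s1 = fst s2] (mod p)" "[snd s1 = snd s2] (mod p)" and "\<lfloor>8 * lam s2\<rfloor> = \<lfloor>8 * lam s1\<rfloor>"
    using s2(2) by (auto simp: f_def cong_def)
  then have lam: "\<bar>lam s2 - lam s1\<bar> \<le> 1 / 8" by linarith
  have lnB: "4 * ln B \<le> ln (H s1)"
  proof -
    have "ln (B ^ 4) \<le> ln (H s1)" using S(5)[OF s1] B0 by (intro ln_mono) auto
    then show ?thesis using B0 by (simp add: ln_realpow)
  qed
  have zero: "pade_form k m (fst s1) (snd s1) (fst s2) (snd s2) = 0"
    if "k \<ge> 50" "\<bar>h - (2 * real k + 1)\<bar> \<le> 2" for k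
    by (rule pade_form_eq_0[OF \<theta> m c p zf[OF S(1)[OF s1]] zf[OF S(1)[OF s2(1)]] prim[OF S(1)[OF s1]] prim[OF S(1)[OF s2(1)]]
          cong H_def H_def S(2)[OF s1] S(2)[OF s2(1)] that(1) _ z_le[OF s1] _ B_def lnB])
       (use that(2) lam in \<open>auto simp: h_def L_def lam_def\<close>)
  \<comment> \<open>With a zero coordinate, \<open>p\<close> cannot divide the cubic form, so the
    exponent is 0; then \<open>c\<close> bounds the other coordinate, against the height of
    \<open>s1\<close>.\<close>
  have nz: "fst s1 \<noteq> 0 \<and> snd s1 \<noteq> 0"
  proof (rule ccontr)
    assume "\<not> ?thesis"
    then have cases: "fst s1 = 0 \<or> snd s1 = 0" by blast
    have eq: "(fst s1) ^ 3 - m * (snd s1) ^ 3 = c * p ^ zf s1" by (rule zf[OF S(1)[OF s1]])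
    have "\<not> p dvd (fst s1) ^ 3 - m * (snd s1) ^ 3"
      using cases prim[OF S(1)[OF s1]] p by (auto simp: prime_dvd_mult_iff prime_dvd_power_iff)
    then have "zf s1 = 0" unfolding eq by (metis dvd_mult dvd_power not_gr_zero)
    with eq have eq': "(fst s1) ^ 3 - m * (snd s1) ^ 3 = c" by simp
    have cube: "\<bar>x\<bar> \<le> \<bar>x ^ 3\<bar>" for x :: int
      using self_le_power[of "\<bar>x\<bar>" 3] by (cases "x = 0") (auto simp: power_abs)
    have "\<bar>fst s1\<bar> \<le> \<bar>c\<bar> \<and> \<bar>snd s1\<bar> \<le> \<bar>c\<bar>"
    proof (cases "fst s1 = 0")
      case True
      have "\<bar>snd s1\<bar> \<le> 1 * \<bar>snd s1 ^ 3\<bar>" using cube by simp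
      also have "\<dots> \<le> \<bar>m\<bar> * \<bar>snd s1 ^ 3\<bar>" using m by (intro mult_right_mono) auto
      also have "\<dots> = \<bar>c\<bar>" using eq' True by (auto simp: abs_mult)
      finally show ?thesis using True by simp
    next
      case False
      then show ?thesis using cases eq' cube[of "fst s1"] by auto
    qed
    then have "real_of_int \<bar>fst s1\<bar> \<le> real_of_int \<bar>c\<bar>" "real_of_int \<bar>snd s1\<bar> \<le> real_of_int \<bar>c\<bar>"
      by (simp_all only: of_int_le_iff)
    then have "H s1 \<le> \<bar>real_of_int c\<bar>" by (simp add: H_def)
    then show False using S(3)[OF s1] by simp
  qed
  have "fst s1 ^ 3 - m * snd s1 ^ 3 \<noteq> 0"
    unfolding zf[OF S(1)[OF s1]] using c p(1) by auto
  moreover have "fst s2 \<noteq> 0 \<or> snd s2 \<noteq> 0" using S(2)[OF s2(1)] by (auto simp: H_def)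
  ultimately have "pade_form n m (fst s1) (snd s1) (fst s2) (snd s2) \<noteq> 0 \<or>
      pade_form (Suc n) m (fst s1) (snd s1) (fst s2) (snd s2) \<noteq> 0"
    using nz m by (intro pade_form_nonzero) auto
  moreover have "\<bar>h - (2 * real (Suc n) + 1)\<bar> \<le> 2" using n by simp
  ultimately show False using zero[of n] zero[of "Suc n"] n n50 by auto
qed

corollary finite_cubic_thue:
  fixes m c :: int
  assumes "m \<noteq> 0" "c \<noteq> 0"
  shows "finite {(U, V). U ^ 3 - m * V ^ 3 = c}"
proof -
  \<comment> \<open>Any large prime \<open>q\<close> makes this the case \<open>z = 0\<close> of the preceding theorem.\<close>
  obtain q :: nat where q: "prime q" "q > nat (\<bar>m\<bar> + \<bar>c\<bar> + 3)" using bigger_prime by blast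
  have ndvd: "\<not> int q dvd x" if "x \<noteq> 0" "\<bar>x\<bar> \<le> \<bar>m\<bar> + \<bar>c\<bar>" for x
    using that q(2) dvd_imp_le_int[of x "int q"] by auto
  have "finite {(U, V). \<not> (int q dvd U \<and> int q dvd V) \<and> (\<exists>z. U ^ 3 - m * V ^ 3 = c * int q ^ z)}"
    using q assms ndvd[of m] by (intro finite_cubic_thue_mahler) auto
  then show ?thesis
  proof (rule rev_finite_subset, safe)
    fix U V assume "c = U ^ 3 - m * V ^ 3"
    then show "\<exists>z. U ^ 3 - m * V ^ 3 = (U ^ 3 - m * V ^ 3) * int q ^ z" by (intro exI[of _ 0]) simp
    assume "int q dvd U" "int q dvd V"
    then have "int q dvd U ^ 3 - m * V ^ 3" by (auto intro!: dvd_diff dvd_mult simp: dvd_power_same power3_eq_cube)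
    then show False using ndvd[of c] assms \<open>c = _\<close> by auto
  qed
qed

section \<open>Pure cubic fields\<close>

definition cubic_norm :: "int \<Rightarrow> int \<Rightarrow> int \<Rightarrow> int \<Rightarrow> int \<Rightarrow> int" where
  "cubic_norm a b x y z = x ^ 3 + a * b ^ 2 * y ^ 3 + a ^ 2 * b * z ^ 3 - 3 * a * b * x * y * z"

lemma cubic_norm_swap: "cubic_norm a b x y z = cubic_norm b a x z y"
  by (simp add: cubic_norm_def mult_ac)

text \<open>The arguments on the left are the coordinates of a product in the basis
  \<open>1\<close>, \<open>\<theta>\<close>, \<open>\<eta>\<close>: this is multiplicativity of the
  field norm, checked as a polynomial identity.\<close>

lemma cubic_norm_mult:
  "cubic_norm a b (x * x' + a * b * (y * z' + z * y')) (x * y' + y * x' + a * z * z') (x * z' + z * x' + b * y * y') =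
   cubic_norm a b x y z * cubic_norm a b x' y' z'"
  by (simp add: cubic_norm_def algebra_simps power2_eq_square power3_eq_cube)

lemma cubic_norm_scale: "cubic_norm a b (t * x) (t * y) (t * z) = t ^ 3 * cubic_norm a b x y z"
  by (simp add: cubic_norm_def algebra_simps power2_eq_square power3_eq_cube)

text \<open>The valuations at \<open>q\<close> of \<open>x ^ 3\<close>,
  \<open>a * b ^ 2 * y ^ 3\<close> and \<open>a ^ 2 * b * z ^ 3\<close> are 0, 1 and 2 modulo 3, as
  for a totally ramified prime. The coordinates can therefore be peeled off one after the
  other.\<close>

lemma prime_dvd_coords_of_ramified:
  fixes q a b x y z :: int
  assumes q: "prime q" "q dvd a" "\<not> q ^ 2 dvd a" "\<not> q dvd b" and N: "q ^ 3 dvd cubic_norm a b x y z"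
  shows "q dvd x \<and> q dvd y \<and> q dvd z"
proof -
  have q0: "q \<noteq> 0" using q(1) by auto
  obtain a' where a: "a = q * a'" using q(2) by blast
  have a': "\<not> q dvd a'" using q(3) unfolding a by (auto simp: power2_eq_square)
  obtain t where t: "cubic_norm a b x y z = q ^ 3 * t" using N by blast
  have "x ^ 3 = q * (q ^ 2 * t - a' * b ^ 2 * y ^ 3 - q * a' ^ 2 * b * z ^ 3 + 3 * a' * b * x * y * z)"
    using t by (simp add: cubic_norm_def a algebra_simps power2_eq_square power3_eq_cube)
  then have "q dvd x ^ 3" by (metis dvd_triv_left)
  then have "q dvd x" using q(1) prime_dvd_power by blast
  then obtain x' where x: "x = q * x'" by blast
  have "q * (a' * b ^ 2 * y ^ 3) = q * (q * (q * t - q * x' ^ 3 - a' ^ 2 * b * z ^ 3 + 3 * a' * b * x' * y * z))"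
    using t by (simp add: cubic_norm_def a x algebra_simps power2_eq_square power3_eq_cube)
  then have "a' * b ^ 2 * y ^ 3 = q * (q * t - q * x' ^ 3 - a' ^ 2 * b * z ^ 3 + 3 * a' * b * x' * y * z)"
    using q0 mult_left_cancel by blast
  then have "q dvd a' * b ^ 2 * y ^ 3" by (metis dvd_triv_left)
  then have "q dvd y" using q(1,4) a' by (auto simp: prime_dvd_mult_iff prime_dvd_power_iff)
  then obtain y' where y: "y = q * y'" by blast
  have "q ^ 2 * (a' ^ 2 * b * z ^ 3) = q ^ 2 * (q * (t - x' ^ 3 - q * a' * b ^ 2 * y' ^ 3 + 3 * a' * b * x' * y' * z))"
    using t by (simp add: cubic_norm_def a x y algebra_simps power2_eq_square power3_eq_cube)
  then have "a' ^ 2 * b * z ^ 3 = q * (t - x' ^ 3 - q * a' * b ^ 2 * y' ^ 3 + 3 * a' * b * x' * y' * z)"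
    using q0 mult_left_cancel[of "q ^ 2"] by auto
  then have "q dvd a' ^ 2 * b * z ^ 3" by (metis dvd_triv_left)
  then have "q dvd z" using q(1,4) a' by (auto simp: prime_dvd_mult_iff prime_dvd_power_iff)
  with \<open>q dvd x\<close> \<open>q dvd y\<close> show ?thesis by blast
qed

lemma cube_mod_9:
  fixes x :: int
  assumes "\<not> 3 dvd x"
  obtains e i where "e = 1 \<or> e = -1" "x ^ 3 = e + 9 * i"
proof -
  have "x mod 3 = 1 \<or> x mod 3 = 2" using assms by presburger
  then show ?thesis
  proof
    assume "x mod 3 = 1"
    then obtain s where "x = 1 + 3 * s" by (metis add.commute mult.commute mod_div_mult_eq)
    then have "x ^ 3 = 1 + 9 * (s + 3 * s ^ 2 + 3 * s ^ 3)" by (simp add: algebra_simps power2_eq_square power3_eq_cube)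
    then show ?thesis using that by blast
  next
    assume "x mod 3 = 2"
    then have "x = -1 + 3 * (x div 3 + 1)" by presburger
    then obtain s where "x = -1 + 3 * s" by blast
    moreover have "(-1 + 3 * s) ^ 3 = -1 + 9 * (s - 3 * s ^ 2 + 3 * s ^ 3)"
      by (simp add: algebra_simps power2_eq_square power3_eq_cube)
    ultimately have "x ^ 3 = -1 + 9 * (s - 3 * s ^ 2 + 3 * s ^ 3)" by simp
    then show ?thesis using that by blast
  qed
qed

text \<open>A cube prime to 3 is \<open>\<plusminus> 1\<close> modulo 9, so \<open>a * b ^ 2\<close>
  would itself be \<open>\<plusminus> 1\<close> modulo 9.\<close>

lemma not_3_dvd_of_unit_cubes:
  fixes a b y :: int
  assumes "\<not> [(a * b ^ 2) ^ 2 = 1] (mod 9)" and "e = 1 \<or> e = -1"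
    and "\<not> 3 dvd y" and "[a * b ^ 2 * y ^ 3 = e] (mod 9)"
  shows False
proof -
  obtain f i where f: "f = 1 \<or> f = -1" "y ^ 3 = f + 9 * i" using cube_mod_9[OF assms(3)] .
  have "[y ^ 3 = f] (mod 9)" unfolding f(2) by (simp add: cong_iff_dvd_diff)
  then have "[(a * b ^ 2 * y ^ 3) ^ 2 = (a * b ^ 2 * f) ^ 2] (mod 9)" by (intro cong_pow cong_mult cong_refl)
  moreover have "(a * b ^ 2 * f) ^ 2 = (a * b ^ 2) ^ 2" using f(1) by auto
  moreover have "[(a * b ^ 2 * y ^ 3) ^ 2 = e ^ 2] (mod 9)" using assms(4) by (rule cong_pow)
  moreover have "e ^ 2 = 1" using assms(2) by auto
  ultimately show False using assms(1) by (metis cong_sym cong_trans)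
qed

text \<open>The product of \<open>a * b ^ 2\<close> and \<open>b * a ^ 2\<close> is a cube prime to
  3, hence \<open>\<plusminus> 1\<close> modulo 9. The condition modulo 9 is thus symmetric in
  \<open>a\<close> and \<open>b\<close>, and \<open>z\<close> can be treated like
  \<open>y\<close>.\<close>

lemma swap_mod_9:
  fixes a b :: int
  assumes "\<not> 3 dvd a" "\<not> 3 dvd b" "[(b * a ^ 2) ^ 2 = 1] (mod 9)"
  shows "[(a * b ^ 2) ^ 2 = 1] (mod 9)"
proof -
  obtain e i where e: "e = 1 \<or> e = -1" "a ^ 3 = e + 9 * i" using cube_mod_9[OF assms(1)] .
  obtain f j where f: "f = 1 \<or> f = -1" "b ^ 3 = f + 9 * j" using cube_mod_9[OF assms(2)] .
  have ab: "[a ^ 3 = e] (mod 9)" "[b ^ 3 = f] (mod 9)" unfolding e(2) f(2) by (simp_all add: cong_iff_dvd_diff)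
  have "[(a ^ 3) ^ 2 * (b ^ 3) ^ 2 = e ^ 2 * f ^ 2] (mod 9)" by (intro cong_mult cong_pow ab)
  moreover have "e ^ 2 * f ^ 2 = 1" using e(1) f(1) by auto
  moreover have "(a ^ 3) ^ 2 * (b ^ 3) ^ 2 = (a * b ^ 2) ^ 2 * (b * a ^ 2) ^ 2"
    by (simp only: power2_eq_square power3_eq_cube mult_ac)
  moreover have "[(a * b ^ 2) ^ 2 * (b * a ^ 2) ^ 2 = (a * b ^ 2) ^ 2 * 1] (mod 9)"
    using assms(3) by (intro cong_mult cong_refl)
  ultimately have "[(a * b ^ 2) ^ 2 * (b * a ^ 2) ^ 2 = 1] (mod 9)"
    and "[(a * b ^ 2) ^ 2 * (b * a ^ 2) ^ 2 = (a * b ^ 2) ^ 2] (mod 9)" by simp_all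
  then show ?thesis using cong_sym cong_trans by blast
qed

text \<open>If 3 divides one coordinate, the cube terms of the other two cancel modulo 9, and the
  condition modulo 9 leaves only the case that all are divisible. If 3 divides none, the norm alone
  says too little, and \<open>k ^ 3 = xx * vv * ww\<close> modulo 27 is brought in: for
  \<open>vv = e + 3 * j\<close> and \<open>ww = e + 3 * l\<close> it yields
  \<open>3 dvd j * l\<close>, while the norm yields \<open>3 dvd j + l\<close>; so \<open>vv\<close>
  is \<open>e\<close> modulo 9, which is excluded.\<close>

lemma three_dvd_coords:
  fixes a b x y z :: int
  assumes ab: "\<not> 3 dvd a" "\<not> 3 dvd b" and nc: "\<not> [(a * b ^ 2) ^ 2 = 1] (mod 9)"
    and N: "27 dvd cubic_norm a b x y z"
  shows "3 dvd x \<and> 3 dvd y \<and> 3 dvd z"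
proof -
  have nc': "\<not> [(b * a ^ 2) ^ 2 = 1] (mod 9)" using swap_mod_9[OF ab] nc by blast
  have p3: "prime (3::int)" by simp
  define xx vv ww k where "xx = x ^ 3" and "vv = a * b ^ 2 * y ^ 3" and "ww = a ^ 2 * b * z ^ 3" and "k = a * b * x * y * z"
  have prod: "k ^ 3 = xx * vv * ww" unfolding k_def xx_def vv_def ww_def by (simp add: algebra_simps power2_eq_square power3_eq_cube)
  obtain n where n: "xx + vv + ww - 3 * k = 27 * n"
    using N unfolding cubic_norm_def xx_def vv_def ww_def k_def by (auto simp: mult.assoc elim!: dvdE)
  have cube3: "27 dvd s ^ 3" if "3 dvd s" for s :: int
  proof -
    have "(3::int) ^ 3 dvd s ^ 3" using that by (rule dvd_power_same)
    then show ?thesis by simp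
  qed
  have vdvd: "3 dvd vv \<longleftrightarrow> 3 dvd y" "3 dvd ww \<longleftrightarrow> 3 dvd z" "3 dvd xx \<longleftrightarrow> 3 dvd x"
    unfolding vv_def ww_def xx_def using ab p3 by (auto simp: prime_dvd_mult_iff prime_dvd_power_iff)
  have unit: "\<exists>e i. (e = 1 \<or> e = -1) \<and> xx = e + 9 * i" if "\<not> 3 dvd x"
    using cube_mod_9[OF that] unfolding xx_def by metis
  show ?thesis
  proof (cases "3 dvd x \<or> 3 dvd y \<or> 3 dvd z")
    case True
    then have "3 dvd k" unfolding k_def by auto
    then obtain k' where k': "k = 3 * k'" by blast
    have s9: "9 dvd xx + vv + ww" using n k' by presburger
    consider "3 dvd x" | "\<not> 3 dvd x" "3 dvd y" | "\<not> 3 dvd x" "\<not> 3 dvd y" "3 dvd z" using True by blast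
    then show ?thesis
    proof cases
      case 1
      have "27 dvd xx" unfolding xx_def using cube3 1 by blast
      then have "9 dvd vv + ww" using s9 by presburger
      then have yz: "3 dvd y \<longleftrightarrow> 3 dvd z" using vdvd by presburger
      show ?thesis
      proof (cases "3 dvd y")
        case False
        have "vv + ww = a * b * (b * y ^ 3 + a * z ^ 3)" unfolding vv_def ww_def by (simp add: algebra_simps power2_eq_square power3_eq_cube)
        then have "9 dvd a * b * (b * y ^ 3 + a * z ^ 3)" using \<open>9 dvd vv + ww\<close> by simp
        moreover have "coprime 9 (a * b)"
        proof -
          have "coprime 3 (a * b)" using ab p3 by (simp add: prime_imp_coprime)
          then have "coprime (3 * 3) (a * b)" by (simp only: coprime_mult_left_iff simp_thms)
          moreover have "(3 * 3 :: int) = 9" by simp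
          ultimately show ?thesis by (simp only:)
        qed
        ultimately have *: "9 dvd b * y ^ 3 + a * z ^ 3" by (simp add: coprime_dvd_mult_right_iff)
        obtain e i where e: "e = 1 \<or> e = -1" "y ^ 3 = e + 9 * i" using cube_mod_9[OF False] .
        obtain f j where f: "f = 1 \<or> f = -1" "z ^ 3 = f + 9 * j" using cube_mod_9 False yz by metis
        have "b * y ^ 3 + a * z ^ 3 = (b * e + a * f) + 9 * (b * i + a * j)" unfolding e f by (simp add: algebra_simps power2_eq_square power3_eq_cube)
        then have "9 dvd b * e + a * f" using * by (metis dvd_add_left_iff dvd_triv_left)
        then have "9 dvd (b * e + a * f) * (b * e - a * f)" by simp
        also have "(b * e + a * f) * (b * e - a * f) = b ^ 2 - a ^ 2"
          using e(1) f(1) by (auto simp: algebra_simps power2_eq_square)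
        finally have ba: "[b ^ 2 = a ^ 2] (mod 9)" by (simp add: cong_iff_dvd_diff)
        obtain g l where g: "g = 1 \<or> g = -1" "a ^ 3 = g + 9 * l" using cube_mod_9[OF ab(1)] .
        have "[a ^ 3 = g] (mod 9)" unfolding g(2) by (simp add: cong_iff_dvd_diff)
        then have "[(a ^ 3) ^ 2 = g ^ 2] (mod 9)" by (rule cong_pow)
        moreover have "[(a * b ^ 2) ^ 2 = (a * a ^ 2) ^ 2] (mod 9)" by (rule cong_pow[OF cong_mult[OF cong_refl ba]])
        moreover have "(a * a ^ 2) ^ 2 = (a ^ 3) ^ 2" "g ^ 2 = 1" using g(1) by (auto simp: power2_eq_square power3_eq_cube)
        ultimately show ?thesis using nc cong_trans by metis
      qed (use 1 yz in auto)
    next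
      case 2
      have "27 dvd vv" unfolding vv_def using cube3 2 by auto
      then have "9 dvd xx + ww" using s9 by presburger
      have z: "\<not> 3 dvd z"
      proof
        assume "3 dvd z"
        then have "27 dvd ww" unfolding ww_def using cube3 by auto
        then have "3 dvd xx" using \<open>9 dvd xx + ww\<close> by presburger
        then show False using 2 vdvd by blast
      qed
      obtain e i where e: "e = 1 \<or> e = -1" "xx = e + 9 * i" using unit 2 by blast
      have "[b * a ^ 2 * z ^ 3 = - e] (mod 9)"
        using \<open>9 dvd xx + ww\<close> unfolding e ww_def cong_iff_dvd_diff by (simp add: mult_ac) presburger
      then show ?thesis using not_3_dvd_of_unit_cubes[OF nc' _ z, of "- e"] e(1) by auto
    next
      case 3
      have "27 dvd ww" unfolding ww_def using cube3 3 by auto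
      then have "9 dvd xx + vv" using s9 by presburger
      obtain e i where e: "e = 1 \<or> e = -1" "xx = e + 9 * i" using unit 3 by blast
      have "[a * b ^ 2 * y ^ 3 = - e] (mod 9)"
        using \<open>9 dvd xx + vv\<close> unfolding e vv_def cong_iff_dvd_diff by presburger
      then show ?thesis using not_3_dvd_of_unit_cubes[OF nc _ 3(2), of "- e"] e(1) by auto
    qed
  next
    case False
    then have nd: "\<not> 3 dvd xx" "\<not> 3 dvd vv" "\<not> 3 dvd ww" using vdvd by auto
    obtain e i where e: "e = 1 \<or> e = -1" "xx = e + 9 * i" using unit False by blast
    have "3 dvd xx + vv + ww" using n by presburger
    then have "3 dvd vv - e" "3 dvd ww - e" using nd e by presburger+
    then obtain j l where j: "vv = e + 3 * j" and l: "ww = e + 3 * l" by (metis add.commute diff_add_cancel dvdE)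
    have "3 dvd k ^ 3 - e"
    proof -
      have "k ^ 3 - e = (e ^ 3 - e) + 3 * (3 * i * (e + 3 * j) * (e + 3 * l) + e * (j * (e + 3 * l) + e * l))"
        unfolding prod e(2) j l by (simp add: algebra_simps power2_eq_square power3_eq_cube)
      moreover have "e ^ 3 - e = 0" using e(1) by auto
      ultimately show ?thesis by simp
    qed
    then have "3 dvd k - e"
    proof -
      have "3 dvd k ^ 3 - k"
      proof -
        have "k ^ 3 - k = (k - 1) * k * (k + 1)" by (simp add: algebra_simps power2_eq_square power3_eq_cube)
        moreover have "3 dvd k - 1 \<or> 3 dvd k \<or> 3 dvd k + 1" by presburger
        ultimately show ?thesis by auto
      qed
      with \<open>3 dvd k ^ 3 - e\<close> show ?thesis by presburger
    qed
    then obtain t where t: "k = e + 3 * t" by (metis add.commute diff_add_cancel dvdE)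
    have s: "j + l = 9 * n - 3 * i + 3 * t" using n unfolding e(2) j l t by presburger
    have e2: "e * e = 1" using e(1) by auto
    define T2 T3 JL IJ IJL where "T2 = e * t ^ 2" and "T3 = t ^ 3" and "JL = e * (j * l)"
      and "IJ = e * i * (j + l)" and "IJL = i * j * l"
    have "(e + 3 * t) ^ 3 = e * (e * e) + 9 * (e * e) * t + 27 * T2 + 27 * T3"
      by (simp add: T2_def T3_def algebra_simps power2_eq_square power3_eq_cube)
    moreover have "(e + 9 * i) * (e + 3 * j) * (e + 3 * l) =
        e * (e * e) + 9 * (e * e) * i + 3 * (e * e) * (j + l) + 9 * JL + 27 * IJ + 81 * IJL"
      by (simp add: JL_def IJ_def IJL_def algebra_simps)
    ultimately have "e + 9 * t + 27 * T2 + 27 * T3 = e + 9 * i + 3 * (j + l) + 9 * JL + 27 * IJ + 81 * IJL"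
      using prod unfolding e(2) j l t e2 by simp
    then have "9 * JL = 9 * (3 * (T2 + T3 - n - IJ - 3 * IJL))" unfolding s by (simp add: algebra_simps)
    then have "JL = 3 * (T2 + T3 - n - IJ - 3 * IJL)" by (simp only: mult_cancel_left) simp
    then have "3 dvd e * (j * l)" unfolding JL_def by simp
    then have "3 dvd j * l" using e(1) by auto
    then have "3 dvd j \<or> 3 dvd l" using p3 by (simp add: prime_dvd_mult_iff)
    then have "3 dvd j" using s by presburger
    then have "[a * b ^ 2 * y ^ 3 = e] (mod 9)"
      using j unfolding vv_def cong_iff_dvd_diff by auto
    then show ?thesis using not_3_dvd_of_unit_cubes[OF nc e(1)] False by blast
  qed
qed

text \<open>Modulo an unramified prime there are no nilpotents: the hypotheses say that the square
  of the element vanishes modulo \<open>q\<close>. Multiplied by \<open>x\<close>,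
  \<open>a * b * z\<close> and \<open>a * b * y\<close>, they make each cube term
  \<open>- 2 * k\<close> modulo \<open>q\<close>, while the product of the cube terms is
  \<open>k ^ 3\<close>; hence \<open>q dvd 9 * k ^ 3\<close>.\<close>

lemma prime_dvd_coords_of_square:
  fixes q a b x y z :: int
  assumes q: "prime q" "\<not> q dvd 3 * a * b"
    and d: "q dvd x ^ 2 + 2 * a * b * y * z" "q dvd 2 * x * y + a * z ^ 2" "q dvd 2 * x * z + b * y ^ 2"
  shows "q dvd x \<and> q dvd y \<and> q dvd z"
proof -
  have nd: "\<not> q dvd 3" "\<not> q dvd a" "\<not> q dvd b" using q by auto
  define k where "k = a * b * x * y * z"
  have "q dvd x * (x ^ 2 + 2 * a * b * y * z)" "q dvd (a * b * y) * (2 * x * z + b * y ^ 2)"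
    "q dvd (a * b * z) * (2 * x * y + a * z ^ 2)" using d by (auto intro: dvd_mult)
  moreover have "x * (x ^ 2 + 2 * a * b * y * z) = x ^ 3 + 2 * k" "(a * b * y) * (2 * x * z + b * y ^ 2) = a * b ^ 2 * y ^ 3 + 2 * k"
    "(a * b * z) * (2 * x * y + a * z ^ 2) = a ^ 2 * b * z ^ 3 + 2 * k" by (simp_all add: k_def algebra_simps power2_eq_square power3_eq_cube)
  ultimately have 1: "q dvd x ^ 3 + 2 * k" "q dvd a * b ^ 2 * y ^ 3 + 2 * k" "q dvd a ^ 2 * b * z ^ 3 + 2 * k" by simp_all
  then obtain r s t where rst: "x ^ 3 = q * r - 2 * k" "a * b ^ 2 * y ^ 3 = q * s - 2 * k" "a ^ 2 * b * z ^ 3 = q * t - 2 * k"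
    by (metis add_diff_cancel_right' dvdE)
  have "k ^ 3 = x ^ 3 * (a * b ^ 2 * y ^ 3) * (a ^ 2 * b * z ^ 3)" unfolding k_def by (simp add: algebra_simps power2_eq_square power3_eq_cube)
  also have "\<dots> = q * (r * (q * s - 2 * k) * (q * t - 2 * k) - 2 * k * s * (q * t - 2 * k) + 4 * k ^ 2 * t) - 8 * k ^ 3"
    unfolding rst by (simp add: algebra_simps power2_eq_square power3_eq_cube)
  finally have "3 * 3 * k ^ 3 = q * (r * (q * s - 2 * k) * (q * t - 2 * k) - 2 * k * s * (q * t - 2 * k) + 4 * k ^ 2 * t)"
    by linarith
  then have "q dvd 3 * 3 * k ^ 3" by (metis dvd_triv_left)
  then have "q dvd k"
    using nd by (simp only: prime_dvd_mult_iff[OF q(1)] prime_dvd_power_iff[OF q(1)] zero_less_numeral simp_thms)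
  then have "q dvd 2 * k" by simp
  then have "q dvd x ^ 3" "q dvd a * b ^ 2 * y ^ 3" "q dvd a ^ 2 * b * z ^ 3"
    using 1 by (simp_all add: dvd_add_left_iff)
  then show ?thesis using q(1) nd by (auto simp: prime_dvd_mult_iff prime_dvd_power_iff)
qed

lemma root_3_cube: "root 3 (w ^ 3) = (w :: real)"
  by (rule odd_real_root_power_cancel) simp

text \<open>
  A cube-free integer is \<open>m = a * b\<^sup>2\<close> with \<open>a\<close>, \<open>b\<close> squarefree and coprime, and \<open>1\<close>, \<open>\<theta>\<close>, \<open>\<eta>\<close> below is an
  integral basis of the field of \<open>\<theta>\<close>, the cube root of \<open>m\<close>.
\<close>

locale pure_cubic =
  fixes a b :: int
  assumes cube_free: "cube_free (a * b ^ 2)"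
    and nc: "\<not> [(a * b ^ 2) ^ 2 = 1] (mod 9)"
    and squarefree_a: "squarefree a" and squarefree_b: "squarefree b"
    and coprime_ab: "coprime a b"
begin

definition \<theta> :: real where "\<theta> = root 3 (of_int (a * b ^ 2))"

definition \<eta> :: real where "\<eta> = \<theta> ^ 2 / of_int b"

definition elt :: "int \<Rightarrow> int \<Rightarrow> int \<Rightarrow> real" where
  "elt x y z = of_int x + of_int y * \<theta> + of_int z * \<eta>"

definition \<O> :: "real set" where "\<O> = {elt x y z | x y z. True}"

text \<open>The fraction field of \<open>\<O>\<close>, in a form that displays integer denominators;
  \<open>rat_adjoin_theta\<close> identifies it with the generated field.\<close>

definition K :: "real set" where "K = {\<xi>. \<exists>D>0. of_int D * \<xi> \<in> \<O>}"

section \<open>The basis of the maximal order and its multiplication table\<close>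

lemma a_nonzero: "a \<noteq> 0" and b_nonzero: "b \<noteq> 0"
  using squarefree_a squarefree_b by auto

lemma prime_dvd_a: "prime q \<Longrightarrow> q dvd a \<Longrightarrow> \<not> q ^ 2 dvd a \<and> \<not> q dvd b"
  using squarefreeD[OF squarefree_a, of q] coprime_common_divisor[OF coprime_ab, of q] not_prime_unit by blast

lemma prime_dvd_b: "prime q \<Longrightarrow> q dvd b \<Longrightarrow> \<not> q ^ 2 dvd b \<and> \<not> q dvd a"
  using squarefreeD[OF squarefree_b, of q] coprime_common_divisor[OF coprime_ab, of q] not_prime_unit by blast

lemma theta_cube: "\<theta> ^ 3 = of_int (a * b ^ 2)"
  by (simp add: \<theta>_def odd_real_root_pow)

lemma theta_eta: "\<theta> * \<eta> = of_int (a * b)"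
  and theta_sq: "\<theta> * \<theta> = of_int b * \<eta>"
  and eta_sq: "\<eta> * \<eta> = of_int a * \<theta>"
proof -
  have b: "real_of_int b \<noteq> 0" using b_nonzero by simp
  have t3: "\<theta> * (\<theta> * \<theta>) = of_int a * (of_int b * of_int b)"
    using theta_cube by (simp add: power2_eq_square power3_eq_cube mult.assoc)
  show *: "\<theta> * \<theta> = of_int b * \<eta>" using b by (simp add: \<eta>_def power2_eq_square)
  have "of_int b * (\<theta> * \<eta>) = \<theta> * (\<theta> * \<theta>)" unfolding * by simp
  then have "of_int b * (\<theta> * \<eta>) = of_int b * of_int (a * b)" unfolding t3 by simp
  then show **: "\<theta> * \<eta> = of_int (a * b)" using b mult_left_cancel by blast
  have "of_int b * (\<eta> * \<eta>) = \<theta> * (\<theta> * \<eta>)" using * by (simp add: mult.assoc[symmetric])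
  also have "\<dots> = of_int b * (of_int a * \<theta>)" unfolding ** by simp
  finally show "\<eta> * \<eta> = of_int a * \<theta>" using b mult_left_cancel by blast
qed

text \<open>A rational \<open>\<theta>\<close> would be an integer whose cube is
  \<open>a * b ^ 2\<close>, so \<open>\<plusminus> 1\<close> by cube-freeness, and the square of
  \<open>a * b ^ 2\<close> would be 1.\<close>

lemma theta_irrational: "\<theta> \<notin> \<rat>"
proof
  assume "\<theta> \<in> \<rat>"
  moreover have "algebraic_int \<theta>"
    unfolding \<theta>_def by (intro algebraic_int_nth_root_real int_imp_algebraic_int) auto
  ultimately have "\<theta> \<in> \<int>" by (intro rational_algebraic_int_is_int)
  then obtain k where "\<theta> = of_int k" by (auto elim: Ints_cases)
  then have "of_int (k ^ 3) = (of_int (a * b ^ 2) :: real)" using theta_cube by simp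
  then have k: "k ^ 3 = a * b ^ 2" by (simp only: of_int_eq_iff)
  then have "k ^ 3 dvd a * b ^ 2" by simp
  then have "k dvd 1" using cube_free unfolding cube_free_def by blast
  then have "k = 1 \<or> k = -1" by auto
  then have "(a * b ^ 2) ^ 2 = 1" unfolding k[symmetric] by auto
  then show False using nc by simp
qed

lemma theta_neq_ratio: "of_int s * \<theta> = of_int r \<Longrightarrow> s = 0"
proof (rule ccontr)
  assume "of_int s * \<theta> = of_int r" "s \<noteq> 0"
  then have "\<theta> = of_int r / of_int s" by (simp add: field_simps)
  then show False using theta_irrational by simp
qed

text \<open>Multiplying the relation by \<open>\<theta>\<close> and eliminating
  \<open>\<eta>\<close> leaves an integer multiple of \<open>\<theta>\<close> equal to an integer,
  so its coefficient vanishes. The integer equations that result give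
  \<open>\<theta> * z = b * y\<close>, which irrationality excludes unless
  \<open>z = 0\<close>.\<close>

lemma elt_eq_0_iff: "elt x y z = 0 \<longleftrightarrow> x = 0 \<and> y = 0 \<and> z = 0"
proof
  assume 0: "elt x y z = 0"
  define r s t B where "r = real_of_int x" and "s = real_of_int y" and "t = real_of_int z" and "B = real_of_int b"
  have e: "r + s * \<theta> + t * \<eta> = 0" using 0 by (simp add: elt_def r_def s_def t_def)
  have tt: "\<theta> * \<theta> = B * \<eta>" and te: "\<theta> * \<eta> = real_of_int a * B" using theta_sq theta_eta by (simp_all add: B_def)
  have "\<theta> * (r + s * \<theta> + t * \<eta>) = 0" using e by simp
  moreover have "\<theta> * (r + s * \<theta> + t * \<eta>) = r * \<theta> + s * (\<theta> * \<theta>) + t * (\<theta> * \<eta>)"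
    by (simp add: algebra_simps)
  ultimately have e2: "r * \<theta> + s * B * \<eta> + t * (real_of_int a * B) = 0"
    unfolding tt te by (simp add: mult.assoc)
  have "t * (r * \<theta> + s * B * \<eta> + t * (real_of_int a * B)) - s * B * (r + s * \<theta> + t * \<eta>) = 0"
    unfolding e e2 by simp
  then have "(t * r - s * B * s) * \<theta> = s * B * r - t * t * (real_of_int a * B)"
    by (simp add: algebra_simps)
  then have "of_int (z * x - y * b * y) * \<theta> = of_int (y * b * x - z * z * (a * b))"
    by (simp add: r_def s_def t_def B_def)
  from theta_neq_ratio[OF this] have zx: "z * x = b * y ^ 2" by (simp add: power2_eq_square)
  with \<open>of_int (z * x - y * b * y) * \<theta> = of_int (y * b * x - z * z * (a * b))\<close>
  have "real_of_int (y * b * x - z * z * (a * b)) = 0" by (simp add: power2_eq_square)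
  then have "y * b * x = z * z * (a * b)" by (simp only: of_int_eq_0_iff)
  then have "b * (y * x) = b * (a * z ^ 2)" by (simp add: power2_eq_square mult_ac)
  then have yx: "y * x = a * z ^ 2" using b_nonzero by simp
  show "x = 0 \<and> y = 0 \<and> z = 0"
  proof (cases "z = 0")
    case True
    then have "y = 0" using zx b_nonzero by simp
    then show ?thesis using 0 True by (simp add: elt_def)
  next
    case False
    have "a * b ^ 2 * z ^ 3 = b ^ 2 * (z * (a * z ^ 2))" by (simp add: power2_eq_square power3_eq_cube)
    also have "\<dots> = b ^ 2 * y * (z * x)" unfolding yx[symmetric] by (simp add: mult_ac)
    also have "\<dots> = (b * y) ^ 3" unfolding zx by (simp add: power2_eq_square power3_eq_cube)
    finally have "a * b ^ 2 * z ^ 3 = (b * y) ^ 3" .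
    moreover have "(\<theta> * of_int z) ^ 3 = of_int (a * b ^ 2 * z ^ 3)"
      unfolding power_mult_distrib theta_cube by simp
    ultimately have "(\<theta> * of_int z) ^ 3 = (of_int (b * y)) ^ 3" by (simp only: of_int_power)
    then have "root 3 ((\<theta> * of_int z) ^ 3) = root 3 ((of_int (b * y)) ^ 3)" by (simp only:)
    then have "\<theta> * of_int z = of_int (b * y)" by (simp only: root_3_cube)
    then show ?thesis using theta_neq_ratio[of z "b * y"] False by (simp add: mult.commute)
  qed
qed (simp add: elt_def)

lemma elt_add: "elt x y z + elt x' y' z' = elt (x + x') (y + y') (z + z')"
  by (simp add: elt_def algebra_simps)

lemma elt_diff: "elt x y z - elt x' y' z' = elt (x - x') (y - y') (z - z')"
  by (simp add: elt_def algebra_simps)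

lemma elt_minus: "- elt x y z = elt (- x) (- y) (- z)"
  by (simp add: elt_def)

lemma elt_scale: "of_int n * elt x y z = elt (n * x) (n * y) (n * z)"
  by (simp add: elt_def algebra_simps)

lemma elt_of_int: "elt n 0 0 = of_int n"
  by (simp add: elt_def)

lemma elt_eq_iff: "elt x y z = elt x' y' z' \<longleftrightarrow> x = x' \<and> y = y' \<and> z = z'"
  using elt_eq_0_iff[of "x - x'" "y - y'" "z - z'"] by (auto simp: elt_diff[symmetric])

lemma elt_mult:
  "elt x y z * elt x' y' z' =
   elt (x * x' + a * b * (y * z' + z * y')) (x * y' + y * x' + a * z * z') (x * z' + z * x' + b * y * y')"
proof -
  have "elt x y z * elt x' y' z' =
    of_int (x * x') + of_int (x * y' + y * x') * \<theta> + of_int (x * z' + z * x') * \<eta> +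
    of_int (y * y') * (\<theta> * \<theta>) + of_int (z * z') * (\<eta> * \<eta>) + of_int (y * z' + z * y') * (\<theta> * \<eta>)"
    by (simp add: elt_def algebra_simps)
  then show ?thesis unfolding theta_sq eta_sq theta_eta by (simp add: elt_def algebra_simps)
qed

lemma order_add: "u \<in> \<O> \<Longrightarrow> v \<in> \<O> \<Longrightarrow> u + v \<in> \<O>"
  unfolding \<O>_def by (auto simp: elt_add) blast

lemma order_minus: "u \<in> \<O> \<Longrightarrow> - u \<in> \<O>"
  unfolding \<O>_def by (auto simp: elt_minus) blast

lemma order_mult: "u \<in> \<O> \<Longrightarrow> v \<in> \<O> \<Longrightarrow> u * v \<in> \<O>"
  unfolding \<O>_def by (force simp: elt_mult)

lemma order_elt: "elt x y z \<in> \<O>"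
  unfolding \<O>_def by blast

lemma order_of_int: "of_int n \<in> \<O>"
  using order_elt[of n 0 0] by (simp only: elt_of_int)

lemma order_sum: "(\<And>i. i \<in> A \<Longrightarrow> f i \<in> \<O>) \<Longrightarrow> sum f A \<in> \<O>"
  by (induction A rule: infinite_finite_induct) (use order_of_int[of 0] order_add in auto)

lemma order_power: "u \<in> \<O> \<Longrightarrow> u ^ k \<in> \<O>"
  by (induction k) (use order_of_int[of 1] order_mult in auto)

lemma elt_power: "\<exists>x' y' z'. elt x y z ^ k = elt x' y' z' \<and> cubic_norm a b x' y' z' = cubic_norm a b x y z ^ k"
proof (induction k)
  case 0
  have "elt x y z ^ 0 = elt 1 0 0" "cubic_norm a b 1 0 0 = cubic_norm a b x y z ^ 0"
    by (simp_all add: elt_def cubic_norm_def)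
  then show ?case by blast
next
  case (Suc k)
  then obtain x' y' z' where *: "elt x y z ^ k = elt x' y' z'" "cubic_norm a b x' y' z' = cubic_norm a b x y z ^ k"
    by blast
  have "elt x y z ^ Suc k = elt x y z * elt x' y' z'" by (simp add: *)
  then show ?case unfolding elt_mult using cubic_norm_mult[of a b x x' y z' z y'] *(2) by fastforce
qed

section \<open>Maximality of the order\<close>

lemma dvd_of_power_dvd_mult:
  fixes q D x :: int
  assumes "prime q" "D \<noteq> 0" "multiplicity q D < k" "q ^ k dvd D * x"
  shows "q dvd x"
proof (rule ccontr)
  assume "\<not> q dvd x"
  then have "coprime (q ^ k) x" using assms(1) by (simp add: prime_imp_coprime)
  then have "q ^ k dvd D" using assms(4) by (simp add: coprime_dvd_mult_left_iff)
  then have "k \<le> multiplicity q D" using assms by (intro multiplicity_geI) auto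
  then show False using assms(3) by simp
qed

lemma in_order_of_prime_multiple:
  assumes q: "prime q" and q\<xi>: "of_int q * \<xi> \<in> \<O>" and D: "D > 0" "\<And>k. of_int D * \<xi> ^ k \<in> \<O>"
  shows "\<xi> \<in> \<O>"
proof -
  have q0: "q \<noteq> 0" using q by auto
  obtain x y z where w: "of_int q * \<xi> = elt x y z" using q\<xi> unfolding \<O>_def by blast
  have pow: "\<exists>x' y' z' u1 u2 u3. elt x y z ^ k = elt x' y' z' \<and> cubic_norm a b x' y' z' = cubic_norm a b x y z ^ k \<and>
     D * x' = q ^ k * u1 \<and> D * y' = q ^ k * u2 \<and> D * z' = q ^ k * u3" for k
  proof -
    obtain x' y' z' where *: "elt x y z ^ k = elt x' y' z'" "cubic_norm a b x' y' z' = cubic_norm a b x y z ^ k"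
      using elt_power by blast
    obtain u1 u2 u3 where u: "of_int D * \<xi> ^ k = elt u1 u2 u3" using D(2)[of k] unfolding \<O>_def by blast
    have "elt (D * x') (D * y') (D * z') = of_int D * (of_int q * \<xi>) ^ k" unfolding w * elt_scale ..
    also have "\<dots> = of_int (q ^ k) * (of_int D * \<xi> ^ k)" by (simp add: power_mult_distrib)
    also have "\<dots> = elt (q ^ k * u1) (q ^ k * u2) (q ^ k * u3)" unfolding u elt_scale ..
    finally show ?thesis using * by (metis elt_eq_iff)
  qed
  have "q dvd x \<and> q dvd y \<and> q dvd z"
  proof (cases "q dvd 3 * a * b")
    case True
    have N: "q ^ 3 dvd cubic_norm a b x y z"
    proof (cases "cubic_norm a b x y z = 0")
      case False
      \<comment> \<open>Taking norms in \<open>D * w ^ k = q ^ k * u\<close> bounds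
        \<open>3 * k\<close> by \<open>3 * multiplicity q D\<close> plus \<open>k\<close> times the
        valuation of the norm of \<open>w\<close>. As the denominators contribute less than
        \<open>k\<close>, that valuation exceeds 2.\<close>
      define k where "k = 3 * multiplicity q D + 1"
      obtain x' y' z' u1 u2 u3 where *: "cubic_norm a b x' y' z' = cubic_norm a b x y z ^ k"
        "D * x' = q ^ k * u1" "D * y' = q ^ k * u2" "D * z' = q ^ k * u3" using pow[of k] by blast
      have "D ^ 3 * cubic_norm a b x y z ^ k = (q ^ k) ^ 3 * cubic_norm a b u1 u2 u3"
        unfolding *(1)[symmetric] cubic_norm_scale[symmetric] *(2-4) ..
      then have "q ^ (k * 3) dvd D ^ 3 * cubic_norm a b x y z ^ k" by (simp add: power_mult)
      then have "k * 3 \<le> multiplicity q (D ^ 3 * cubic_norm a b x y z ^ k)"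
        using D(1) False q by (intro multiplicity_geI) auto
      also have "\<dots> = 3 * multiplicity q D + k * multiplicity q (cubic_norm a b x y z)"
      proof -
        have "prime_elem q" using q by (rule prime_imp_prime_elem)
        then show ?thesis using D(1) False
          by (simp add: prime_elem_multiplicity_mult_distrib[of q "D ^ 3"] prime_elem_multiplicity_power_distrib)
      qed
      finally have le: "3 * k \<le> (k - 1) + k * multiplicity q (cubic_norm a b x y z)" by (simp add: k_def)
      have "3 \<le> multiplicity q (cubic_norm a b x y z)"
      proof (rule ccontr)
        assume "\<not> ?thesis"
        then have "k * multiplicity q (cubic_norm a b x y z) \<le> k * 2" by (intro mult_le_mono2) simp
        then show False using le unfolding k_def by simp
      qed
      then show ?thesis by (rule multiplicity_dvd')
    qed simp
    consider "q dvd a" | "q dvd b" | "\<not> q dvd a" "\<not> q dvd b" by blast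
    then show ?thesis
    proof cases
      case 1
      then show ?thesis using prime_dvd_coords_of_ramified[OF q _ _ _ N] prime_dvd_a[OF q] by blast
    next
      case 2
      have "q ^ 3 dvd cubic_norm b a x z y" using N by (simp only: cubic_norm_swap[of b a])
      then show ?thesis using prime_dvd_coords_of_ramified[OF q, of b a x z y] prime_dvd_b[OF q] 2 by blast
    next
      case 3
      then have "q dvd 3" using True q by (auto simp: prime_dvd_mult_iff)
      moreover have "prime (3::int)" by simp
      ultimately have "q = 3" using q primes_dvd_imp_eq by blast
      then show ?thesis using three_dvd_coords[OF _ _ nc, of x y z] 3 N by simp
    qed
  next
    case False
    \<comment> \<open>Vanishing modulo \<open>q\<close> descends from a square to its root, hence
      the exponents \<open>2 ^ j\<close>; \<open>j = multiplicity q D\<close> is large enough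
      because \<open>j < 2 ^ j\<close>.\<close>
    have step: "q dvd x' \<and> q dvd y' \<and> q dvd z' \<Longrightarrow> elt x y z ^ (2 ^ j) = elt x' y' z' \<Longrightarrow> q dvd x \<and> q dvd y \<and> q dvd z"
      for j x' y' z'
    proof (induction j arbitrary: x' y' z')
      case 0
      then show ?case by (simp add: elt_eq_iff)
    next
      case (Suc j)
      obtain x1 y1 z1 where *: "elt x y z ^ (2 ^ j) = elt x1 y1 z1" using elt_power by blast
      have "elt x y z ^ (2 ^ Suc j) = elt x1 y1 z1 * elt x1 y1 z1"
        unfolding *[symmetric] by (simp add: power_add[symmetric] mult_2)
      then have "x' = x1 ^ 2 + 2 * a * b * y1 * z1" "y' = 2 * x1 * y1 + a * z1 ^ 2" "z' = 2 * x1 * z1 + b * y1 ^ 2"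
        unfolding Suc.prems(2) elt_mult elt_eq_iff by (simp_all add: power2_eq_square algebra_simps)
      then have "q dvd x1 \<and> q dvd y1 \<and> q dvd z1"
        using prime_dvd_coords_of_square[OF q False] Suc.prems(1) by blast
      then show ?case using Suc.IH * by blast
    qed
    define j where "j = multiplicity q D"
    have "multiplicity q D < 2 ^ j" unfolding j_def by (rule less_exp)
    moreover obtain x' y' z' u1 u2 u3 where *: "elt x y z ^ (2 ^ j) = elt x' y' z'"
      "D * x' = q ^ (2 ^ j) * u1" "D * y' = q ^ (2 ^ j) * u2" "D * z' = q ^ (2 ^ j) * u3" using pow[of "2 ^ j"] by blast
    ultimately have "q dvd x'" "q dvd y'" "q dvd z'"
      using dvd_of_power_dvd_mult[OF q, of D "2 ^ j"] D(1) by (metis dvd_triv_left less_irrefl)+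
    then show ?thesis using step *(1) by blast
  qed
  then obtain x1 y1 z1 where "x = q * x1" "y = q * y1" "z = q * z1" by blast
  then have "of_int q * \<xi> = of_int q * elt x1 y1 z1" unfolding w elt_scale by simp
  then show ?thesis using q0 order_elt by simp
qed

text \<open>
  Maximality of \<open>\<O>\<close>. For a prime \<open>q\<close> with \<open>q * \<xi> = w \<in> \<O>\<close>, bounded denominators of the powers of \<open>\<xi>\<close>
  make \<open>w\<close> nilpotent modulo \<open>q\<close> if \<open>q\<close> is unramified, and its norm divisible by \<open>q\<^sup>3\<close> if \<open>q\<close> divides
  \<open>3 * a * b\<close>; either way \<open>w \<in> q \<O>\<close>.
\<close>

theorem in_order_of_bounded_powers:
  assumes "\<xi> \<in> K" and D: "D > 0" "\<And>k. of_int D * \<xi> ^ k \<in> \<O>"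
  shows "\<xi> \<in> \<O>"
proof -
  have "E > 0 \<Longrightarrow> of_int (int E) * \<xi> \<in> \<O> \<Longrightarrow> (\<And>k. of_int D * \<xi> ^ k \<in> \<O>) \<Longrightarrow> \<xi> \<in> \<O>" for E :: nat and \<xi>
  proof (induction E arbitrary: \<xi> rule: less_induct)
    case (less E)
    show ?case
    proof (cases "E = 1")
      case False
      then obtain q where q: "prime q" "q dvd E" using prime_factor_nat by blast
      then obtain E' where E: "E = q * E'" by blast
      have E': "E' > 0" "E' < E" using E less.prems(1) prime_gt_1_nat[OF q(1)] by auto
      have "of_int (int E') * \<xi> \<in> \<O>"
      proof (rule in_order_of_prime_multiple)
        show "prime (int q)" using q(1) by simp
        show "of_int (int q) * (of_int (int E') * \<xi>) \<in> \<O>" using less.prems(2) by (simp add: E mult.assoc)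
        show "of_int D * (of_int (int E') * \<xi>) ^ k \<in> \<O>" for k
        proof -
          have "of_int D * (of_int (int E') * \<xi>) ^ k = of_int (int E' ^ k) * (of_int D * \<xi> ^ k)"
            by (simp only: power_mult_distrib of_int_power mult_ac)
          then show ?thesis using order_mult[OF order_of_int less.prems(3)] by (simp only:)
        qed
      qed (rule D(1))
      then show ?thesis using less.IH[OF E'(2,1)] less.prems(3) by blast
    qed (use less.prems in simp)
  qed
  moreover obtain E where "E > 0" "of_int E * \<xi> \<in> \<O>" using assms(1) unfolding K_def by blast
  ultimately show ?thesis using D(2) by (metis zero_less_imp_eq_int of_nat_0_less_iff)
qed

end

section \<open>The ambient type as a ring, a vector space and a module\<close>

lemma ring_of_type_algebra_simps:
  "carrier (ring_of_type_algebra :: 'a::ring_1 ring) = UNIV"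
  "x \<otimes>\<^bsub>ring_of_type_algebra\<^esub> y = (x * y :: 'a)"
  "x \<oplus>\<^bsub>ring_of_type_algebra\<^esub> y = (x + y :: 'a)"
  "\<one>\<^bsub>ring_of_type_algebra\<^esub> = (1 :: 'a)"
  "\<zero>\<^bsub>ring_of_type_algebra\<^esub> = (0 :: 'a)"
  by (simp_all add: ring_of_type_algebra_def)

lemma a_inv_ring_of_type_algebra: "\<ominus>\<^bsub>ring_of_type_algebra\<^esub> x = - (x :: 'a::comm_ring_1)"
proof -
  interpret cring "ring_of_type_algebra :: 'a ring" by (rule cring_from_type_algebra)
  show ?thesis by (rule minus_equality) (simp_all add: ring_of_type_algebra_simps)
qed

lemma m_inv_ring_of_type_algebra:
  assumes "(x :: 'a::field) \<noteq> 0"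
  shows "inv\<^bsub>ring_of_type_algebra\<^esub> x = inverse x"
proof -
  interpret cring "ring_of_type_algebra :: 'a ring" by (rule cring_from_type_algebra)
  show ?thesis by (rule comm_inv_char) (use assms in \<open>simp_all add: ring_of_type_algebra_simps\<close>)
qed

lemma subring_ring_of_type_algebra_iff:
  "subring R (ring_of_type_algebra :: 'a::comm_ring_1 ring) \<longleftrightarrow>
     1 \<in> R \<and> (\<forall>x\<in>R. - x \<in> R) \<and> (\<forall>x\<in>R. \<forall>y\<in>R. x + y \<in> R) \<and> (\<forall>x\<in>R. \<forall>y\<in>R. x * y \<in> R)"
proof
  assume "subring R (ring_of_type_algebra :: 'a ring)"
  from subringE(3,5,6,7)[OF this] show "1 \<in> R \<and> (\<forall>x\<in>R. - x \<in> R) \<and> (\<forall>x\<in>R. \<forall>y\<in>R. x + y \<in> R) \<and> (\<forall>x\<in>R. \<forall>y\<in>R. x * y \<in> R)"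
    unfolding ring_of_type_algebra_simps a_inv_ring_of_type_algebra by blast
next
  interpret cring "ring_of_type_algebra :: 'a ring" by (rule cring_from_type_algebra)
  assume "1 \<in> R \<and> (\<forall>x\<in>R. - x \<in> R) \<and> (\<forall>x\<in>R. \<forall>y\<in>R. x + y \<in> R) \<and> (\<forall>x\<in>R. \<forall>y\<in>R. x * y \<in> R)"
  then show "subring R (ring_of_type_algebra :: 'a ring)"
    by (intro subringI) (auto simp: ring_of_type_algebra_simps a_inv_ring_of_type_algebra)
qed

lemma vector_space_of_rat: "vector_space (\<lambda>q x. of_rat q * (x :: 'a::field_char_0))"
  by unfold_locales (auto simp: algebra_simps of_rat_add of_rat_mult)

lemma module_of_int: "Modules.module (\<lambda>(n::int) x. of_int n * (x :: 'a::comm_ring_1))"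
  by unfold_locales (auto simp: algebra_simps)

lemma common_denominator:
  fixes u :: "'b \<Rightarrow> rat"
  assumes "finite A"
  shows "\<exists>D>0. \<forall>v\<in>A. \<exists>n. of_int D * u v = of_int n"
  using assms
proof (induction A rule: finite_induct)
  case empty
  then show ?case by (intro exI[of _ 1]) simp
next
  case (insert w A)
  then obtain D where D: "D > 0" "\<forall>v\<in>A. \<exists>n. of_int D * u v = of_int n" by blast
  obtain c d where cd: "d > 0" "u w = of_int c / of_int d"
    by (metis Fract_of_int_quotient quotient_of_denom_pos quotient_of_div surj_pair)
  have "of_int (D * d) * u w = of_int (D * c)" using cd by simp
  moreover have "\<exists>n. of_int (D * d) * u v = of_int n" if v: "v \<in> A" for v
  proof -
    obtain n where "of_int D * u v = of_int n" using D v by blast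
    then have "of_int (D * d) * u v = of_int (d * n)" by (simp add: mult_ac)
    then show ?thesis by blast
  qed
  ultimately show ?case using D cd(1) by (intro exI[of _ "D * d"]) (auto simp del: of_int_mult)
qed

text \<open>Clearing denominators in a rational relation. Ranks over the integers thereby become
  bounded by dimensions over the rationals.\<close>

lemma rat_independent_of_int_independent:
  fixes B :: "'a::field_char_0 set"
  assumes "int_independent B"
  shows "\<not> module.dependent (\<lambda>q x. of_rat q * x) B"
proof
  interpret vs: vector_space "\<lambda>q x. of_rat q * (x :: 'a)" by (rule vector_space_of_rat)
  interpret zm: Modules.module "\<lambda>(n::int) x. of_int n * (x :: 'a)" by (rule module_of_int)
  assume "vs.dependent B"
  then obtain t u w where t: "finite t" "t \<subseteq> B" "(\<Sum>v\<in>t. of_rat (u v) * v) = 0" and w: "w \<in> t" "u w \<noteq> 0"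
    unfolding vs.dependent_explicit by blast
  obtain D where D: "D > 0" "\<forall>v\<in>t. \<exists>n. of_int D * u v = of_int n"
    using common_denominator[OF t(1)] by blast
  then obtain n where n: "\<And>v. v \<in> t \<Longrightarrow> of_int D * u v = of_int (n v)" by metis
  have "(\<Sum>v\<in>t. of_int (n v) * v) = (\<Sum>v\<in>t. of_int D * (of_rat (u v) * v))"
  proof (rule sum.cong[OF refl])
    fix v assume "v \<in> t"
    have "(of_int (n v) :: 'a) = of_rat (of_int D * u v)" unfolding n[OF \<open>v \<in> t\<close>] by simp
    then show "of_int (n v) * v = of_int D * (of_rat (u v) * v)" by (simp add: of_rat_mult mult.assoc)
  qed
  also have "\<dots> = 0" unfolding sum_distrib_left[symmetric] t(3) by simp
  finally have "(\<Sum>v\<in>t. of_int (n v) * v) = 0" .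
  moreover have "n w \<noteq> 0" using n[OF w(1)] w(2) D(1) by auto
  ultimately have "zm.dependent B" unfolding zm.dependent_explicit using t(1,2) w(1) by blast
  then show False using assms unfolding int_independent_def by blast
qed

lemma int_dependentE:
  fixes S :: "'a::field_char_0 set"
  assumes "finite S" "\<not> int_independent S"
  obtains u :: "'a \<Rightarrow> int" and v where "v \<in> S" "u v \<noteq> 0" "(\<Sum>v\<in>S. of_int (u v) * v) = 0"
proof -
  interpret zm: Modules.module "\<lambda>(n::int) x. of_int n * (x :: 'a)" by (rule module_of_int)
  show thesis using that assms(2) unfolding int_independent_def zm.dependent_finite[OF assms(1)] by blast
qed

section \<open>The field, its degree and its ring of integers\<close>

context pure_cubic
begin

lemma order_subset_K: "\<O> \<subseteq> K"
  unfolding K_def by (auto intro!: exI[of _ 1])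

lemma K_add: "u \<in> K \<Longrightarrow> v \<in> K \<Longrightarrow> u + v \<in> K"
proof -
  assume "u \<in> K" "v \<in> K"
  then obtain D E where *: "D > 0" "of_int D * u \<in> \<O>" "E > 0" "of_int E * v \<in> \<O>" unfolding K_def by blast
  have "of_int (D * E) * (u + v) = of_int E * (of_int D * u) + of_int D * (of_int E * v)"
    by (simp add: algebra_simps)
  also have "\<dots> \<in> \<O>" by (rule order_add[OF order_mult[OF order_of_int *(2)] order_mult[OF order_of_int *(4)]])
  finally show ?thesis using * unfolding K_def by (auto intro!: exI[of _ "D * E"])
qed

lemma K_mult: "u \<in> K \<Longrightarrow> v \<in> K \<Longrightarrow> u * v \<in> K"
proof -
  assume "u \<in> K" "v \<in> K"
  then obtain D E where *: "D > 0" "of_int D * u \<in> \<O>" "E > 0" "of_int E * v \<in> \<O>" unfolding K_def by blast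
  have "of_int (D * E) * (u * v) = (of_int D * u) * (of_int E * v)"
    by (simp add: algebra_simps)
  also have "\<dots> \<in> \<O>" by (rule order_mult[OF *(2,4)])
  finally show ?thesis using * unfolding K_def by (auto intro!: exI[of _ "D * E"])
qed

text \<open>The second factor is the product of the two other conjugates, expressed in the real
  basis; it provides the inverses in \<open>K\<close>.\<close>

lemma elt_mult_adjugate:
  "elt x y z * elt (x ^ 2 - a * b * y * z) (a * z ^ 2 - x * y) (b * y ^ 2 - x * z) = of_int (cubic_norm a b x y z)"
  unfolding elt_mult elt_of_int[symmetric] elt_eq_iff cubic_norm_def
  by (simp add: algebra_simps power2_eq_square power3_eq_cube)

lemma cubic_norm_nonzero:
  assumes "elt x y z \<noteq> 0"
  shows "cubic_norm a b x y z \<noteq> 0"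
proof
  assume "cubic_norm a b x y z = 0"
  then have "elt (x ^ 2 - a * b * y * z) (a * z ^ 2 - x * y) (b * y ^ 2 - x * z) = 0"
    using elt_mult_adjugate[of x y z] assms by simp
  then have 1: "x ^ 2 = a * b * y * z" "a * z ^ 2 = x * y" "b * y ^ 2 = x * z" unfolding elt_eq_0_iff by auto
  have "x ^ 3 = x * x ^ 2" by (simp add: power2_eq_square power3_eq_cube)
  also have "\<dots> = a * b * y * (x * z)" unfolding 1 by (simp add: mult_ac)
  also have "\<dots> = a * b ^ 2 * y ^ 3" unfolding 1(3)[symmetric] by (simp add: power2_eq_square power3_eq_cube mult_ac)
  finally have x3: "x ^ 3 = a * b ^ 2 * y ^ 3" .
  have "(\<theta> * of_int y) ^ 3 = of_int (a * b ^ 2 * y ^ 3)"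
    unfolding power_mult_distrib theta_cube by simp
  then have "(\<theta> * of_int y) ^ 3 = (of_int x) ^ 3" by (simp only: x3[symmetric] of_int_power)
  then have "root 3 ((\<theta> * of_int y) ^ 3) = root 3 ((of_int x) ^ 3)" by (simp only:)
  then have "\<theta> * of_int y = of_int x" by (simp only: root_3_cube)
  then have "y = 0" using theta_neq_ratio[of y x] by (simp add: mult.commute)
  then show False using 1 assms a_nonzero by (simp add: elt_eq_0_iff)
qed

lemma K_inverse:
  assumes "u \<in> K"
  shows "inverse u \<in> K"
proof (cases "u = 0")
  case False
  obtain D x y z where D: "D > 0" "of_int D * u = elt x y z" using assms unfolding K_def \<O>_def by blast
  have nz: "elt x y z \<noteq> 0" using False D by (metis mult_eq_0_iff of_int_0_eq_iff less_irrefl)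
  define N where "N = cubic_norm a b x y z"
  have N: "N \<noteq> 0" unfolding N_def using cubic_norm_nonzero[OF nz] .
  define w where "w = elt (x ^ 2 - a * b * y * z) (a * z ^ 2 - x * y) (b * y ^ 2 - x * z)"
  have "of_int D * u * w = of_int N" unfolding D(2) w_def N_def by (rule elt_mult_adjugate)
  then have "of_int N * inverse u = of_int D * w" using False by (simp add: field_simps)
  then have "of_int (\<bar>N\<bar>) * inverse u = of_int (sgn N * D) * w"
    by (cases "N > 0") (auto simp: sgn_if)
  also have "\<dots> \<in> \<O>" unfolding w_def by (intro order_mult order_of_int order_elt)
  finally show ?thesis unfolding K_def using N by (auto intro!: exI[of _ "\<bar>N\<bar>"])
qed (use assms in simp)

lemma rat_adjoin_theta: "rat_adjoin \<theta> = K"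
proof
  let ?R = "ring_of_type_algebra :: real ring"
  have theta: "\<theta> \<in> \<O>" using order_elt[of 0 1 0] by (simp add: elt_def)
  show "rat_adjoin \<theta> \<subseteq> K"
  proof
    fix h assume "h \<in> rat_adjoin \<theta>"
    then show "h \<in> K" unfolding rat_adjoin_def
    proof (induction rule: generate_field.induct)
      case one
      then show ?case using order_subset_K order_of_int[of 1] by (auto simp: ring_of_type_algebra_simps)
    next
      case (incl h)
      then show ?case using order_subset_K theta by auto
    next
      case (a_inv h)
      then show ?case using K_mult[of "of_int (-1)" h] order_subset_K order_of_int[of "-1"]
        by (auto simp: a_inv_ring_of_type_algebra)
    next
      case (m_inv h)
      then show ?case using K_inverse by (simp add: m_inv_ring_of_type_algebra ring_of_type_algebra_simps)
    qed (simp_all add: ring_of_type_algebra_simps K_add K_mult)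
  qed
  let ?G = "rat_adjoin \<theta>"
  have G: "1 \<in> ?G" "\<theta> \<in> ?G" "\<And>h. h \<in> ?G \<Longrightarrow> - h \<in> ?G" "\<And>h k. h \<in> ?G \<Longrightarrow> k \<in> ?G \<Longrightarrow> h + k \<in> ?G"
    "\<And>h k. h \<in> ?G \<Longrightarrow> k \<in> ?G \<Longrightarrow> h * k \<in> ?G" "\<And>h. h \<in> ?G \<Longrightarrow> h \<noteq> 0 \<Longrightarrow> inverse h \<in> ?G"
    using generate_field.one[of ?R "{\<theta>}"] generate_field.incl[of \<theta> "{\<theta>}" ?R] generate_field.a_inv[of _ ?R "{\<theta>}"]
      generate_field.eng_add[of _ ?R "{\<theta>}"] generate_field.eng_mult[of _ ?R "{\<theta>}"] generate_field.m_inv[of _ ?R "{\<theta>}"]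
    by (simp_all add: rat_adjoin_def ring_of_type_algebra_simps a_inv_ring_of_type_algebra m_inv_ring_of_type_algebra)
  have G0: "0 \<in> ?G" using G(4)[OF G(1) G(3)[OF G(1)]] by simp
  have nat: "of_nat n \<in> ?G" for n by (induction n) (use G0 G(1,4) in auto)
  have int: "of_int n \<in> ?G" for n
    by (cases n rule: int_cases2) (use nat G(3) in auto)
  show "K \<subseteq> ?G"
  proof
    fix u assume "u \<in> K"
    then obtain D x y z where D: "D > 0" "of_int D * u = elt x y z" unfolding K_def \<O>_def by blast
    then have u: "u = inverse (of_int D) * (of_int x + of_int y * \<theta> + of_int z * (\<theta> * \<theta> * inverse (of_int b)))"
      by (simp add: elt_def \<eta>_def field_simps power2_eq_square)
    show "u \<in> ?G" unfolding u using D(1) b_nonzero by (intro G int) auto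
  qed
qed

lemma algebraic_int_elt: "algebraic_int (elt x y z)"
proof (rule algebraic_int.intros)
  define s N where "s = 3 * (x ^ 2 - a * b * y * z)" and "N = cubic_norm a b x y z"
  \<comment> \<open>The characteristic polynomial: \<open>3 * x\<close> is the trace,
    \<open>s\<close> the second elementary symmetric function of the conjugates, \<open>N\<close>
    the norm.\<close>
  define p where "p = [: of_int (- N), of_int s, of_int (- 3 * x), 1 :: real :]"
  show "lead_coeff p = 1" by (simp add: p_def)
  show "\<forall>i. coeff p i \<in> \<int>" by (auto simp: p_def coeff_pCons split: nat.splits)
  let ?w = "elt x y z"
  have "poly p ?w = of_int (- N) + of_int s * ?w + of_int (- 3 * x) * (?w * ?w) + ?w * (?w * ?w)"
    by (simp add: p_def algebra_simps)
  also have "\<dots> = elt 0 0 0"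
    unfolding elt_mult elt_scale elt_of_int[of "- N", symmetric] elt_add elt_eq_iff
    by (simp add: s_def N_def cubic_norm_def algebra_simps power2_eq_square power3_eq_cube)
  finally show "poly p ?w = 0" by (simp add: elt_def)
qed

text \<open>A monic integral equation of degree \<open>d\<close> reduces each power of
  \<open>\<xi>\<close> to lower ones, so \<open>E ^ d\<close> is a denominator for all powers at
  once.\<close>

theorem ring_of_integers_K: "ring_of_integers K = \<O>"
proof
  show "\<O> \<subseteq> ring_of_integers K"
    using order_subset_K algebraic_int_elt unfolding ring_of_integers_def \<O>_def by blast
  show "ring_of_integers K \<subseteq> \<O>"
  proof
    fix \<xi> assume "\<xi> \<in> ring_of_integers K"
    then have \<xi>: "\<xi> \<in> K" "algebraic_int \<xi>" by (auto simp: ring_of_integers_def)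
    obtain E where E: "E > 0" "of_int E * \<xi> \<in> \<O>" using \<xi>(1) unfolding K_def by blast
    obtain p where p: "lead_coeff p = 1" "\<forall>i. coeff p i \<in> \<int>" "poly p \<xi> = 0"
      using \<xi>(2) by (auto elim: algebraic_int.cases)
    define d where "d = degree p"
    have "of_int (E ^ d) * \<xi> ^ k \<in> \<O>" for k
    proof (induction k rule: less_induct)
      case (less k)
      show ?case
      proof (cases "k < d")
        case True
        then have "E ^ d = E ^ (d - k) * E ^ k" by (simp flip: power_add)
        then have "of_int (E ^ d) * \<xi> ^ k = of_int (E ^ (d - k)) * (of_int E * \<xi>) ^ k"
          by (simp add: power_mult_distrib)
        then show ?thesis using E by (simp only: order_mult order_of_int order_power)
      next
        case False
        have "0 = (\<Sum>i\<le>d. coeff p i * \<xi> ^ i)" using p(3) by (simp add: poly_altdef d_def)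
        also have "\<dots> = (\<Sum>i<d. coeff p i * \<xi> ^ i) + \<xi> ^ d"
          using p(1) by (simp add: lessThan_Suc_atMost[symmetric] d_def)
        finally have "\<xi> ^ d = - (\<Sum>i<d. coeff p i * \<xi> ^ i)" by simp
        then have "\<xi> ^ (k - d) * \<xi> ^ d = - (\<Sum>i<d. coeff p i * (\<xi> ^ (k - d) * \<xi> ^ i))"
          by (simp add: sum_distrib_left mult_ac)
        then have "\<xi> ^ k = - (\<Sum>i<d. coeff p i * \<xi> ^ (k - d + i))"
          using False by (simp flip: power_add)
        then have "of_int (E ^ d) * \<xi> ^ k = - (\<Sum>i<d. coeff p i * (of_int (E ^ d) * \<xi> ^ (k - d + i)))"
          by (simp add: sum_distrib_left mult_ac)
        also have "\<dots> \<in> \<O>"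
        proof (rule order_minus, rule order_sum, rule order_mult)
          fix i assume i: "i \<in> {..<d}"
          show "coeff p i \<in> \<O>" using p(2) order_of_int by (metis Ints_cases)
          show "of_int (E ^ d) * \<xi> ^ (k - d + i) \<in> \<O>" using i False by (intro less) auto
        qed
        finally show ?thesis .
      qed
    qed
    then show "\<xi> \<in> \<O>" using in_order_of_bounded_powers[OF \<xi>(1), of "E ^ d"] E(1) by simp
  qed
qed

lemma int_independent_basis:
  assumes "t \<noteq> 0"
  shows "int_independent {1, of_int t * \<theta>, of_int t * \<eta>}" "card {1, of_int t * \<theta>, of_int t * \<eta>} = 3"
proof -
  have d: "1 \<noteq> of_int t * \<theta>" "1 \<noteq> of_int t * \<eta>" "of_int t * \<theta> \<noteq> of_int t * \<eta>"
    using elt_eq_iff[of 1 0 0 0 t 0] elt_eq_iff[of 1 0 0 0 0 t] elt_eq_iff[of 0 t 0 0 0 t] assms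
    by (auto simp: elt_def)
  then show "card {1, of_int t * \<theta>, of_int t * \<eta>} = 3" by auto
  show "int_independent {1, of_int t * \<theta>, of_int t * \<eta>}"
  proof (rule ccontr)
    assume dep: "\<not> ?thesis"
    have fin: "finite {1, of_int t * \<theta>, of_int t * \<eta>}" by simp
    obtain u v where u: "v \<in> {1, of_int t * \<theta>, of_int t * \<eta>}" "u v \<noteq> 0"
      "(\<Sum>v\<in>{1, of_int t * \<theta>, of_int t * \<eta>}. of_int (u v) * v) = 0"
      by (rule int_dependentE[OF fin dep])
    from u(3) have "elt (u 1) (u (of_int t * \<theta>) * t) (u (of_int t * \<eta>) * t) = 0"
      using d by (simp add: elt_def mult.assoc add.assoc)
    then show False using u(1,2) assms by (auto simp: elt_eq_0_iff)
  qed
qed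

lemma rat_span_basis: "module.span (\<lambda>q x. of_rat q * x) {1, \<theta>, \<eta>} = K"
proof -
  interpret vs: vector_space "\<lambda>q x. of_rat q * (x :: real)" by (rule vector_space_of_rat)
  have base: "1 \<in> \<O>" "\<theta> \<in> \<O>" "\<eta> \<in> \<O>"
    using order_elt[of 1 0 0] order_elt[of 0 1 0] order_elt[of 0 0 1] by (simp_all add: elt_def)
  have rat: "of_rat q \<in> K" for q
  proof -
    obtain D n where "D > 0" "of_int D * q = of_int n" using common_denominator[of "{q}" "\<lambda>x. x"] by auto
    moreover have "of_int D * (of_rat q :: real) = of_rat (of_int D * q)" by (simp add: of_rat_mult)
    ultimately show ?thesis unfolding K_def using order_of_int[of n] by auto
  qed
  have "vs.subspace K"
    using order_subset_K order_of_int[of 0] K_add K_mult[OF rat] by (auto simp: vs.subspace_def)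
  then have 1: "vs.span {1, \<theta>, \<eta>} \<subseteq> K"
    using base order_subset_K by (intro vs.span_minimal) auto
  have "K \<subseteq> vs.span {1, \<theta>, \<eta>}"
  proof
    fix u assume "u \<in> K"
    then obtain D x y z where D: "D > 0" "of_int D * u = elt x y z" unfolding K_def \<O>_def by blast
    have "u = of_rat (of_int x / of_int D) * 1 + of_rat (of_int y / of_int D) * \<theta> + of_rat (of_int z / of_int D) * \<eta>"
      using D by (simp add: elt_def of_rat_divide field_simps)
    moreover have "\<dots> \<in> vs.span {1, \<theta>, \<eta>}"
      by (intro vs.span_add vs.span_scale vs.span_base) auto
    ultimately show "u \<in> vs.span {1, \<theta>, \<eta>}" by (simp only:)
  qed
  with 1 show ?thesis by blast
qed

lemma nf_degree_K: "nf_degree K = 3"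
proof -
  interpret vs: vector_space "\<lambda>q x. of_rat q * (x :: real)" by (rule vector_space_of_rat)
  have "vs.independent {1, \<theta>, \<eta>}"
    using rat_independent_of_int_independent[OF int_independent_basis(1)[of 1]] by simp
  then have "vs.dim K = card {1, \<theta>, \<eta>}"
    unfolding rat_span_basis[symmetric] by (intro vs.dim_eq_card) (auto simp: vs.span_span)
  then show ?thesis using int_independent_basis(2)[of 1] by (simp add: nf_degree_def)
qed

text \<open>The multiplier \<open>t\<close> is there because a proper order need not contain
  \<open>\<theta>\<close> and \<open>\<eta>\<close> themselves.\<close>

lemma has_int_rank_3:
  assumes "R \<subseteq> K" "t \<noteq> 0" "{1, of_int t * \<theta>, of_int t * \<eta>} \<subseteq> R"
  shows "has_int_rank R 3"
proof -
  interpret vs: vector_space "\<lambda>q x. of_rat q * (x :: real)" by (rule vector_space_of_rat)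
  have "finite B \<and> card B \<le> 3" if B: "B \<subseteq> R" "int_independent B" for B
  proof -
    have "vs.independent B" using rat_independent_of_int_independent[OF B(2)] by blast
    moreover have "B \<subseteq> vs.span {1, \<theta>, \<eta>}" unfolding rat_span_basis using B(1) assms(1) by blast
    ultimately have "finite B \<and> card B \<le> card {1, \<theta>, \<eta>}" by (intro vs.independent_span_bound) auto
    then show ?thesis using int_independent_basis(2)[of 1] by simp
  qed
  moreover have "\<exists>B\<subseteq>R. int_independent B \<and> finite B \<and> card B = 3"
    using int_independent_basis[OF assms(2)] assms(3) by (intro exI[of _ "{1, of_int t * \<theta>, of_int t * \<eta>}"]) simp
  ultimately show ?thesis unfolding has_int_rank_def by blast
qed

lemma finite_common_denominator:
  assumes "finite B" "B \<subseteq> K"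
  shows "\<exists>D>0. \<forall>v\<in>B. of_int D * v \<in> \<O>"
  using assms
proof (induction B rule: finite_induct)
  case empty
  then show ?case by (intro exI[of _ 1]) simp
next
  case (insert w B)
  then obtain D where D: "D > 0" "\<forall>v\<in>B. of_int D * v \<in> \<O>" by auto
  obtain E where E: "E > 0" "of_int E * w \<in> \<O>" using insert.prems unfolding K_def by auto
  have "of_int (D * E) * v \<in> \<O>" if "v \<in> insert w B" for v
  proof -
    have "of_int (D * E) * v = of_int E * (of_int D * v)" "of_int (D * E) * v = of_int D * (of_int E * v)" by simp_all
    then show ?thesis using that D(2) E(2) order_mult order_of_int by (metis insertE)
  qed
  then show ?case using D E by (intro exI[of _ "D * E"]) (auto simp del: of_int_mult)
qed

text \<open>A common denominator of finitely many generators serves for the whole order, in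
  particular for all powers of one element.\<close>

theorem is_order_of_subset:
  assumes "is_order_of K R"
  shows "R \<subseteq> \<O>"
proof
  interpret zm: Modules.module "\<lambda>(n::int) x. of_int n * (x :: real)" by (rule module_of_int)
  fix \<xi> assume \<xi>: "\<xi> \<in> R"
  obtain B where B: "finite B" "R = int_span B" and RK: "R \<subseteq> K" and R: "subring R ring_of_type_algebra"
    using assms unfolding is_order_of_def by blast
  have "B \<subseteq> R" unfolding B(2) int_span_def by (rule zm.span_superset)
  then obtain D where D: "D > 0" "\<forall>v\<in>B. of_int D * v \<in> \<O>" using finite_common_denominator[OF B(1)] RK by blast
  have "zm.subspace {v. of_int D * v \<in> \<O>}"
  proof (rule zm.subspaceI)
    show "0 \<in> {v. of_int D * v \<in> \<O>}" using order_of_int[of 0] by simp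
    show "v + w \<in> {v. of_int D * v \<in> \<O>}" if "v \<in> {v. of_int D * v \<in> \<O>}" "w \<in> {v. of_int D * v \<in> \<O>}" for v w
      using that order_add by (simp add: distrib_left)
    show "of_int n * v \<in> {v. of_int D * v \<in> \<O>}" if "v \<in> {v. of_int D * v \<in> \<O>}" for n v
      using order_mult[OF order_of_int[of n], of "of_int D * v"] that by (simp add: mult_ac)
  qed
  then have DR: "R \<subseteq> {v. of_int D * v \<in> \<O>}"
    unfolding B(2) int_span_def using D(2) by (intro zm.span_minimal) auto
  have "\<xi> ^ k \<in> R" for k
    using R \<xi> unfolding subring_ring_of_type_algebra_iff by (induction k) auto
  then have "of_int D * \<xi> ^ k \<in> \<O>" for k using DR by blast
  then show "\<xi> \<in> \<O>" using in_order_of_bounded_powers[of \<xi> D] D(1) \<xi> RK by blast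
qed

end

section \<open>Orders of pure cubic fields\<close>

context pure_cubic
begin

text \<open>
  An order contains \<open>1\<close>, so it amounts to a sublattice of \<open>\<int>\<^sup>2\<close>, the lattice of \<open>\<theta>\<close>- and \<open>\<eta>\<close>-coordinates,
  that is closed under \<open>(y, z) (y', z') = (a z z', b y y')\<close>. Here it is given by the Hermite basis
  \<open>(e, f)\<close>, \<open>(0, g)\<close>.
\<close>

definition lat :: "int \<Rightarrow> int \<Rightarrow> int \<Rightarrow> real set" where
  "lat e f g = {elt x (e * i) (f * i + g * j) | x i j. True}"

lemma elt_in_lat_iff: "elt x y z \<in> lat e f g \<longleftrightarrow> (\<exists>i j. y = e * i \<and> z = f * i + g * j)"
  unfolding lat_def by (auto simp: elt_eq_iff)

lemma order_index_eq: "order_index K R = card ((\<lambda>u. (\<lambda>h. h + u) ` R) ` \<O>)"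
proof -
  have "a_rcosets\<^bsub>ring_of_type_algebra\<lparr>carrier := \<O>\<rparr>\<^esub> R = (\<lambda>u. (\<lambda>h. h + u) ` R) ` \<O>"
    unfolding A_RCOSETS_def RCOSETS_def r_coset_def by (auto simp: ring_of_type_algebra_def)
  then show ?thesis unfolding order_index_def ring_of_integers_K by simp
qed

lemma coset_eq_iff:
  fixes R :: "'a::ab_group_add set"
  assumes "0 \<in> R" "\<And>u. u \<in> R \<Longrightarrow> - u \<in> R" "\<And>u v. u \<in> R \<Longrightarrow> v \<in> R \<Longrightarrow> u + v \<in> R"
  shows "(\<lambda>h. h + u) ` R = (\<lambda>h. h + v) ` R \<longleftrightarrow> u - v \<in> R"
proof
  assume "(\<lambda>h. h + u) ` R = (\<lambda>h. h + v) ` R"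
  moreover have "u \<in> (\<lambda>h. h + u) ` R" using assms(1) by (auto intro!: image_eqI[of _ _ 0])
  ultimately obtain h where "u = h + v" "h \<in> R" by auto
  then show "u - v \<in> R" by simp
next
  have *: "(\<lambda>h. h + u) ` R \<subseteq> (\<lambda>h. h + v) ` R" if "u - v \<in> R" for u v
  proof
    fix w assume "w \<in> (\<lambda>h. h + u) ` R"
    then obtain h where "h \<in> R" "w = h + u" by auto
    then have "w = (h + (u - v)) + v" "h + (u - v) \<in> R" using assms(3) that by auto
    then show "w \<in> (\<lambda>h. h + v) ` R" by blast
  qed
  assume "u - v \<in> R"
  then show "(\<lambda>h. h + u) ` R = (\<lambda>h. h + v) ` R"
    using *[of u v] *[of v u] assms(2)[of "u - v"] by auto
qed

lemma lat_group:
  "0 \<in> lat e f g" "u \<in> lat e f g \<Longrightarrow> - u \<in> lat e f g"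
  "u \<in> lat e f g \<Longrightarrow> v \<in> lat e f g \<Longrightarrow> u + v \<in> lat e f g"
proof -
  have "elt 0 0 0 \<in> lat e f g" unfolding elt_in_lat_iff by (intro exI[of _ 0]) simp
  then show "0 \<in> lat e f g" by (simp add: elt_def)
  assume "u \<in> lat e f g"
  then obtain x i j where u: "u = elt x (e * i) (f * i + g * j)" unfolding lat_def by blast
  have "- u = elt (- x) (e * (- i)) (f * (- i) + g * (- j))" unfolding u elt_minus by (simp add: algebra_simps)
  then show "- u \<in> lat e f g" unfolding lat_def by blast
  assume "v \<in> lat e f g"
  then obtain x' i' j' where v: "v = elt x' (e * i') (f * i' + g * j')" unfolding lat_def by blast
  have "u + v = elt (x + x') (e * (i + i')) (f * (i + i') + g * (j + j'))"
    unfolding u v elt_add by (simp add: algebra_simps)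
  then show "u + v \<in> lat e f g" unfolding lat_def by blast
qed

text \<open>The pairs \<open>(y, z)\<close> with \<open>0 \<le> y < e\<close> and
  \<open>0 \<le> z < g\<close> represent the cosets: \<open>y\<close> is reduced with
  \<open>(e, f)\<close>, and then \<open>z\<close> with \<open>(0, g)\<close>.\<close>

theorem order_index_lat:
  assumes "e > 0" "g > 0"
  shows "order_index K (lat e f g) = nat (e * g)"
proof -
  let ?R = "lat e f g"
  let ?c = "\<lambda>u. (\<lambda>h. h + u) ` ?R"
  have eq: "?c u = ?c v \<longleftrightarrow> u - v \<in> ?R" for u v
    by (rule coset_eq_iff) (use lat_group in blast)+
  define F where "F = (\<lambda>(y, z). ?c (elt 0 y z))"
  have "bij_betw F ({0..<e} \<times> {0..<g}) (?c ` \<O>)"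
    unfolding bij_betw_def
  proof
    show "inj_on F ({0..<e} \<times> {0..<g})"
    proof (rule inj_onI, clarify)
      fix y z y' z' assume b: "y \<in> {0..<e}" "z \<in> {0..<g}" "y' \<in> {0..<e}" "z' \<in> {0..<g}" and "F (y, z) = F (y', z')"
      then have "elt 0 (y - y') (z - z') \<in> ?R" unfolding F_def using eq by (simp add: elt_diff)
      then obtain i j where ij: "y - y' = e * i" "z - z' = f * i + g * j" unfolding elt_in_lat_iff by blast
      have "\<bar>e * i\<bar> < e" unfolding ij(1)[symmetric] using b by auto
      then have "i = 0" using assms(1) by (simp add: abs_mult)
      then have "\<bar>g * j\<bar> < g" using ij(2) b by auto
      then have "j = 0" using assms(2) by (simp add: abs_mult)
      then show "y = y' \<and> z = z'" using \<open>i = 0\<close> ij by simp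
    qed
    show "F ` ({0..<e} \<times> {0..<g}) = ?c ` \<O>"
    proof
      show "F ` ({0..<e} \<times> {0..<g}) \<subseteq> ?c ` \<O>" unfolding F_def using order_elt by auto
      show "?c ` \<O> \<subseteq> F ` ({0..<e} \<times> {0..<g})"
      proof
        fix w assume "w \<in> ?c ` \<O>"
        then obtain x y z where w: "w = ?c (elt x y z)" unfolding \<O>_def by blast
        define y' z' where "y' = y mod e" and "z' = (z - f * (y div e)) mod g"
        have "elt x y z - elt 0 y' z' \<in> ?R"
          unfolding elt_diff elt_in_lat_iff
          by (intro exI[of _ "y div e"] exI[of _ "(z - f * (y div e)) div g"])
             (simp add: y'_def z'_def minus_mod_eq_mult_div[symmetric])
        then have "w = F (y', z')" unfolding w F_def using eq by simp
        moreover have "(y', z') \<in> {0..<e} \<times> {0..<g}" using assms by (simp add: y'_def z'_def)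
        ultimately show "w \<in> F ` ({0..<e} \<times> {0..<g})" by blast
      qed
    qed
  qed
  then have "card (?c ` \<O>) = card ({0..<e} \<times> {0..<g})" by (simp only: bij_betw_same_card)
  also have "\<dots> = nat (e * g)" using assms by (simp add: nat_mult_distrib)
  finally show ?thesis unfolding order_index_eq .
qed

lemma subring_add_elt:
  assumes "subring R (ring_of_type_algebra :: real ring)"
  shows "of_int n \<in> R" "u \<in> R \<Longrightarrow> of_int n * u \<in> R" "elt x y z \<in> R \<longleftrightarrow> elt 0 y z \<in> R"
proof -
  have R: "1 \<in> R" "\<And>u. u \<in> R \<Longrightarrow> - u \<in> R" "\<And>u v. u \<in> R \<Longrightarrow> v \<in> R \<Longrightarrow> u + v \<in> R"
    "\<And>u v. u \<in> R \<Longrightarrow> v \<in> R \<Longrightarrow> u * v \<in> R"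
    using assms unfolding subring_ring_of_type_algebra_iff by blast+
  have 0: "0 \<in> R" using R(3)[OF R(1) R(2)[OF R(1)]] by simp
  have nat: "of_nat n \<in> R" for n by (induction n) (use 0 R(1,3) in auto)
  show int: "of_int n \<in> R" for n by (cases n rule: int_cases2) (use nat R(2) in auto)
  show "u \<in> R \<Longrightarrow> of_int n * u \<in> R" using R(4) int by blast
  have "elt 0 y z = elt x y z + of_int (- x)" "elt x y z = elt 0 y z + of_int x" by (simp_all add: elt_def)
  then show "elt x y z \<in> R \<longleftrightarrow> elt 0 y z \<in> R" using R(3) int by metis
qed

text \<open>By pigeonhole on the cosets, a positive multiple of each element of \<open>\<O>\<close>
  lies in \<open>R\<close>. This makes the least positive \<open>e\<close> and \<open>g\<close> of
  the Hermite basis exist; division with remainder shows that the basis spans.\<close>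

theorem finite_index_subring_is_lat:
  assumes R: "R \<subseteq> \<O>" "subring R (ring_of_type_algebra :: real ring)" and idx: "order_index K R \<noteq> 0"
  obtains e f g where "e > 0" "g > 0" "0 \<le> f" "f < g" "R = lat e f g"
proof -
  have Rc: "1 \<in> R" "\<And>u. u \<in> R \<Longrightarrow> - u \<in> R" "\<And>u v. u \<in> R \<Longrightarrow> v \<in> R \<Longrightarrow> u + v \<in> R"
    using R(2) unfolding subring_ring_of_type_algebra_iff by blast+
  note Rint = subring_add_elt[OF R(2)]
  have R0: "0 \<in> R" using Rint(1)[of 0] by simp
  let ?c = "\<lambda>u. (\<lambda>h. h + u) ` R"
  have fin: "finite (?c ` \<O>)"
  proof (rule ccontr)
    assume "infinite (?c ` \<O>)"
    then have "card (?c ` \<O>) = 0" by (rule card.infinite)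
    with idx show False unfolding order_index_eq by contradiction
  qed
  have mult: "\<exists>n>0. of_int n * u \<in> R" if u: "u \<in> \<O>" for u
  proof -
    define F where "F n = ?c (of_nat n * u)" for n :: nat
    have "F n \<in> ?c ` \<O>" for n
      unfolding F_def using order_mult[OF order_of_int[of "int n"] u] by (intro imageI) simp
    then have "range F \<subseteq> ?c ` \<O>" by blast
    then have "finite (range F)" using fin by (rule finite_subset)
    then have "\<not> inj F" using finite_imageD[of F UNIV] infinite_UNIV_nat by blast
    then obtain n k where "F n = F k" "n \<noteq> k" unfolding inj_def by blast
    then obtain n k :: nat where nk: "n < k" "F n = F k"
      by (cases n k rule: linorder_cases) auto
    have "of_nat k * u - of_nat n * u \<in> R"
      using coset_eq_iff[of R "of_nat k * u" "of_nat n * u"] R0 Rc(2,3) nk(2) unfolding F_def by blast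
    then have "of_int (int k - int n) * u \<in> R" by (simp add: algebra_simps)
    then show ?thesis using nk(1) by (intro exI[of _ "int k - int n"]) simp
  qed
  define L where "L y z \<longleftrightarrow> elt 0 y z \<in> R" for y z
  have L_iff: "elt x y z \<in> R \<longleftrightarrow> L y z" for x y z unfolding L_def by (rule Rint(3))
  have L_sub: "L (y - n * y') (z - n * z')" if "L y z" "L y' z'" for y z y' z' n
  proof -
    have "elt 0 (y - n * y') (z - n * z') = elt 0 y z + - (of_int n * elt 0 y' z')"
      by (simp add: elt_def algebra_simps)
    moreover have "elt 0 y z + - (of_int n * elt 0 y' z') \<in> R"
      using that unfolding L_def by (intro Rc(2,3) Rint(2))
    ultimately show ?thesis unfolding L_def by (simp only:)
  qed
  define e where "e = (LEAST n. 0 < n \<and> (\<exists>z. L (int n) z))"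
  define g where "g = (LEAST n. 0 < n \<and> L 0 (int n))"
  have th: "elt 0 1 0 \<in> \<O>" "elt 0 0 1 \<in> \<O>" by (rule order_elt)+
  obtain n1 where "n1 > 0" "of_int n1 * elt 0 1 0 \<in> R" using mult[OF th(1)] by blast
  then have "0 < nat n1 \<and> (\<exists>z. L (int (nat n1)) z)" unfolding L_def elt_scale by auto
  from LeastI[of "\<lambda>n. 0 < n \<and> (\<exists>z. L (int n) z)", OF this] obtain f0 where e: "e > 0" "L (int e) f0"
    unfolding e_def by blast
  obtain n2 where "n2 > 0" "of_int n2 * elt 0 0 1 \<in> R" using mult[OF th(2)] by blast
  then have "0 < nat n2 \<and> L 0 (int (nat n2))" unfolding L_def elt_scale by auto
  from LeastI[of "\<lambda>n. 0 < n \<and> L 0 (int n)", OF this] have g: "g > 0" "L 0 (int g)"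
    unfolding g_def by blast+
  define f where "f = f0 mod int g"
  have f: "0 \<le> f" "f < int g" using g(1) by (simp_all add: f_def)
  have Lf: "L (int e) f"
    using L_sub[OF e(2) g(2), of "f0 div int g"] by (simp add: f_def minus_div_mult_eq_mod)
  have "L y z \<longleftrightarrow> (\<exists>i j. y = int e * i \<and> z = f * i + int g * j)" for y z
  proof
    assume yz: "L y z"
    have "L (y mod int e) (z - y div int e * f)"
      using L_sub[OF yz Lf, of "y div int e"] by (simp add: minus_div_mult_eq_mod)
    moreover have "0 \<le> y mod int e" "y mod int e < int e" using e(1) by simp_all
    ultimately have y0: "y mod int e = 0"
      using not_less_Least[of "nat (y mod int e)" "\<lambda>n. 0 < n \<and> (\<exists>z. L (int n) z)", folded e_def] by fastforce
    then obtain i where i: "y = int e * i" by (auto elim: dvdE simp: mod_eq_0_iff_dvd)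
    define w where "w = z - i * f"
    have w: "L 0 w" using L_sub[OF yz Lf, of i] unfolding i w_def by (simp add: mult.commute)
    have "L 0 (w mod int g)" using L_sub[OF w g(2), of "w div int g"] by (simp add: minus_div_mult_eq_mod)
    moreover have "0 \<le> w mod int g" "w mod int g < int g" using g(1) by simp_all
    ultimately have "w mod int g = 0"
      using not_less_Least[of "nat (w mod int g)" "\<lambda>n. 0 < n \<and> L 0 (int n)", folded g_def] by fastforce
    then obtain j where "w = int g * j" by (auto elim: dvdE simp: mod_eq_0_iff_dvd)
    then show "\<exists>i j. y = int e * i \<and> z = f * i + int g * j"
      using i by (intro exI[of _ i] exI[of _ j]) (simp add: w_def mult.commute)
  next
    assume "\<exists>i j. y = int e * i \<and> z = f * i + int g * j"
    then obtain i j where ij: "y = int e * i" "z = f * i + int g * j" by blast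
    have "elt 0 y z = of_int i * elt 0 (int e) f + of_int j * elt 0 0 (int g)"
      unfolding ij elt_scale elt_add by (simp add: mult.commute)
    then show "L y z" using Lf g(2) Rc(3) Rint(2) unfolding L_def by simp
  qed
  then have "elt x y z \<in> R \<longleftrightarrow> elt x y z \<in> lat (int e) f (int g)" for x y z
    unfolding L_iff elt_in_lat_iff by blast
  moreover have "lat (int e) f (int g) \<subseteq> \<O>" unfolding lat_def \<O>_def by blast
  ultimately have "R = lat (int e) f (int g)" using R(1) unfolding \<O>_def by blast
  then show thesis using that[of "int e" "int g" f] e(1) g(1) f by simp
qed

text \<open>The mixed terms of a product are integer multiples of the two factors, so closure has to
  be checked only for the bilinear part \<open>(a * z * z', b * y * y')\<close>.\<close>

lemma lat_is_order:
  assumes "e > 0" "g > 0"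
    and mult: "\<And>y z y' z'. elt 0 y z \<in> lat e f g \<Longrightarrow> elt 0 y' z' \<in> lat e f g \<Longrightarrow> elt 0 (a * z * z') (b * y * y') \<in> lat e f g"
  shows "is_order_of K (lat e f g)"
  unfolding is_order_of_def nf_degree_K
proof (intro conjI)
  let ?R = "lat e f g"
  interpret zm: Modules.module "\<lambda>(n::int) x. of_int n * (x :: real)" by (rule module_of_int)
  have shift: "elt x y z \<in> ?R \<longleftrightarrow> elt 0 y z \<in> ?R" for x y z unfolding elt_in_lat_iff ..
  show sub: "?R \<subseteq> K" using order_subset_K unfolding lat_def \<O>_def by blast
  have scale: "of_int n * u \<in> ?R" if mem: "u \<in> ?R" for n u
  proof -
    obtain x i j where u: "u = elt x (e * i) (f * i + g * j)" using mem unfolding lat_def by blast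
    have "of_int n * u = elt (n * x) (e * (n * i)) (f * (n * i) + g * (n * j))"
      unfolding u elt_scale by (simp add: algebra_simps)
    then show ?thesis unfolding lat_def by blast
  qed
  show "subring ?R ring_of_type_algebra"
    unfolding subring_ring_of_type_algebra_iff
  proof (intro conjI ballI)
    have "elt 1 0 0 \<in> ?R" unfolding elt_in_lat_iff by (intro exI[of _ 0]) simp
    then show "1 \<in> ?R" by (simp add: elt_def)
    show "- u \<in> ?R" if "u \<in> ?R" for u using lat_group(2) that .
    show "u + v \<in> ?R" if "u \<in> ?R" "v \<in> ?R" for u v using lat_group(3) that .
    show "u * v \<in> ?R" if uv: "u \<in> ?R" "v \<in> ?R" for u v
    proof -
      obtain x y z x' y' z' where u: "u = elt x y z" and v: "v = elt x' y' z'" using uv unfolding lat_def by blast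
      have uv0: "elt 0 y z \<in> ?R" "elt 0 y' z' \<in> ?R"
        using shift[THEN iffD1, OF uv(1)[unfolded u]] shift[THEN iffD1, OF uv(2)[unfolded v]] .
      then have "elt 0 (a * z * z') (b * y * y') \<in> ?R" by (rule mult)
      moreover have "of_int x * elt 0 y' z' \<in> ?R" "of_int x' * elt 0 y z \<in> ?R"
        using uv0 by (blast intro: scale)+
      ultimately have "of_int x * elt 0 y' z' + of_int x' * elt 0 y z + elt 0 (a * z * z') (b * y * y') \<in> ?R"
        using lat_group(3) by blast
      moreover have "of_int x * elt 0 y' z' + of_int x' * elt 0 y z + elt 0 (a * z * z') (b * y * y') =
         elt 0 (x * y' + y * x' + a * z * z') (x * z' + z * x' + b * y * y')"
        unfolding elt_scale elt_add by (simp add: algebra_simps)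
      ultimately have "elt 0 (x * y' + y * x' + a * z * z') (x * z' + z * x' + b * y * y') \<in> ?R" by (simp only:)
      then show ?thesis unfolding u v elt_mult by (rule shift[THEN iffD2])
    qed
  qed
  have gens: "elt 1 0 0 \<in> ?R" "elt 0 e f \<in> ?R" "elt 0 0 g \<in> ?R"
    unfolding elt_in_lat_iff by (auto intro: exI[of _ 0] exI[of _ 1])
  show "\<exists>B. finite B \<and> ?R = int_span B"
  proof (intro exI conjI)
    let ?B = "{elt 1 0 0, elt 0 e f, elt 0 0 g}"
    show "finite ?B" by simp
    have "zm.subspace ?R" unfolding zm.subspace_def using lat_group scale by blast
    then have "int_span ?B \<subseteq> ?R" unfolding int_span_def using gens by (intro zm.span_minimal) auto
    moreover have "?R \<subseteq> int_span ?B"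
    proof
      fix u assume "u \<in> ?R"
      then obtain x i j where u: "u = elt x (e * i) (f * i + g * j)" unfolding lat_def by blast
      have "u = of_int x * elt 1 0 0 + of_int i * elt 0 e f + of_int j * elt 0 0 g"
        unfolding u elt_scale elt_add by (simp add: algebra_simps)
      moreover have "\<dots> \<in> int_span ?B"
        unfolding int_span_def by (intro zm.span_add zm.span_scale zm.span_base) auto
      ultimately show "u \<in> int_span ?B" by (simp only:)
    qed
    ultimately show "?R = int_span ?B" by blast
  qed
  have "elt 0 (e * g) 0 \<in> ?R" unfolding elt_in_lat_iff
    by (intro exI[of _ g] exI[of _ "- f"]) (simp add: mult.commute)
  moreover have "elt 0 0 (e * g) \<in> ?R" unfolding elt_in_lat_iff
    by (intro exI[of _ 0] exI[of _ e]) (simp add: mult.commute)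
  ultimately have "{1, of_int (e * g) * \<theta>, of_int (e * g) * \<eta>} \<subseteq> ?R" using gens(1) by (simp add: elt_def)
  then show "has_int_rank ?R 3" using assms(1,2) by (intro has_int_rank_3[OF sub, of "e * g"]) auto
qed

end

section \<open>Counting the orders of prime power index\<close>

context pure_cubic
begin

definition orders_of_index :: "nat \<Rightarrow> real set set" where
  "orders_of_index N = {R. is_order_of K R \<and> order_index K R = N}"

text \<open>In the last clause the basis is \<open>(1, f)\<close>, \<open>(0, p ^ i)\<close>. The
  square of \<open>elt 0 1 f\<close> has coordinates \<open>(a * f ^ 2, b)\<close>, and these lie in
  the lattice only if \<open>b = a * f ^ 3\<close> modulo \<open>p ^ i\<close>.\<close>

lemma order_is_lat:
  assumes p: "prime p" and R: "R \<in> orders_of_index (p ^ i)"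
  obtains t f where "t \<le> i" "f < p ^ t" "R = lat (int p ^ (i - t)) (int f) (int p ^ t)"
    "t = i \<Longrightarrow> int p ^ t dvd b - a * int f ^ 3"
proof -
  have order: "is_order_of K R" and idx: "order_index K R = p ^ i" using R by (auto simp: orders_of_index_def)
  have sub: "R \<subseteq> \<O>" "subring R ring_of_type_algebra"
    using is_order_of_subset[OF order] order unfolding is_order_of_def by blast+
  have "order_index K R \<noteq> 0" unfolding idx using prime_gt_0_nat[OF p] by simp
  with sub obtain e f g where efg: "e > 0" "g > 0" "0 \<le> f" "f < g" "R = lat e f g"
    by (rule finite_index_subring_is_lat)
  have "nat (e * g) = p ^ i" using order_index_lat[OF efg(1,2), of f] idx efg(5) by simp
  then have eg: "nat e * nat g = p ^ i" using efg(1) by (simp add: nat_mult_distrib)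
  then have "nat g dvd p ^ i" by (metis dvd_triv_right)
  then obtain t where t: "t \<le> i" "nat g = p ^ t" using divides_primepow_nat[OF p] by blast
  have "nat e * p ^ t = p ^ (i - t) * p ^ t" using eg t by (simp flip: power_add)
  then have e: "nat e = p ^ (i - t)" using prime_gt_0_nat[OF p] by simp
  have ge: "g = int p ^ t" "e = int p ^ (i - t)"
    using t(2) e efg(1,2) by (metis int_nat_eq less_imp_le of_nat_power)+
  have f: "nat f < p ^ t" "int (nat f) = f" using efg(3,4) t(2) by auto
  have "int p ^ t dvd b - a * f ^ 3" if "t = i"
  proof -
    have e1: "e = 1" using ge(2) that by simp
    have "elt 0 1 f \<in> R" unfolding efg(5) elt_in_lat_iff e1 by (intro exI[of _ 1] exI[of _ 0]) simp
    then have "elt 0 1 f * elt 0 1 f \<in> R" using sub(2) unfolding subring_ring_of_type_algebra_iff by blast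
    then obtain k l where "a * f * f = e * k" "b = f * k + g * l"
      unfolding elt_mult efg(5) elt_in_lat_iff by auto
    then have "b - a * f ^ 3 = g * l" by (simp add: e1 power3_eq_cube mult_ac)
    then show ?thesis using ge(1) by simp
  qed
  then show thesis using that[OF t(1) f(1)] f(2) ge efg(5) by simp
qed

lemma card_cube_roots_mod_prime:
  assumes p: "prime p" and "\<not> int p dvd a"
  shows "card {x\<in>{..<p}. int p dvd b - a * int x ^ 3} \<le> 3"
proof -
  have "coprime a (int p)" using p assms(2) by (metis coprime_commute prime_imp_coprime prime_nat_int_transfer)
  then obtain s where s: "[a * s = 1] (mod int p)" by (metis cong_solve_coprime_int)
  define c where "c = nat ((b * s) mod int p)"
  have p0: "int p > 0" using prime_gt_0_nat[OF p] by simp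
  then have c: "int c = (b * s) mod int p" by (simp add: c_def)
  have "{x\<in>{..<p}. int p dvd b - a * int x ^ 3} \<subseteq> {x\<in>{..<p}. [x ^ 3 = c] (mod p)}"
  proof (rule subsetI, clarify)
    fix x assume x: "x < p" "int p dvd b - a * int x ^ 3"
    then have "[b = a * int x ^ 3] (mod int p)" by (simp add: cong_iff_dvd_diff)
    then have "[b * s = a * int x ^ 3 * s] (mod int p)" by (intro cong_mult cong_refl)
    also have "a * int x ^ 3 * s = (a * s) * int x ^ 3" by simp
    also have "[(a * s) * int x ^ 3 = 1 * int x ^ 3] (mod int p)" using s by (intro cong_mult cong_refl)
    finally have "[int c = int (x ^ 3)] (mod int p)" unfolding c by simp
    then have "[x ^ 3 = c] (mod p)" by (metis cong_int_iff cong_sym)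
    then show "x \<in> {..<p} \<and> [x ^ 3 = c] (mod p)" using x(1) by simp
  qed
  then have "card {x\<in>{..<p}. int p dvd b - a * int x ^ 3} \<le> card {x\<in>{..<p}. [x ^ 3 = c] (mod p)}"
    by (intro card_mono) auto
  also have "\<dots> \<le> 3" using roots_mod_prime_bound[OF p, of 3 c] by simp
  finally show ?thesis .
qed

text \<open>If \<open>p\<close> does not divide \<open>a * b\<close>, a root modulo
  \<open>p ^ t\<close> is determined by its residue modulo \<open>p\<close>, where a cubic has at
  most 3 roots. If \<open>p dvd a\<close> there is no root; if \<open>p dvd b\<close> a root is
  divisible by \<open>p\<close>, and squarefreeness of \<open>b\<close> leaves only
  \<open>f = 0\<close> with \<open>t = 1\<close>.\<close>

lemma card_cube_roots_mod_prime_power: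
  assumes p: "prime p" "p \<noteq> 3" and t: "t > 0"
  shows "card {f\<in>{..<p ^ t}. int p ^ t dvd b - a * int f ^ 3} \<le> 3" (is "card ?F \<le> 3")
proof -
  have ip: "prime (int p)" using p(1) by simp
  have pdvd: "int p dvd b - a * int f ^ 3" if "f \<in> ?F" for f
    using that t by (metis (mono_tags, lifting) dvd_power dvd_trans mem_Collect_eq)
  show ?thesis
  proof (cases "int p dvd a")
    case True
    then have "\<not> int p dvd b" using prime_dvd_a[OF ip] by blast
    moreover have "int p dvd b" if "f \<in> ?F" for f
      using pdvd[OF that] True by (metis dvd_diff_left_iff dvd_mult2)
    ultimately have "?F = {}" by blast
    then show ?thesis by (simp only: card.empty)
  next
    case pa: False
    show ?thesis
    proof (cases "int p dvd b")
      case True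
      have pf: "int p dvd int f" if "f \<in> ?F" for f
      proof -
        have "int p dvd a * int f ^ 3" using pdvd[OF that] True by (metis dvd_diff_right_iff)
        then show ?thesis using pa ip by (auto simp: prime_dvd_mult_iff prime_dvd_power_iff)
      qed
      have "?F \<subseteq> {0}"
      proof
        fix f assume f: "f \<in> ?F"
        show "f \<in> {0}"
        proof (cases "t = 1")
          case True
          have "p dvd f" using pf[OF f] by simp
          then show ?thesis using f True by (auto dest: dvd_imp_le)
        next
          case False
          then have "int p ^ 2 dvd b - a * int f ^ 3"
            using f t by (auto intro: dvd_trans[OF le_imp_power_dvd[of 2 t]])
          moreover have "int p ^ 2 dvd a * int f ^ 3"
          proof -
            have "int p ^ 2 dvd int f ^ 2" using pf[OF f] by (rule dvd_power_same)
            then show ?thesis by (simp add: power3_eq_cube power2_eq_square)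
          qed
          ultimately have "int p ^ 2 dvd b" by (metis dvd_diff_left_iff)
          then show ?thesis using prime_dvd_b[OF ip True] by blast
        qed
      qed
      then have "card ?F \<le> card {0::nat}" by (intro card_mono) auto
      then show ?thesis by simp
    next
      case pb: False
      have nd: "\<not> int p dvd int f" if "f \<in> ?F" for f
      proof
        assume "int p dvd int f"
        then have "int p dvd a * int f ^ 3" by (simp add: power3_eq_cube)
        then show False using pdvd[OF that] pb by (metis dvd_diff_left_iff)
      qed
      have "inj_on (\<lambda>f. f mod p) ?F"
      proof (rule inj_onI)
        fix f g assume f: "f \<in> ?F" and g: "g \<in> ?F" and "f mod p = g mod p"
        then have cong: "[int f = int g] (mod int p)" by (simp only: cong_int_iff) (simp add: cong_def)
        have "int p ^ t dvd (b - a * int g ^ 3) - (b - a * int f ^ 3)" by (rule dvd_diff) (use f g in auto)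
        then have "int p ^ t dvd a * (int f ^ 3 - int g ^ 3)" by (simp add: algebra_simps)
        moreover have "coprime (int p ^ t) a" using ip pa by (simp add: prime_imp_coprime)
        ultimately have "int p ^ t dvd int f ^ 3 - int g ^ 3" by (simp add: coprime_dvd_mult_right_iff)
        then have "int p ^ t dvd int f - int g"
          using power_dvd_diff_of_cubes[OF ip _ nd[OF f] cong] p(2) by simp
        moreover have "\<bar>int f - int g\<bar> < int p ^ t" using f g by (auto simp flip: of_nat_power)
        ultimately show "f = g" by (metis abs_of_nonneg dvd_imp_le_int eq_iff_diff_eq_0 linorder_not_le of_nat_0_le_iff of_nat_eq_iff zero_le_power)
      qed
      then have "card ?F = card ((\<lambda>f. f mod p) ` ?F)" by (simp only: card_image)
      also have "\<dots> \<le> card {x\<in>{..<p}. int p dvd b - a * int x ^ 3}"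
      proof (rule card_mono)
        show "(\<lambda>f. f mod p) ` ?F \<subseteq> {x\<in>{..<p}. int p dvd b - a * int x ^ 3}"
        proof (rule image_subsetI)
          fix f assume f: "f \<in> ?F"
          have "[b - a * int f ^ 3 = b - a * int (f mod p) ^ 3] (mod int p)"
            by (intro cong_diff cong_mult cong_pow cong_refl) (simp only: cong_int_iff, simp add: cong_def)
          then have "int p dvd b - a * int (f mod p) ^ 3" using pdvd[OF f] cong_dvd_iff by blast
          then show "f mod p \<in> {x\<in>{..<p}. int p dvd b - a * int x ^ 3}" using prime_gt_0_nat[OF p(1)] by simp
        qed
      qed simp
      also have "\<dots> \<le> 3" by (rule card_cube_roots_mod_prime[OF p(1) pa])
      finally show ?thesis .
    qed
  qed
qed

text \<open>
  Counting all Hermite bases with \<open>g < p ^ i\<close> is harmless; only for \<open>g = p ^ i\<close> does one need that the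
  second coordinate \<open>f\<close> solves \<open>a * f\<^sup>3 = b\<close> modulo \<open>p ^ i\<close>.
\<close>

lemma orders_of_index_bound:
  assumes p: "prime p" "p \<noteq> 3"
  shows "finite (orders_of_index (p ^ i)) \<and>
    card (orders_of_index (p ^ i)) \<le> (if i = 0 then 1 else 3) + (\<Sum>t<i. p ^ t)"
proof -
  define F where "F t = (if t = i then {f\<in>{..<p ^ t}. int p ^ t dvd b - a * int f ^ 3} else {..<p ^ t})" for t
  define W where "W = (\<Union>t\<le>i. (\<lambda>f. lat (int p ^ (i - t)) (int f) (int p ^ t)) ` F t)"
  have finF: "finite (F t)" for t by (simp add: F_def)
  have "orders_of_index (p ^ i) \<subseteq> W"
  proof
    fix R assume "R \<in> orders_of_index (p ^ i)"
    then obtain t f where tf: "t \<le> i" "f < p ^ t" "R = lat (int p ^ (i - t)) (int f) (int p ^ t)"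
      "t = i \<Longrightarrow> int p ^ t dvd b - a * int f ^ 3" using order_is_lat[OF p(1)] by metis
    then have "f \<in> F t" by (auto simp: F_def)
    then show "R \<in> W" unfolding W_def using tf(1,3) by blast
  qed
  moreover have finW: "finite W" unfolding W_def using finF by blast
  moreover have "card W \<le> (\<Sum>t\<le>i. card (F t))"
  proof -
    have "card W \<le> (\<Sum>t\<le>i. card ((\<lambda>f. lat (int p ^ (i - t)) (int f) (int p ^ t)) ` F t))"
      unfolding W_def by (rule card_UN_le) simp
    also have "\<dots> \<le> (\<Sum>t\<le>i. card (F t))" by (intro sum_mono card_image_le finF)
    finally show ?thesis .
  qed
  moreover have "(\<Sum>t\<le>i. card (F t)) \<le> (if i = 0 then 1 else 3) + (\<Sum>t<i. p ^ t)"
  proof -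
    have "(\<Sum>t\<le>i. card (F t)) = card (F i) + (\<Sum>t<i. card (F t))"
      by (simp add: lessThan_Suc_atMost[symmetric])
    also have "(\<Sum>t<i. card (F t)) = (\<Sum>t<i. p ^ t)" by (intro sum.cong) (auto simp: F_def)
    also have "card (F i) \<le> (if i = 0 then 1 else 3)"
    proof (cases "i = 0")
      case True
      have "card (F i) \<le> card {..<p ^ i}" by (intro card_mono) (auto simp: F_def)
      then show ?thesis using True by simp
    next
      case False
      then show ?thesis using card_cube_roots_mod_prime_power[OF p, of i] by (simp add: F_def)
    qed
    finally show ?thesis by simp
  qed
  ultimately show ?thesis by (meson card_mono finite_subset le_trans)
qed

text \<open>The 3 accounts for the cube roots in \<open>orders_of_index_bound\<close>, and
  \<open>n = 0\<close> gives equality. The factor 4 fits the induction for the upper bound: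
  \<open>p ^ n + 4 * p ^ n \<le> p ^ (n + 1)\<close> as \<open>p \<ge> 5\<close>.\<close>

lemma geometric_sum_bound:
  assumes "(p::nat) \<ge> 5"
  shows "(\<Sum>t<Suc n. p ^ t) + 3 \<le> 4 * p ^ n"
proof (induction n)
  case (Suc n)
  have "(\<Sum>t<Suc (Suc n). p ^ t) + 3 \<le> 4 * p ^ n + p ^ Suc n" using Suc by simp
  also have "4 * p ^ n \<le> 3 * p * p ^ n" using assms by (intro mult_right_mono) auto
  finally show ?case by simp
qed simp

lemma num_orders_eq: "num_orders K p n = card (\<Union>i\<le>n. orders_of_index (p ^ i))"
  unfolding num_orders_def orders_of_index_def by (rule arg_cong[where f = card]) auto

theorem num_orders_le:
  assumes p: "prime p" "p \<noteq> 2" "p \<noteq> 3"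
  shows "num_orders K p n \<le> p ^ n"
proof -
  have p5: "p \<ge> 5"
  proof (rule ccontr)
    assume "\<not> p \<ge> 5"
    then have "p = 0 \<or> p = 1 \<or> p = 2 \<or> p = 3 \<or> p = 4" by linarith
    moreover have "\<not> prime (4::nat)"
      using prime_product[of 2 2] by auto
    ultimately show False using p by auto
  qed
  have "num_orders K p n \<le> (\<Sum>i\<le>n. card (orders_of_index (p ^ i)))"
    unfolding num_orders_eq by (rule card_UN_le) simp
  also have "\<dots> \<le> p ^ n"
  proof (induction n)
    case 0
    show ?case using orders_of_index_bound[OF p(1,3), of 0] by simp
  next
    case (Suc n)
    have "card (orders_of_index (p ^ Suc n)) \<le> 3 + (\<Sum>t<Suc n. p ^ t)"
      using orders_of_index_bound[OF p(1,3), of "Suc n"] by simp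
    also have "\<dots> \<le> 4 * p ^ n" using geometric_sum_bound[OF p5, of n] by simp
    finally have "(\<Sum>i\<le>Suc n. card (orders_of_index (p ^ i))) \<le> p ^ n + 4 * p ^ n" using Suc by simp
    also have "\<dots> = 5 * p ^ n" by simp
    also have "\<dots> \<le> p * p ^ n" using p5 by (rule mult_le_mono1)
    finally show ?case by simp
  qed
  finally show ?thesis .
qed

text \<open>There is one lattice for each residue modulo \<open>p ^ k\<close>, all of index
  \<open>p ^ k * p ^ (2 * k)\<close>; this is the origin of \<open>n / 3\<close>.\<close>

theorem num_orders_ge:
  assumes p: "prime p" "p \<noteq> 3" and k: "3 * k \<le> n"
  shows "p ^ k \<le> num_orders K p n"
proof -
  define q where "q = int p"
  have q: "q > 0" unfolding q_def using prime_gt_0_nat[OF p(1)] by simp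
  \<comment> \<open>\<open>q ^ k\<close> times a lattice that contains \<open>q ^ k \<int>\<^sup>2\<close> is closed under multiplication.\<close>
  define L where "L j = lat (q ^ k) (q ^ k * int j) (q ^ (2 * k))" for j
  have elt_L: "elt x y z \<in> L j \<longleftrightarrow> (\<exists>i l. y = q ^ k * i \<and> z = q ^ k * (int j * i + q ^ k * l))" for x y z j
  proof -
    have "q ^ (2 * k) = q ^ k * q ^ k" by (simp add: mult_2 power_add)
    then show ?thesis unfolding L_def elt_in_lat_iff by (simp add: algebra_simps)
  qed
  have "inj_on L {..<p ^ k}"
  proof (rule inj_onI)
    fix j j' assume jj: "j \<in> {..<p ^ k}" "j' \<in> {..<p ^ k}" and eq: "L j = L j'"
    have "elt 0 (q ^ k) (q ^ k * int j) \<in> L j" unfolding elt_L by (intro exI[of _ 1] exI[of _ 0]) simp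
    then obtain i l where "q ^ k = q ^ k * i" "q ^ k * int j = q ^ k * (int j' * i + q ^ k * l)"
      unfolding eq elt_L by blast
    then have "int j = int j' + q ^ k * l" using q by simp
    then have "[int j = int j'] (mod q ^ k)" by (simp add: cong_iff_dvd_diff)
    then have "[j = j'] (mod p ^ k)" unfolding q_def by (simp only: of_nat_power[symmetric] cong_int_iff)
    then show "j = j'" using jj by (simp add: cong_def)
  qed
  then have "p ^ k = card (L ` {..<p ^ k})" by (simp add: card_image)
  also have "\<dots> \<le> card (\<Union>i\<le>n. orders_of_index (p ^ i))"
  proof (rule card_mono)
    show "finite (\<Union>i\<le>n. orders_of_index (p ^ i))" using orders_of_index_bound[OF p] by blast
    show "L ` {..<p ^ k} \<subseteq> (\<Union>i\<le>n. orders_of_index (p ^ i))"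
    proof (rule image_subsetI)
      fix j
      have "order_index K (L j) = nat (q ^ k * q ^ (2 * k))" unfolding L_def using q by (intro order_index_lat) auto
      also have "q ^ k * q ^ (2 * k) = int (p ^ (3 * k))" unfolding q_def by (simp flip: power_add)
      finally have "order_index K (L j) = p ^ (3 * k)" by (simp only: nat_int)
      moreover have "is_order_of K (L j)"
        unfolding L_def
      proof (rule lat_is_order, unfold L_def[symmetric])
        fix y z y' z' assume "elt 0 y z \<in> L j" "elt 0 y' z' \<in> L j"
        then obtain i l i' l' where *: "y = q ^ k * i" "z = q ^ k * (int j * i + q ^ k * l)"
          "y' = q ^ k * i'" "z' = q ^ k * (int j * i' + q ^ k * l')" unfolding elt_L by blast
        define A where "A = a * (int j * i + q ^ k * l) * (int j * i' + q ^ k * l')"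
        have "a * z * z' = q ^ k * (q ^ k * A)" unfolding * A_def by (simp add: mult_ac)
        moreover have "b * y * y' = q ^ k * (int j * (q ^ k * A) + q ^ k * (b * i * i' - int j * A))"
          unfolding * by (simp add: algebra_simps)
        ultimately show "elt 0 (a * z * z') (b * y * y') \<in> L j" unfolding elt_L by blast
      qed (use q in auto)
      ultimately show "L j \<in> (\<Union>i\<le>n. orders_of_index (p ^ i))" using k unfolding orders_of_index_def by blast
    qed
  qed
  finally show ?thesis unfolding num_orders_eq .
qed

end

section \<open>Monogenic orders\<close>

context pure_cubic
begin

text \<open>Up to integers, the square of \<open>elt 0 y z\<close> is
  \<open>elt 0 (a * z ^ 2) (b * y ^ 2)\<close>. So this is the span of \<open>1\<close>,
  \<open>\<alpha>\<close> and \<open>\<alpha> ^ 2\<close> for \<open>\<alpha> = elt x y z\<close>,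
  whatever \<open>x\<close> is.\<close>

definition monogenic_lat :: "int \<Rightarrow> int \<Rightarrow> real set" where
  "monogenic_lat y z = {elt u (y * i + a * z ^ 2 * j) (z * i + b * y ^ 2 * j) | u i j. True}"

lemma elt_in_monogenic_lat_iff:
  "elt x y' z' \<in> monogenic_lat y z \<longleftrightarrow> (\<exists>i j. y' = y * i + a * z ^ 2 * j \<and> z' = z * i + b * y ^ 2 * j)"
  unfolding monogenic_lat_def by (auto simp: elt_eq_iff)

theorem int_adjoin_elt: "int_adjoin (elt x y z) = monogenic_lat y z"
proof
  let ?R = "ring_of_type_algebra :: real ring"
  show "int_adjoin (elt x y z) \<subseteq> monogenic_lat y z"
  proof
    fix h assume "h \<in> int_adjoin (elt x y z)"
    then show "h \<in> monogenic_lat y z" unfolding int_adjoin_def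
    proof (induction rule: generate_ring.induct)
      case one
      have "elt 1 0 0 \<in> monogenic_lat y z" unfolding elt_in_monogenic_lat_iff by (intro exI[of _ 0]) simp
      then show ?case by (simp add: ring_of_type_algebra_simps elt_def)
    next
      case (incl h)
      have "elt x y z \<in> monogenic_lat y z" unfolding elt_in_monogenic_lat_iff
        by (intro exI[of _ 1] exI[of _ 0]) simp
      then show ?case using incl by simp
    next
      case (a_inv h)
      then obtain u i j where h: "h = elt u (y * i + a * z ^ 2 * j) (z * i + b * y ^ 2 * j)"
        unfolding monogenic_lat_def by blast
      have "- h \<in> monogenic_lat y z" unfolding h elt_minus elt_in_monogenic_lat_iff
        by (intro exI[of _ "- i"] exI[of _ "- j"]) simp
      then show ?case by (simp only: a_inv_ring_of_type_algebra)
    next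
      case (eng_add h1 h2)
      obtain u1 i1 j1 where h1: "h1 = elt u1 (y * i1 + a * z ^ 2 * j1) (z * i1 + b * y ^ 2 * j1)"
        using eng_add.IH(1) unfolding monogenic_lat_def by blast
      obtain u2 i2 j2 where h2: "h2 = elt u2 (y * i2 + a * z ^ 2 * j2) (z * i2 + b * y ^ 2 * j2)"
        using eng_add.IH(2) unfolding monogenic_lat_def by blast
      have "h1 + h2 \<in> monogenic_lat y z" unfolding h1 h2 elt_add elt_in_monogenic_lat_iff
        by (intro exI[of _ "i1 + i2"] exI[of _ "j1 + j2"]) (simp add: algebra_simps)
      then show ?case by (simp only: ring_of_type_algebra_simps)
    next
      case (eng_mult h1 h2)
      obtain u1 i1 j1 where h1: "h1 = elt u1 (y * i1 + a * z ^ 2 * j1) (z * i1 + b * y ^ 2 * j1)"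
        using eng_mult.IH(1) unfolding monogenic_lat_def by blast
      obtain u2 i2 j2 where h2: "h2 = elt u2 (y * i2 + a * z ^ 2 * j2) (z * i2 + b * y ^ 2 * j2)"
        using eng_mult.IH(2) unfolding monogenic_lat_def by blast
      \<comment> \<open>With \<open>\<alpha> = elt 0 y z\<close> and
        \<open>\<beta> = elt 0 (a * z ^ 2) (b * y ^ 2)\<close>, up to integers:
        \<open>\<alpha> ^ 2\<close> is \<open>\<beta>\<close>, \<open>\<alpha> * \<beta>\<close> is
        \<open>a * b * y * z * \<alpha>\<close>, and \<open>\<beta> ^ 2\<close> is \<open>(a * b ^ 2
        * y ^ 3 + a ^ 2 * b * z ^ 3) * \<alpha> - a * b * y * z * \<beta>\<close>.\<close>
      define I J where "I = u1 * i2 + i1 * u2 + a * b * y * z * (i1 * j2 + i2 * j1) + (a * b ^ 2 * y ^ 3 + a ^ 2 * b * z ^ 3) * j1 * j2"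
        and "J = u1 * j2 + j1 * u2 + i1 * i2 - a * b * y * z * j1 * j2"
      have "h1 * h2 \<in> monogenic_lat y z" unfolding h1 h2 elt_mult elt_in_monogenic_lat_iff
        by (intro exI[of _ I] exI[of _ J])
           (simp add: I_def J_def algebra_simps power2_eq_square power3_eq_cube)
      then show ?case by (simp only: ring_of_type_algebra_simps)
    qed
  qed
  interpret cring ?R by (rule cring_from_type_algebra)
  let ?G = "int_adjoin (elt x y z)"
  have sub: "subring ?G ?R"
    unfolding int_adjoin_def by (rule generate_ring_is_subring) (simp add: ring_of_type_algebra_simps)
  then have G: "\<And>u v. u \<in> ?G \<Longrightarrow> v \<in> ?G \<Longrightarrow> u + v \<in> ?G" "\<And>u v. u \<in> ?G \<Longrightarrow> v \<in> ?G \<Longrightarrow> u * v \<in> ?G"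
    unfolding subring_ring_of_type_algebra_iff by blast+
  note Gint = subring_add_elt[OF sub]
  have "elt x y z \<in> ?G" unfolding int_adjoin_def by (rule generate_ring.incl) simp
  then have g1: "elt 0 y z \<in> ?G" using Gint(3)[of x y z] by blast
  have "elt 0 y z * elt 0 y z \<in> ?G" by (rule G(2)[OF g1 g1])
  then have "elt 0 (0 * y + y * 0 + a * z * z) (0 * z + z * 0 + b * y * y) \<in> ?G"
    unfolding elt_mult by (rule Gint(3)[THEN iffD1])
  then have g2: "elt 0 (a * z ^ 2) (b * y ^ 2) \<in> ?G" by (simp add: power2_eq_square mult.assoc)
  show "monogenic_lat y z \<subseteq> ?G"
  proof
    fix h assume "h \<in> monogenic_lat y z"
    then obtain u i j where h: "h = elt u (y * i + a * z ^ 2 * j) (z * i + b * y ^ 2 * j)"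
      unfolding monogenic_lat_def by blast
    have "h = of_int u + of_int i * elt 0 y z + of_int j * elt 0 (a * z ^ 2) (b * y ^ 2)"
      unfolding h elt_def by (simp add: algebra_simps)
    moreover have "\<dots> \<in> ?G" by (intro G(1) Gint(1,2) g1 g2)
    ultimately show "h \<in> ?G" by (simp only:)
  qed
qed

text \<open>Two bases of one lattice have the same determinant up to sign: \<open>e * g\<close> for
  the Hermite basis, \<open>b * y ^ 3 - a * z ^ 3\<close> for \<open>(y, z)\<close> and
  \<open>(a * z ^ 2, b * y ^ 2)\<close>. Expressing each basis in the other makes the determinants
  divide each other.\<close>

lemma index_form:
  assumes "lat e f g = monogenic_lat y z" "e > 0" "g > 0"
  shows "\<bar>b * y ^ 3 - a * z ^ 3\<bar> = e * g"
proof -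
  define D where "D = b * y ^ 3 - a * z ^ 3"
  have "elt 0 y z \<in> lat e f g" unfolding assms(1) elt_in_monogenic_lat_iff
    by (intro exI[of _ 1] exI[of _ 0]) simp
  then obtain k1 l1 where 1: "y = e * k1" "z = f * k1 + g * l1" unfolding elt_in_lat_iff by blast
  have "elt 0 (a * z ^ 2) (b * y ^ 2) \<in> lat e f g" unfolding assms(1) elt_in_monogenic_lat_iff
    by (intro exI[of _ 0] exI[of _ 1]) simp
  then obtain k2 l2 where 2: "a * z ^ 2 = e * k2" "b * y ^ 2 = f * k2 + g * l2" unfolding elt_in_lat_iff by blast
  have "D = y * (b * y ^ 2) - z * (a * z ^ 2)" by (simp add: D_def power2_eq_square power3_eq_cube)
  also have "\<dots> = (e * k1) * (f * k2 + g * l2) - (f * k1 + g * l1) * (e * k2)"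
    unfolding 2 by (simp only: 1)
  also have "\<dots> = (e * g) * (k1 * l2 - l1 * k2)" by (simp add: algebra_simps)
  finally have d1: "e * g dvd D" by simp
  have "elt 0 e f \<in> monogenic_lat y z" unfolding assms(1)[symmetric] elt_in_lat_iff
    by (intro exI[of _ 1] exI[of _ 0]) simp
  then obtain i1 j1 where 3: "e = y * i1 + a * z ^ 2 * j1" "f = z * i1 + b * y ^ 2 * j1"
    unfolding elt_in_monogenic_lat_iff by blast
  have "elt 0 0 g \<in> monogenic_lat y z" unfolding assms(1)[symmetric] elt_in_lat_iff
    by (intro exI[of _ 0] exI[of _ 1]) simp
  then obtain i2 j2 where 4: "0 = y * i2 + a * z ^ 2 * j2" "g = z * i2 + b * y ^ 2 * j2"
    unfolding elt_in_monogenic_lat_iff by blast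
  have "e * g = e * g - f * 0" by simp
  also have "\<dots> = (y * i1 + a * z ^ 2 * j1) * (z * i2 + b * y ^ 2 * j2) - (z * i1 + b * y ^ 2 * j1) * (y * i2 + a * z ^ 2 * j2)"
    by (simp only: 3[symmetric] 4[symmetric])
  also have "\<dots> = D * (i1 * j2 - i2 * j1)"
    by (simp add: D_def algebra_simps power2_eq_square power3_eq_cube)
  finally have "D dvd e * g" by simp
  with d1 have "\<bar>D\<bar> = \<bar>e * g\<bar>" by (intro zdvd_antisym_abs)
  then show ?thesis using assms(2,3) by (simp add: D_def)
qed

text \<open>If \<open>p dvd a\<close>, then \<open>p dvd y\<close>, and \<open>p ^ 2\<close>
  dividing the form would imply \<open>p ^ 2 dvd a * z ^ 3\<close>, so \<open>p dvd z\<close> by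
  squarefreeness of \<open>a\<close>. The case \<open>p dvd b\<close> is symmetric.\<close>

lemma exponent_le_1_of_ramified:
  fixes p :: int
  assumes p: "prime p" "p dvd a \<or> p dvd b" and eq: "\<bar>b * y ^ 3 - a * z ^ 3\<bar> = p ^ i"
    and prim: "\<not> (p dvd y \<and> p dvd z)"
  shows "i \<le> 1"
proof (rule ccontr)
  assume "\<not> i \<le> 1"
  then have "p ^ 2 dvd p ^ i" by (intro le_imp_power_dvd) simp
  then have p2: "p ^ 2 dvd b * y ^ 3 - a * z ^ 3" unfolding eq[symmetric] by simp
  have "p dvd p ^ 2" by simp
  then have p1: "p dvd b * y ^ 3 - a * z ^ 3" using p2 by (rule dvd_trans)
  have sq: "p ^ 2 dvd c * w ^ 3" if "p dvd w" for c w :: int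
  proof -
    have "p ^ 2 dvd w ^ 2" using that by (rule dvd_power_same)
    then show ?thesis by (simp add: power3_eq_cube power2_eq_square)
  qed
  have cop: "p ^ 2 dvd c" if "p ^ 2 dvd c * w ^ 3" "\<not> p dvd w" for c w :: int
  proof -
    have "coprime (p ^ 2) (w ^ 3)" using that(2) p(1) by (simp add: prime_imp_coprime)
    then show ?thesis using that(1) by (simp only: coprime_dvd_mult_left_iff)
  qed
  show False
  proof (cases "p dvd a")
    case True
    then have na: "\<not> p ^ 2 dvd a" "\<not> p dvd b" using prime_dvd_a[OF p(1)] by auto
    have "p dvd b * y ^ 3" using p1 True by (simp add: dvd_diff_left_iff)
    then have y: "p dvd y" using p(1) na by (auto simp: prime_dvd_mult_iff prime_dvd_power_iff)
    have "p ^ 2 dvd a * z ^ 3" using p2 sq[OF y, of b] by (simp add: dvd_diff_right_iff)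
    then show False using cop prim y na by blast
  next
    case False
    then have pb: "p dvd b" using p(2) by blast
    then have nb: "\<not> p ^ 2 dvd b" using prime_dvd_b[OF p(1)] by auto
    have "p dvd a * z ^ 3" using p1 pb by (simp add: dvd_diff_right_iff)
    then have z: "p dvd z" using p(1) False by (auto simp: prime_dvd_mult_iff prime_dvd_power_iff)
    have "p ^ 2 dvd b * y ^ 3" using p2 sq[OF z, of a] by (simp add: dvd_diff_left_iff)
    then show False using cop prim z nb by blast
  qed
qed

definition primitive_solutions :: "int \<Rightarrow> (int \<times> int) set" where
  "primitive_solutions p = {(y, z). \<not> (p dvd y \<and> p dvd z) \<and> (\<exists>i. \<bar>b * y ^ 3 - a * z ^ 3\<bar> = p ^ i)}"

text \<open>Multiplication by \<open>b ^ 2\<close> turns the form into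
  \<open>U ^ 3 - m * z ^ 3\<close> with \<open>U = b * y\<close>. The Thue-Mahler theorem asks for
  \<open>p\<close> prime to \<open>m\<close>; for \<open>p\<close> dividing \<open>a * b\<close> the
  exponent is at most 1, and four Thue equations remain.\<close>

theorem finite_primitive_solutions:
  fixes p :: int
  assumes p: "prime p" "p \<noteq> 3"
  shows "finite (primitive_solutions p)"
proof -
  define m where "m = a * b ^ 2"
  have m: "m \<noteq> 0" using a_nonzero b_nonzero by (simp add: m_def)
  have inj: "inj (\<lambda>(y, z). (b * y, z))" using b_nonzero by (auto simp: inj_def)
  have key: "(b * y) ^ 3 - m * z ^ 3 = b ^ 2 * (b * y ^ 3 - a * z ^ 3)" for y z
    by (simp add: m_def algebra_simps power2_eq_square power3_eq_cube)
  have p0: "p \<noteq> 0" using p(1) by auto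
  show ?thesis
  proof (cases "p dvd a \<or> p dvd b")
    case True
    define T where "T c = {(U, V). U ^ 3 - m * V ^ 3 = b ^ 2 * c}" for c
    have fin: "finite (T c)" if "c \<noteq> 0" for c
      unfolding T_def using that b_nonzero m by (intro finite_cubic_thue) auto
    have "primitive_solutions p \<subseteq> (\<lambda>(y, z). (b * y, z)) -` (T 1 \<union> T (-1) \<union> T p \<union> T (- p))"
    proof (rule subsetI, clarify)
      fix y z assume "(y, z) \<in> primitive_solutions p"
      then obtain i where i: "\<not> (p dvd y \<and> p dvd z)" "\<bar>b * y ^ 3 - a * z ^ 3\<bar> = p ^ i"
        unfolding primitive_solutions_def by blast
      have "i \<le> 1" using exponent_le_1_of_ramified[OF p(1) True i(2,1)] .
      then have "i = 0 \<or> i = 1" by auto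
      then have "b * y ^ 3 - a * z ^ 3 = 1 \<or> b * y ^ 3 - a * z ^ 3 = -1 \<or> b * y ^ 3 - a * z ^ 3 = p \<or> b * y ^ 3 - a * z ^ 3 = - p"
        using i(2) by auto
      then show "(y, z) \<in> (\<lambda>(y, z). (b * y, z)) -` (T 1 \<union> T (-1) \<union> T p \<union> T (- p))"
        unfolding vimage_def T_def by (auto simp: key)
    qed
    moreover have "finite ((\<lambda>(y, z). (b * y, z)) -` (T 1 \<union> T (-1) \<union> T p \<union> T (- p)))"
      using fin p0 by (intro finite_vimageI[OF _ inj]) auto
    ultimately show ?thesis by (rule finite_subset)
  next
    case False
    then have pm: "\<not> p dvd m" unfolding m_def using p(1) by (auto simp: prime_dvd_mult_iff prime_dvd_power_iff)
    define T where "T c = {(U, V). \<not> (p dvd U \<and> p dvd V) \<and> (\<exists>i. U ^ 3 - m * V ^ 3 = c * p ^ i)}" for c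
    have fin: "finite (T c)" if "c \<noteq> 0" for c
      unfolding T_def using finite_cubic_thue_mahler[OF p pm that] .
    have "primitive_solutions p \<subseteq> (\<lambda>(y, z). (b * y, z)) -` (T (b ^ 2) \<union> T (- (b ^ 2)))"
    proof (rule subsetI, clarify)
      fix y z assume "(y, z) \<in> primitive_solutions p"
      then obtain i where i: "\<not> (p dvd y \<and> p dvd z)" "\<bar>b * y ^ 3 - a * z ^ 3\<bar> = p ^ i"
        unfolding primitive_solutions_def by blast
      have "\<not> (p dvd b * y \<and> p dvd z)" using i(1) False p(1) by (auto simp: prime_dvd_mult_iff)
      moreover have "b * y ^ 3 - a * z ^ 3 = p ^ i \<or> b * y ^ 3 - a * z ^ 3 = - (p ^ i)" using i(2) by linarith
      then have "(b * y) ^ 3 - m * z ^ 3 = b ^ 2 * p ^ i \<or> (b * y) ^ 3 - m * z ^ 3 = - (b ^ 2) * p ^ i"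
        unfolding key by auto
      ultimately show "(y, z) \<in> (\<lambda>(y, z). (b * y, z)) -` (T (b ^ 2) \<union> T (- (b ^ 2)))"
        unfolding vimage_def T_def mem_Collect_eq Un_iff case_prod_conv by blast
    qed
    moreover have "finite ((\<lambda>(y, z). (b * y, z)) -` (T (b ^ 2) \<union> T (- (b ^ 2))))"
      using fin b_nonzero by (intro finite_vimageI[OF _ inj]) auto
    ultimately show ?thesis by (rule finite_subset)
  qed
qed

text \<open>Dividing a common factor \<open>p\<close> out of \<open>y\<close> and \<open>z\<close>
  lowers the exponent by 3, so the descent ends.\<close>

lemma solution_from_primitive:
  fixes p :: int
  assumes p: "prime p"
  shows "\<bar>b * y ^ 3 - a * z ^ 3\<bar> = p ^ i \<Longrightarrow>
    \<exists>k\<le>i. \<exists>(y0, z0)\<in>primitive_solutions p. y = p ^ k * y0 \<and> z = p ^ k * z0"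
proof (induction i arbitrary: y z rule: less_induct)
  case (less i)
  have p1: "p > 1" using prime_gt_1_int[OF p] .
  show ?case
  proof (cases "p dvd y \<and> p dvd z")
    case False
    then have "(y, z) \<in> primitive_solutions p" unfolding primitive_solutions_def using less.prems by blast
    then show ?thesis by (intro exI[of _ 0]) auto
  next
    case True
    then obtain y' z' where yz: "y = p * y'" "z = p * z'" by (auto elim!: dvdE)
    have "b * y ^ 3 - a * z ^ 3 = p ^ 3 * (b * y' ^ 3 - a * z' ^ 3)"
      unfolding yz by (simp add: algebra_simps power3_eq_cube)
    then have eq: "p ^ 3 * \<bar>b * y' ^ 3 - a * z' ^ 3\<bar> = p ^ i"
      using less.prems p1 by (simp add: abs_mult)
    then have "p ^ 3 dvd p ^ i" by (metis dvd_triv_left)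
    then have "p ^ 3 \<le> p ^ i" using p1 by (intro zdvd_imp_le) auto
    then have "3 \<le> i" by (rule power_le_imp_le_exp[OF p1])
    then have "p ^ i = p ^ 3 * p ^ (i - 3)" by (simp flip: power_add)
    then have "\<bar>b * y' ^ 3 - a * z' ^ 3\<bar> = p ^ (i - 3)" using eq p1 by simp
    moreover have "i - 3 < i" using \<open>3 \<le> i\<close> by simp
    ultimately obtain k y0 z0 where k: "k \<le> i - 3" "(y0, z0) \<in> primitive_solutions p"
      "y' = p ^ k * y0" "z' = p ^ k * z0" using less.IH[of "i - 3" y' z'] by blast
    then have "y = p ^ Suc k * y0" "z = p ^ Suc k * z0" "Suc k \<le> i"
      using \<open>3 \<le> i\<close> by (auto simp: yz)
    then show ?thesis using k(2) by blast
  qed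
qed

text \<open>A monogenic order is determined by \<open>(y, z)\<close>, hence by a power
  \<open>k \<le> n\<close> of \<open>p\<close> and one of finitely many primitive pairs.\<close>

theorem num_monogenic_orders_le:
  assumes p: "prime p" "p \<noteq> 3"
  shows "num_monogenic_orders K p n \<le> (n + 1) * card (primitive_solutions (int p))"
proof -
  let ?F = "primitive_solutions (int p)"
  define W where "W = (\<lambda>(k, y, z). monogenic_lat (int p ^ k * y) (int p ^ k * z)) ` ({..n} \<times> ?F)"
  have fin: "finite ({..n} \<times> ?F)" using finite_primitive_solutions[of "int p"] p by simp
  have "{R. is_order_of K R \<and> is_monogenic R \<and> (\<exists>i\<in>{0..n}. order_index K R = p ^ i)} \<subseteq> W"
  proof (rule subsetI, clarify)
    fix R i assume order: "is_order_of K R" and mono: "is_monogenic R" and i: "i \<in> {0..n}" "order_index K R = p ^ i"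
    have sub: "R \<subseteq> \<O>" "subring R ring_of_type_algebra"
      using is_order_of_subset[OF order] order unfolding is_order_of_def by blast+
    obtain x y z where "R = int_adjoin (elt x y z)"
      using mono sub(1) unfolding is_monogenic_def \<O>_def by blast
    then have Rm: "R = monogenic_lat y z" unfolding int_adjoin_elt .
    have "order_index K R \<noteq> 0" unfolding i(2) using prime_gt_0_nat[OF p(1)] by simp
    with sub obtain e f g where efg: "e > 0" "g > 0" "R = lat e f g"
      by (rule finite_index_subring_is_lat)
    have "nat (e * g) = p ^ i" using order_index_lat[OF efg(1,2), of f] i(2) efg(3) by simp
    then have "e * g = int p ^ i" using efg(1,2) by (metis int_nat_eq less_imp_le mult_pos_pos of_nat_power)
    moreover have "\<bar>b * y ^ 3 - a * z ^ 3\<bar> = e * g" using index_form[of e f g y z] efg Rm by simp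
    ultimately have "\<bar>b * y ^ 3 - a * z ^ 3\<bar> = int p ^ i" by simp
    then obtain k y0 z0 where k: "k \<le> i" "(y0, z0) \<in> ?F" "y = int p ^ k * y0" "z = int p ^ k * z0"
      using solution_from_primitive[of "int p" y z i] p(1) by auto
    then show "R \<in> W" unfolding W_def Rm using i(1) by (intro image_eqI[of _ _ "(k, y0, z0)"]) auto
  qed
  then have "num_monogenic_orders K p n \<le> card W"
    unfolding num_monogenic_orders_def using fin by (intro card_mono) (auto simp: W_def)
  also have "\<dots> \<le> card ({..n} \<times> ?F)" unfolding W_def by (rule card_image_le[OF fin])
  finally show ?thesis by (simp only: card_cartesian_product card_atMost Suc_eq_plus1)
qed

end

section \<open>Assembly of the estimates\<close>

lemma pure_cubic_decomposition:
  fixes m :: int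
  assumes "cube_free m" "\<not> [m\<^sup>2 = 1] (mod 9)"
  obtains a b where "m = a * b ^ 2" "pure_cubic a b"
proof -
  define a b where "a = squarefree_part m" and "b = square_part m"
  have m: "m = a * b ^ 2" unfolding a_def b_def by (rule squarefree_decompose)
  have unit: "d dvd 1" if "d ^ 3 dvd m" for d using assms(1) that unfolding cube_free_def by blast
  have "squarefree b"
  proof (rule squarefreeI)
    fix d assume "d ^ 2 dvd b"
    then have "(d ^ 2) ^ 2 dvd b ^ 2" by (rule dvd_power_same)
    then have "d ^ 3 * d dvd m" unfolding m by (simp add: power2_eq_square power3_eq_cube mult.assoc)
    then show "d dvd 1" using unit dvd_mult_left by blast
  qed
  moreover have "coprime a b"
  proof (rule coprimeI)
    fix d assume "d dvd a" "d dvd b"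
    then have "d * d ^ 2 dvd a * b ^ 2" by (intro mult_dvd_mono dvd_power_same)
    moreover have "d * d ^ 2 = d ^ 3" by (simp add: power2_eq_square power3_eq_cube)
    ultimately have "d ^ 3 dvd m" unfolding m by (simp only:)
    then show "d dvd 1" by (rule unit)
  qed
  moreover have "squarefree a" unfolding a_def by (rule squarefree_squarefree_part)
  ultimately have "pure_cubic a b" using assms unfolding m by (intro pure_cubic.intro)
  then show thesis using that m by blast
qed

text \<open>Since \<open>n + 1 \<le> 3 * (n div 3 + 1)\<close>, the quotient is bounded by a null
  sequence evaluated at \<open>n div 3\<close>, which tends to infinity.\<close>

lemma linear_over_exponential_tendsto_0:
  fixes C q :: real
  assumes "q > 1"
  shows "(\<lambda>n. real (n + 1) * C / q ^ (n div 3)) \<longlonglongrightarrow> 0"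
proof -
  define h where "h k = 3 * \<bar>C\<bar> * (real k * (1 / q) ^ k + (1 / q) ^ k)" for k :: nat
  have "h \<longlonglongrightarrow> 3 * \<bar>C\<bar> * (0 + 0)"
    unfolding h_def using assms
    by (intro tendsto_intros powser_times_n_limit_0 LIMSEQ_power_zero) auto
  moreover have "filterlim (\<lambda>n::nat. n div 3) at_top sequentially"
    unfolding filterlim_at_top
  proof
    fix Z :: nat
    show "eventually (\<lambda>n. Z \<le> n div 3) sequentially"
      using eventually_ge_at_top[of "3 * Z"] by eventually_elim auto
  qed
  ultimately have lim: "(\<lambda>n. h (n div 3)) \<longlonglongrightarrow> 0" by (auto intro: filterlim_compose)
  have "\<bar>real (n + 1) * C / q ^ (n div 3)\<bar> \<le> h (n div 3)" for n
  proof -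
    have "n + 1 \<le> 3 * (n div 3 + 1)" by presburger
    then have "real (n + 1) \<le> real (3 * (n div 3 + 1))" by (simp only: of_nat_le_iff)
    then have "real (n + 1) \<le> 3 * (real (n div 3) + 1)" by simp
    then have "real (n + 1) * (\<bar>C\<bar> / q ^ (n div 3)) \<le> 3 * (real (n div 3) + 1) * (\<bar>C\<bar> / q ^ (n div 3))"
      using assms by (intro mult_right_mono) auto
    also have "3 * (real (n div 3) + 1) * (\<bar>C\<bar> / q ^ (n div 3)) = h (n div 3)"
      by (simp add: h_def power_divide algebra_simps)
    also have "real (n + 1) * (\<bar>C\<bar> / q ^ (n div 3)) = \<bar>real (n + 1) * C / q ^ (n div 3)\<bar>"
      using assms by (simp add: abs_mult del: of_nat_Suc of_nat_add)
    finally show ?thesis .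
  qed
  then have "norm (real (n + 1) * C / q ^ (n div 3)) \<le> norm (h (n div 3)) * 1" for n
    by (metis abs_ge_self mult.right_neutral order_trans real_norm_def)
  then show ?thesis by (intro tendsto_0_le[OF lim] always_eventually allI)
qed

theorem theorem1p1:
  fixes m :: int and p :: nat and K :: "real set"
  assumes "cube_free m"
    and "\<not> [m\<^sup>2 = 1] (mod 9)"
    and "K = rat_adjoin (root 3 (real_of_int m))"
    and "Factorial_Ring.prime p" and "p \<noteq> 2" and "p \<noteq> 3"
  shows "(\<forall>n::nat. real_of_int \<lfloor>real n / 3\<rfloor> \<le> log (real p) (real (num_orders K p n)) \<and>
                   log (real p) (real (num_orders K p n)) \<le> real n) \<and>
         (\<lambda>n. real (num_monogenic_orders K p n)) \<in> O(\<lambda>n. real n) \<and>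
         (\<lambda>n. real (num_monogenic_orders K p n) / real (num_orders K p n)) \<longlonglongrightarrow> 0"
proof -
  obtain a b where m: "m = a * b ^ 2" and pc: "pure_cubic a b"
    using pure_cubic_decomposition[OF assms(1,2)] by blast
  interpret pc: pure_cubic a b by (rule pc)
  have K: "K = pc.K" unfolding assms(3) m using pc.rat_adjoin_theta unfolding pc.\<theta>_def .
  have p1: "p > 1" using assms(4) by (rule prime_gt_1_nat)
  define A B where "A n = num_orders K p n" and "B n = num_monogenic_orders K p n" for n
  have A_le: "A n \<le> p ^ n" for n
    unfolding A_def K using pc.num_orders_le[OF assms(4,5,6)] .
  have A_ge: "p ^ (n div 3) \<le> A n" for n
    unfolding A_def K by (rule pc.num_orders_ge[OF assms(4,6)]) simp
  obtain C where B_le: "\<And>n. B n \<le> (n + 1) * C"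
    unfolding B_def K using pc.num_monogenic_orders_le[OF assms(4,6)] by blast
  have A_pos: "0 < A n" for n using A_ge[of n] p1 by (metis less_le_trans zero_less_power less_trans zero_less_one)
  have rp: "real p > 1" using p1 by simp
  have A_ge': "real p ^ (n div 3) \<le> real (A n)" for n
    using A_ge[of n] by (simp flip: of_nat_power)
  have logs: "real_of_int \<lfloor>real n / 3\<rfloor> \<le> log (real p) (real (A n)) \<and> log (real p) (real (A n)) \<le> real n" for n
  proof
    have "\<lfloor>real n / 3\<rfloor> = int (n div 3)" using floor_divide_of_nat_eq[of n 3] by simp
    moreover have "real (n div 3) \<le> log (real p) (real (A n))"
      using A_ge'[of n] A_pos[of n] rp by (simp add: le_log_iff powr_realpow)
    ultimately show "real_of_int \<lfloor>real n / 3\<rfloor> \<le> log (real p) (real (A n))" by simp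
    have "real (A n) \<le> real p ^ n" using A_le[of n] by (simp flip: of_nat_power)
    then show "log (real p) (real (A n)) \<le> real n"
      using A_pos[of n] rp by (simp add: log_le_iff powr_realpow)
  qed
  have B_le': "real (B n) \<le> real (n + 1) * real C" for n
    using B_le[of n] by (metis of_nat_le_iff of_nat_mult)
  have bigo: "(\<lambda>n. real (B n)) \<in> O(\<lambda>n. real n)"
  proof (rule bigoI)
    show "eventually (\<lambda>n. norm (real (B n)) \<le> 2 * real C * norm (real n)) sequentially"
      \<comment> \<open>At \<open>n = 0\<close> the comparison function is 0; from 1 on,
        \<open>n + 1 \<le> 2 * n\<close>.\<close>
      using eventually_ge_at_top[of 1]
    proof eventually_elim
      case (elim n)
      then have "real (n + 1) * real C \<le> (2 * real n) * real C" by (intro mult_right_mono) auto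
      then show ?case using B_le'[of n] by (simp add: mult_ac)
    qed
  qed
  have "norm (real (B n) / real (A n)) \<le> real (n + 1) * real C / real p ^ (n div 3)" for n
    using B_le'[of n] A_ge'[of n] A_pos[of n] p1 by (simp del: of_nat_add) (intro frac_le; simp)
  then have "norm (real (B n) / real (A n)) \<le> norm (real (n + 1) * real C / real p ^ (n div 3)) * 1" for n
    by (metis abs_ge_self mult.right_neutral order_trans real_norm_def)
  then have "(\<lambda>n. real (B n) / real (A n)) \<longlonglongrightarrow> 0"
    by (intro tendsto_0_le[OF linear_over_exponential_tendsto_0[OF rp]] always_eventually allI)
  with logs bigo show ?thesis unfolding A_def B_def by blast
qed

end
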